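(* Let $b$ be a non-extreme point of the closed unit ball of $H^\infty$, let $a$ be the unique outer function on the unit disk $\mathbb D$ with $a(0)>0$ and $|a|^2+|b|^2=1$ a.e. on $\mathbb T$, and let $\phi:=b/a$. Let $\mathcal H(b)$ be the de Branges–Rovnyak space with kernel $K(z,w)=\frac{1-b(z)\overline{b(w)}}{1-z\overline w}$. For $\alpha\ge0$ and $h\in\mathcal H(b)$ let $\sigma_n^\alpha(h):=\sum_{j=0}^n\binom{n}{j}\big/\binom{n+\alpha}{j}\,\hat h(j)z^j$, where $\hat h(j)$ are Taylor coefficients. If $\sigma_n^\alpha(h)\to h$ (weakly or in norm) in $\mathcal H(b)$ for all $h\in\mathcal H(b)$, then \[ \phi(z)=O\bigl((1-|z|)^{-\alpha-1/2}\bigr)\quad(|z|\to1^-). \]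
   Context: $H^\infty$ is the space of bounded holomorphic functions on $\mathbb D$ with sup-norm; $b$ non-extreme in its unit ball is equivalent to $\log(1-|b|^2)\in L^1(\mathbb T)$, which guarantees existence of the outer function $a$ (the Pythagorean complement of $b$); then $\phi=b/a$ lies in the Smirnov class. Binomial coefficients with non-integer arguments are defined via the Gamma function. *)

theory Defs
  imports "HOL-Analysis.Analysis"
begin

definition Hinf_ball :: "(complex \<Rightarrow> complex) \<Rightarrow> bool" where
  "Hinf_ball b \<longleftrightarrow> b holomorphic_on ball 0 1 \<and> (\<forall>z\<in>ball 0 1. cmod (b z) \<le> 1)"

definition Hinf :: "(complex \<Rightarrow> complex) \<Rightarrow> bool" where
  "Hinf c \<longleftrightarrow> c holomorphic_on ball 0 1 \<and> bounded (c ` ball 0 1)"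

text \<open>Extreme point of the closed unit ball of H-infinity: not the midpoint of two
  distinct points of the ball (functions are identified by their values on the disc).\<close>
definition extreme_Hinf :: "(complex \<Rightarrow> complex) \<Rightarrow> bool" where
  "extreme_Hinf b \<longleftrightarrow> Hinf_ball b \<and>
     \<not> (\<exists>c. Hinf c \<and> (\<exists>z\<in>ball 0 1. c z \<noteq> 0) \<and>
            Hinf_ball (\<lambda>z. b z + c z) \<and> Hinf_ball (\<lambda>z. b z - c z))"

definition radial_limit :: "(complex \<Rightarrow> complex) \<Rightarrow> real \<Rightarrow> complex \<Rightarrow> bool" where
  "radial_limit f t L \<longleftrightarrow> ((\<lambda>r. f (complex_of_real r * cis t)) \<longlongrightarrow> L) (at_left 1)"

text \<open>Outer function: c * exp of the Herglotz integral of an integrable real function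
  (log of the modulus weight), with |c| = 1.\<close>
definition outer :: "(complex \<Rightarrow> complex) \<Rightarrow> bool" where
  "outer a \<longleftrightarrow> (\<exists>c u. cmod c = 1 \<and> u absolutely_integrable_on {0..2*pi} \<and>
     (\<forall>z\<in>ball 0 1. a z = c * exp (integral {0..2*pi}
        (\<lambda>t. (cis t + z) / (cis t - z) * complex_of_real (u t)) / complex_of_real (2*pi))))"

definition dBR_kernel :: "(complex \<Rightarrow> complex) \<Rightarrow> complex \<Rightarrow> complex \<Rightarrow> complex" where
  "dBR_kernel b z w = (1 - b z * cnj (b w)) / (1 - z * cnj w)"

definition psd_kernel :: "(complex \<Rightarrow> complex \<Rightarrow> complex) \<Rightarrow> bool" where
  "psd_kernel L \<longleftrightarrow> (\<forall>(n::nat) (p::nat \<Rightarrow> complex) (c::nat \<Rightarrow> complex).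
     (\<forall>i<n. p i \<in> ball 0 1) \<longrightarrow>
     (let s = (\<Sum>i<n. \<Sum>j<n. c i * cnj (c j) * L (p i) (p j)) in s \<in> \<real> \<and> 0 \<le> Re s))"

text \<open>Reproducing kernel Hilbert space H(b) (Aronszajn): f belongs to H(K) iff
  C^2 K(z,w) - f(z) conj(f(w)) is positive semidefinite for some C, and the norm of f is
  the least such C.\<close>
definition in_Hb :: "(complex \<Rightarrow> complex) \<Rightarrow> (complex \<Rightarrow> complex) \<Rightarrow> bool" where
  "in_Hb b f \<longleftrightarrow> (\<exists>C::real. 0 \<le> C \<and>
     psd_kernel (\<lambda>z w. complex_of_real (C^2) * dBR_kernel b z w - f z * cnj (f w)))"

definition Hb_norm :: "(complex \<Rightarrow> complex) \<Rightarrow> (complex \<Rightarrow> complex) \<Rightarrow> real" where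
  "Hb_norm b f = Inf {C::real. 0 \<le> C \<and>
     psd_kernel (\<lambda>z w. complex_of_real (C^2) * dBR_kernel b z w - f z * cnj (f w))}"

text \<open>Inner product by polarization (linear in the first argument).\<close>
definition Hb_inner :: "(complex \<Rightarrow> complex) \<Rightarrow> (complex \<Rightarrow> complex) \<Rightarrow> (complex \<Rightarrow> complex) \<Rightarrow> complex" where
  "Hb_inner b f g = (\<Sum>k<(4::nat). \<i>^k * complex_of_real ((Hb_norm b (\<lambda>z. f z + \<i>^k * g z))^2)) / 4"

definition taylor_coeff :: "(complex \<Rightarrow> complex) \<Rightarrow> nat \<Rightarrow> complex" where
  "taylor_coeff h j = (deriv ^^ j) h 0 / of_nat (fact j)"

definition cesaro :: "real \<Rightarrow> nat \<Rightarrow> (complex \<Rightarrow> complex) \<Rightarrow> complex \<Rightarrow> complex" where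
  "cesaro \<alpha> n h z = (\<Sum>j=0..n. complex_of_real (real (n choose j) / ((real n + \<alpha>) gchoose j))
                        * taylor_coeff h j * z^j)"

definition Hb_norm_conv :: "(complex \<Rightarrow> complex) \<Rightarrow> (nat \<Rightarrow> complex \<Rightarrow> complex) \<Rightarrow> (complex \<Rightarrow> complex) \<Rightarrow> bool" where
  "Hb_norm_conv b F h \<longleftrightarrow> (\<forall>n. in_Hb b (F n)) \<and>
     (\<lambda>n. Hb_norm b (\<lambda>z. F n z - h z)) \<longlonglongrightarrow> 0"

definition Hb_weak_conv :: "(complex \<Rightarrow> complex) \<Rightarrow> (nat \<Rightarrow> complex \<Rightarrow> complex) \<Rightarrow> (complex \<Rightarrow> complex) \<Rightarrow> bool" where
  "Hb_weak_conv b F h \<longleftrightarrow> (\<forall>n. in_Hb b (F n)) \<and>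
     (\<forall>g. in_Hb b g \<longrightarrow> (\<lambda>n. Hb_inner b (F n) g) \<longlonglongrightarrow> Hb_inner b h g)"

end

theory Submission
  imports Defs "HOL-Complex_Analysis.Complex_Analysis"
begin

text \<open>
  The reproducing kernel of \<open>H(b)\<close> turns finite combinations \<open>l\<close> of point evaluations into a
  pre-Hilbert space with form \<open>Q l = \<Sum>m. \<bar>l(z\<^sup>m)\<bar>\<^sup>2 - \<bar>l(b z\<^sup>m)\<bar>\<^sup>2\<close>, and \<open>H(b)\<close> is its dual. This gives
  completeness and the parallelogram law without constructing the Hilbert space, hence, by two
  applications of uniform boundedness, a common bound \<open>M\<close> for the norms of the Cesaro operators.

  Since \<open>a\<close> is outer there are bounded \<open>g\<^sub>k\<close> with \<open>\<bar>a g\<^sub>k\<bar> \<le> 1\<close> and \<open>a g\<^sub>k \<rightarrow> 1\<close>. For \<open>f = a g\<^sub>0\<close> the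
  functions \<open>f z\<^sup>n\<close> have norm at most \<open>1\<close>, and the \<open>n\<close>-th Cesaro mean of \<open>f z\<^sup>n\<close> is
  \<open>f(0) z\<^sup>n\<close> divided by the binomial coefficient \<open>(n + \<alpha> choose n)\<close>; so the norm of \<open>z\<^sup>n\<close> is at most
  a constant multiple of this coefficient. On the other hand, testing with the Taylor coefficients
  of \<open>b g\<^sub>k q\<close>, \<open>q = \<Sum>j\<le>n. cnj \<phi>\<^sub>n\<^sub>-\<^sub>j z\<^sup>j\<close>, shows that the squared norm of \<open>z\<^sup>n\<close> is at
  least \<open>\<Sum>j\<le>n. \<bar>\<phi>\<^sub>j\<bar>\<^sup>2\<close>. The growth of \<open>\<phi>\<close> then follows from the Cauchy-Schwarz inequality and the
  binomial series.
\<close>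

section \<open>Power series on the disc and boundary comparison\<close>

text \<open>On the circle, \<open>q\<close> is the analytic part of \<open>cnj \<phi> * z^n\<close>.
  In the classical description of H(b) for non-extreme \<open>b\<close>, each element
  \<open>h\<close> has a companion \<open>h+\<close> in the Hardy space, determined by
  \<open>T(cnj b) h = T(cnj a) h+\<close> with Toeplitz operators \<open>T\<close>, and the squared
  norm of \<open>h\<close> is the sum of the squared Hardy norms of \<open>h\<close> and
  \<open>h+\<close>. For \<open>h = z^n\<close> the companion is \<open>q\<close>; this is its
  origin, although the proof only tests with it. The multipliers \<open>g\<^sub>k\<close>
  regularise: \<open>\<phi>\<close> is in general not square integrable on the circle, while
  replacing \<open>1/a\<close> by \<open>g\<^sub>k\<close> keeps the test functions bounded.

  Radial limits are supplied for \<open>a\<close> and \<open>b\<close> alone. Boundary inequalities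
  are therefore stated for squared moduli along radii, up to an error tending to zero, and reach the
  coefficients through Parseval's identity on circles of radius below 1.

  Of the two uses of uniform boundedness, one makes the Cesaro means of each fixed function bounded
  when they converge only weakly, the other bounds the operators uniformly in
  \<open>n\<close>.\<close>

definition pser :: "(complex \<Rightarrow> complex) \<Rightarrow> (nat \<Rightarrow> complex) \<Rightarrow> bool" where
  "pser F f \<longleftrightarrow> (\<forall>z\<in>ball 0 1. (\<lambda>j. f j * z ^ j) sums F z)"

lemma pser_sums: "pser F f \<Longrightarrow> cmod z < 1 \<Longrightarrow> (\<lambda>j. f j * z ^ j) sums F z"
  by (simp add: pser_def)

lemma pser_summable_norm:
  assumes "pser F f" "0 \<le> r" "r < 1"
  shows "summable (\<lambda>j. cmod (f j) * r ^ j)"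
proof -
  obtain s where s: "r < s" "s < 1" using assms dense by blast
  have "summable (\<lambda>j. f j * complex_of_real s ^ j)"
    using pser_sums[OF assms(1), of "complex_of_real s"] s assms by (auto simp: sums_iff)
  from powser_insidea[OF this, of "complex_of_real r"] s assms
  show ?thesis by (simp add: norm_mult norm_power)
qed

lemma pser_taylor:
  assumes "F holomorphic_on ball 0 1"
  shows "pser F (taylor_coeff F)"
  using holomorphic_power_series[OF assms] by (auto simp: pser_def taylor_coeff_def)

lemma pser_holomorphic:
  assumes "pser F f"
  shows "F holomorphic_on ball 0 1"
  by (rule power_series_holomorphic[where a = f]) (use assms in \<open>auto simp: pser_def\<close>)

text \<open>The bridge from explicit coefficient sequences, on which products are Cauchy products,
  back to \<open>taylor_coeff\<close>. It also serves as uniqueness of the coefficients.\<close>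

lemma taylor_coeff_pser:
  assumes "pser F f"
  shows "taylor_coeff F = f"
proof -
  have "fps_conv_radius (Abs_fps f) \<ge> ereal (1/2)"
    unfolding fps_conv_radius_def
    by (rule conv_radius_geI_ex')
       (use pser_sums[OF assms] in \<open>auto simp: sums_iff\<close>)
  then have pos: "fps_conv_radius (Abs_fps f) > 0"
    by (rule less_le_trans[rotated]) auto
  have "eventually (\<lambda>z. z \<in> ball (0::complex) 1) (nhds 0)"
    by (intro eventually_nhds_in_open) auto
  then have "eventually (\<lambda>z. eval_fps (Abs_fps f) z = F z) (nhds 0)"
    by eventually_elim (use pser_sums[OF assms] in \<open>auto simp: eval_fps_def sums_iff\<close>)
  then have "F has_fps_expansion Abs_fps f"
    using pos by (simp add: has_fps_expansion_def)
  from fps_nth_fps_expansion[OF this] show ?thesis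
    by (auto simp: taylor_coeff_def fun_eq_iff)
qed

lemma pser_cong:
  assumes "pser F f" "\<And>z. z \<in> ball 0 1 \<Longrightarrow> F z = G z"
  shows "pser G f"
  using assms by (auto simp: pser_def)

lemma pser_add:
  assumes "pser F f" "pser G g"
  shows "pser (\<lambda>z. F z + G z) (\<lambda>j. f j + g j)"
  using assms by (auto simp: pser_def algebra_simps intro!: sums_add)

lemma pser_cmult:
  assumes "pser F f"
  shows "pser (\<lambda>z. c * F z) (\<lambda>j. c * f j)"
  using assms by (auto simp: pser_def mult.assoc intro!: sums_mult)

lemma pser_mult:
  assumes "pser F f" "pser G g"
  shows "pser (\<lambda>z. F z * G z) (\<lambda>n. \<Sum>i\<le>n. f i * g (n - i))"
  unfolding pser_def
proof
  fix z :: complex assume "z \<in> ball 0 1"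
  then have z: "cmod z < 1" by simp
  have s: "summable (\<lambda>j. cmod (f j * z ^ j))" "summable (\<lambda>j. cmod (g j * z ^ j))"
    using pser_summable_norm[OF assms(1), of "cmod z"] pser_summable_norm[OF assms(2), of "cmod z"] z
    by (auto simp: norm_mult norm_power)
  from Cauchy_product_sums[OF this]
  have "(\<lambda>k. \<Sum>i\<le>k. f i * z ^ i * (g (k - i) * z ^ (k - i))) sums (F z * G z)"
    using pser_sums[OF assms(1) z] pser_sums[OF assms(2) z] by (simp add: sums_iff)
  moreover have "(\<Sum>i\<le>k. f i * z ^ i * (g (k - i) * z ^ (k - i))) = (\<Sum>i\<le>k. f i * g (k - i)) * z ^ k" for k
    unfolding sum_distrib_right
  proof (rule sum.cong)
    fix i assume "i \<in> {..k}"
    then have "z ^ k = z ^ i * z ^ (k - i)" by (simp flip: power_add)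
    then show "f i * z ^ i * (g (k - i) * z ^ (k - i)) = f i * g (k - i) * z ^ k" by simp
  qed simp
  ultimately show "(\<lambda>n. (\<Sum>i\<le>n. f i * g (n - i)) * z ^ n) sums (F z * G z)" by simp
qed

lemma pser_polynomial: "pser (\<lambda>z. \<Sum>j<d. f j * z ^ j) (\<lambda>j. if j < d then f j else 0)"
proof -
  have "(\<lambda>j. (if j < d then f j else 0) * z ^ j) sums (\<Sum>j<d. f j * z ^ j)" for z
    using sums_finite[of "{..<d}" "\<lambda>j. (if j < d then f j else 0) * z ^ j"] by simp
  then show ?thesis by (simp add: pser_def)
qed

section \<open>Orthogonality of the characters and Parseval's identity on circles inside the
  disc\<close>

lemma cis_has_integral:
  fixes m :: int
  shows "((\<lambda>t. cis (of_int m * t)) has_integral (if m = 0 then of_real (2*pi) else 0)) {0..2*pi}"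
proof (cases "m = 0")
  case True
  have "((\<lambda>t. 1::complex) has_integral (of_real (2*pi))) {0..2*pi}"
    using has_integral_const_real[of "1::complex" 0 "2*pi"] by (simp add: scaleR_conv_of_real)
  then show ?thesis using True by simp
next
  case False
  have "((\<lambda>t. cis (of_int m * t)) has_integral
      (cis (of_int m * (2*pi)) / (\<i> * of_int m) - cis (of_int m * 0) / (\<i> * of_int m))) {0..2*pi}"
  proof (rule fundamental_theorem_of_calculus)
    fix t :: real
    show "((\<lambda>t. cis (of_int m * t) / (\<i> * of_int m)) has_vector_derivative cis (of_int m * t))
        (at t within {0..2*pi})"
      unfolding cis_conv_exp using False
      by (auto intro!: derivative_eq_intros has_vector_derivative_real_field simp: field_simps)
  qed simp
  moreover have "cis (of_int m * (2*pi)) = 1"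
    using cis_multiple_2pi[of "of_int m"] by (simp add: mult.commute mult.left_commute)
  ultimately show ?thesis using False by simp
qed

lemma trig_polynomial_has_integral:
  "((\<lambda>t. (cmod (\<Sum>j<d. f j * (of_real r * cis t) ^ j))\<^sup>2) has_integral
      2 * pi * (\<Sum>j<d. (cmod (f j))\<^sup>2 * r ^ (2*j))) {0..2*pi}"
proof -
  define c where "c j = f j * of_real (r ^ j)" for j
  have e: "complex_of_real ((cmod (\<Sum>j<d. f j * (of_real r * cis t) ^ j))\<^sup>2) =
     (\<Sum>j<d. \<Sum>k<d. c j * cnj (c k) * cis (of_int (int j - int k) * t))" for t
  proof -
    have 1: "(\<Sum>j<d. f j * (of_real r * cis t) ^ j) = (\<Sum>j<d. c j * cis (of_nat j * t))"
      by (simp add: c_def power_mult_distrib Complex.DeMoivre mult.assoc)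
    show ?thesis unfolding 1 complex_norm_square
      by (simp add: sum_product cnj_sum cis_cnj cis_mult mult_ac algebra_simps flip: cis_cnj cis_mult)
         (simp add: cis_mult cis_cnj algebra_simps)
  qed
  have "((\<lambda>t. \<Sum>j<d. \<Sum>k<d. c j * cnj (c k) * cis (of_int (int j - int k) * t)) has_integral
      (\<Sum>j<d. \<Sum>k<d. c j * cnj (c k) * (if int j - int k = 0 then of_real (2*pi) else 0))) {0..2*pi}"
    by (intro has_integral_sum has_integral_mult_right cis_has_integral) auto
  also have "(\<Sum>j<d. \<Sum>k<d. c j * cnj (c k) * (if int j - int k = 0 then of_real (2*pi) else 0))
     = (\<Sum>j<d. \<Sum>k<d. if j = k then c j * cnj (c k) * of_real (2*pi) else 0)"
    by (intro sum.cong refl) auto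
  also have "\<dots> = (\<Sum>j<d. c j * cnj (c j) * of_real (2*pi))"
    by (intro sum.cong refl) (simp add: sum.delta')
  also have "\<dots> = complex_of_real (2 * pi * (\<Sum>j<d. (cmod (f j))\<^sup>2 * r ^ (2*j)))"
  proof -
    have "c j * cnj (c j) = complex_of_real ((cmod (f j))\<^sup>2 * r ^ (2*j))" for j
      unfolding complex_norm_square[symmetric]
      by (simp add: c_def norm_mult power_mult_distrib power_even_eq del: of_real_power)
    then show ?thesis by (simp add: sum_distrib_left mult_ac)
  qed
  finally have "((\<lambda>t. complex_of_real ((cmod (\<Sum>j<d. f j * (of_real r * cis t) ^ j))\<^sup>2)) has_integral
     complex_of_real (2 * pi * (\<Sum>j<d. (cmod (f j))\<^sup>2 * r ^ (2*j)))) {0..2*pi}"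
    unfolding e .
  from has_integral_linear[OF this bounded_linear_Re] show ?thesis by (simp add: o_def)
qed

definition circle_mean :: "(complex \<Rightarrow> complex) \<Rightarrow> real \<Rightarrow> real" where
  "circle_mean F r = integral {0..2*pi} (\<lambda>t. (cmod (F (of_real r * cis t)))\<^sup>2) / (2*pi)"

text \<open>The identity for polynomials passes to the limit by dominated convergence: the
  absolutely convergent series \<open>B\<close> bounds every partial sum uniformly in
  \<open>t\<close>.\<close>

lemma parseval_circle:
  assumes F: "pser F f" and r: "0 \<le> r" "r < 1"
  shows "(\<lambda>j. (cmod (f j))\<^sup>2 * r ^ (2*j)) sums circle_mean F r"
proof -
  define B where "B = (\<Sum>j. cmod (f j) * r ^ j)"
  note sm = pser_summable_norm[OF F r]
  have bd: "cmod (\<Sum>j<d. f j * (of_real r * cis t) ^ j) \<le> B" for d t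
  proof -
    have "cmod (\<Sum>j<d. f j * (of_real r * cis t) ^ j) \<le> (\<Sum>j<d. cmod (f j) * r ^ j)"
      by (rule sum_norm_le) (use r in \<open>simp add: norm_mult norm_power\<close>)
    also have "\<dots> \<le> B" unfolding B_def
      by (rule sum_le_suminf[OF sm]) (use r in auto)
    finally show ?thesis .
  qed
  have lim: "(\<lambda>d. integral {0..2*pi} (\<lambda>t. (cmod (\<Sum>j<d. f j * (of_real r * cis t) ^ j))\<^sup>2))
     \<longlonglongrightarrow> integral {0..2*pi} (\<lambda>t. (cmod (F (of_real r * cis t)))\<^sup>2)"
  proof (rule dominated_convergence(2))
    show "(\<lambda>t. (cmod (\<Sum>j<d. f j * (of_real r * cis t) ^ j))\<^sup>2) integrable_on {0..2*pi}" for d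
      using trig_polynomial_has_integral by blast
    show "(\<lambda>t. B\<^sup>2) integrable_on {0..2*pi}" by (rule integrable_const_ivl)
    show "norm ((cmod (\<Sum>j<d. f j * (of_real r * cis t) ^ j))\<^sup>2) \<le> B\<^sup>2" for d t
      using bd by (simp add: power_mono)
    show "(\<lambda>d. (cmod (\<Sum>j<d. f j * (of_real r * cis t) ^ j))\<^sup>2) \<longlonglongrightarrow> (cmod (F (of_real r * cis t)))\<^sup>2" for t
      using pser_sums[OF F, of "of_real r * cis t"] r
      by (intro tendsto_intros) (simp add: sums_def norm_mult)
  qed
  have "(\<lambda>d. (\<Sum>j<d. (cmod (f j))\<^sup>2 * r ^ (2*j))) \<longlonglongrightarrow> circle_mean F r"
    using tendsto_divide[OF lim tendsto_const[of "2*pi"]]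
    unfolding integral_unique[OF trig_polynomial_has_integral] circle_mean_def by simp
  then show ?thesis by (simp add: sums_def)
qed

lemma circle_continuous:
  assumes "F holomorphic_on ball 0 1" "0 \<le> r" "r < 1"
  shows "continuous_on S (\<lambda>t. F (of_real r * cis t))"
proof -
  have "continuous_on (ball 0 1) F" by (rule holomorphic_on_imp_continuous_on[OF assms(1)])
  then show ?thesis
    by (rule continuous_on_compose2) (use assms in \<open>auto intro!: continuous_intros simp: norm_mult\<close>)
qed

lemma circle_integrable:
  assumes "F holomorphic_on ball 0 1" "0 \<le> r" "r < 1"
  shows "(\<lambda>t. (cmod (F (of_real r * cis t)))\<^sup>2) integrable_on {0..2*pi}"
  by (intro integrable_continuous_interval continuous_intros circle_continuous assms)

lemma circle_mean_bound:
  assumes "F holomorphic_on ball 0 1" "0 \<le> r" "r < 1" "\<And>z. z \<in> ball 0 1 \<Longrightarrow> cmod (F z) \<le> B"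
  shows "circle_mean F r \<le> B\<^sup>2"
proof -
  have "integral {0..2*pi} (\<lambda>t. (cmod (F (of_real r * cis t)))\<^sup>2) \<le> integral {0..2*pi} (\<lambda>t. B\<^sup>2)"
    by (intro integral_le circle_integrable integrable_const_ivl assms power_mono)
       (use assms in \<open>auto simp: norm_mult\<close>)
  then show ?thesis by (simp add: circle_mean_def field_simps)
qed

section \<open>Coefficient sums as the radius tends to 1\<close>

text \<open>The limit in the radius is taken on finite sections only, where it is harmless; a bound
  common to all sections then controls the infinite sum.\<close>

lemma partial_sum_square_le:
  fixes f :: "nat \<Rightarrow> complex"
  assumes "\<forall>\<^sub>F k in sequentially. (\<Sum>j<d. (cmod (f j))\<^sup>2 * r k ^ (2*j)) \<le> A k"
    and "r \<longlonglongrightarrow> 1" "A \<longlonglongrightarrow> L"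
  shows "(\<Sum>j<d. (cmod (f j))\<^sup>2) \<le> L"
proof (rule tendsto_le[OF _ assms(3) _ assms(1)])
  have "(\<lambda>k. (\<Sum>j<d. (cmod (f j))\<^sup>2 * r k ^ (2*j))) \<longlonglongrightarrow> (\<Sum>j<d. (cmod (f j))\<^sup>2 * 1 ^ (2*j))"
    by (intro tendsto_intros assms)
  then show "(\<lambda>k. (\<Sum>j<d. (cmod (f j))\<^sup>2 * r k ^ (2*j))) \<longlonglongrightarrow> (\<Sum>j<d. (cmod (f j))\<^sup>2)" by simp
qed simp

lemma bounded_coeff_square_summable:
  assumes F: "pser F f" and B: "\<And>z. z \<in> ball 0 1 \<Longrightarrow> cmod (F z) \<le> B"
  shows "summable (\<lambda>j. (cmod (f j))\<^sup>2)" "(\<Sum>j. (cmod (f j))\<^sup>2) \<le> B\<^sup>2"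
proof -
  define r where "r k = real k / real (Suc k)" for k
  have r1: "r \<longlonglongrightarrow> 1" unfolding r_def by (rule LIMSEQ_n_over_Suc_n)
  have r01: "0 \<le> r k" "r k < 1" for k by (auto simp: r_def)
  have le: "(\<Sum>j<d. (cmod (f j))\<^sup>2) \<le> B\<^sup>2" for d
  proof (rule partial_sum_square_le[OF _ r1 tendsto_const])
    have "(\<Sum>j<d. (cmod (f j))\<^sup>2 * r k ^ (2*j)) \<le> B\<^sup>2" for k
    proof -
      have "(\<Sum>j<d. (cmod (f j))\<^sup>2 * r k ^ (2*j)) \<le> circle_mean F (r k)"
        using parseval_circle[OF F r01[of k]] r01[of k]
        by (subst sums_unique[of _ "circle_mean F (r k)"]) (auto simp: sums_iff intro!: sum_le_suminf)
      also have "\<dots> \<le> B\<^sup>2"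
        by (intro circle_mean_bound pser_holomorphic[OF F] r01 B)
      finally show ?thesis .
    qed
    then show "\<forall>\<^sub>F k in sequentially. (\<Sum>j<d. (cmod (f j))\<^sup>2 * r k ^ (2*j)) \<le> B\<^sup>2" by simp
  qed
  show s: "summable (\<lambda>j. (cmod (f j))\<^sup>2)"
    by (rule bounded_imp_summable[where B = "B\<^sup>2"]) (use le[of "Suc _"] in \<open>auto simp: lessThan_Suc_atMost\<close>)
  show "(\<Sum>j. (cmod (f j))\<^sup>2) \<le> B\<^sup>2"
    by (rule suminf_le_const[OF s le])
qed

text \<open>Only the boundary comparison up to an error vanishing almost everywhere is required, so that
  no radial limits of \<open>F\<close>, \<open>G\<close>, \<open>H\<close> themselves are needed.\<close>

lemma coeff_square_sum_le:
  assumes F: "pser F f" and G: "pser G g" and H: "pser H h"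
    and BF: "\<And>z. z \<in> ball 0 1 \<Longrightarrow> cmod (F z) \<le> B"
    and BG: "\<And>z. z \<in> ball 0 1 \<Longrightarrow> cmod (G z) \<le> B"
    and BH: "\<And>z. z \<in> ball 0 1 \<Longrightarrow> cmod (H z) \<le> B"
    and ae: "AE t in lebesgue_on {0..2*pi}. \<exists>e. (e \<longlongrightarrow> 0) (at_left 1) \<and>
        (\<forall>r\<in>{0..<1}. (cmod (F (of_real r * cis t)))\<^sup>2 \<le>
            (cmod (G (of_real r * cis t)))\<^sup>2 + (cmod (H (of_real r * cis t)))\<^sup>2 + e r)"
  shows "(\<Sum>j. (cmod (f j))\<^sup>2) \<le> (\<Sum>j. (cmod (g j))\<^sup>2) + (\<Sum>j. (cmod (h j))\<^sup>2)"
proof -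
  define r where "r k = real k / real (Suc k)" for k
  have r1: "r \<longlonglongrightarrow> 1" unfolding r_def by (rule LIMSEQ_n_over_Suc_n)
  have r01: "0 \<le> r k" "r k < 1" for k by (auto simp: r_def)
  note hol = pser_holomorphic[OF F] pser_holomorphic[OF G] pser_holomorphic[OF H]
  \<comment> \<open>The error \<open>e\<close> depends on \<open>t\<close> and comes without a
    majorant. The positive part of the excess is at most \<open>B^2\<close> in any case, so
    dominated convergence applies to it.\<close>
  define s where "s k t = max 0 ((cmod (F (of_real (r k) * cis t)))\<^sup>2 -
     (cmod (G (of_real (r k) * cis t)))\<^sup>2 - (cmod (H (of_real (r k) * cis t)))\<^sup>2)" for k t
  have scont: "continuous_on {0..2*pi} (s k)" for k
    unfolding s_def by (intro continuous_intros circle_continuous hol r01)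
  have inb: "of_real (r k) * cis t \<in> ball (0::complex) 1" for k t
    using r01[of k] by (simp add: norm_mult)
  have slim: "AE t in lebesgue_on {0..2*pi}. (\<lambda>k. s k t) \<longlonglongrightarrow> 0"
    using ae
  proof eventually_elim
    fix t assume "\<exists>e. (e \<longlongrightarrow> 0) (at_left 1) \<and>
        (\<forall>r\<in>{0..<1}. (cmod (F (of_real r * cis t)))\<^sup>2 \<le>
            (cmod (G (of_real r * cis t)))\<^sup>2 + (cmod (H (of_real r * cis t)))\<^sup>2 + e r)"
    then obtain e where e: "(e \<longlongrightarrow> 0) (at_left 1)"
      "\<And>r. r \<in> {0..<1} \<Longrightarrow> (cmod (F (of_real r * cis t)))\<^sup>2 \<le>
            (cmod (G (of_real r * cis t)))\<^sup>2 + (cmod (H (of_real r * cis t)))\<^sup>2 + e r" by blast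
    have "filterlim r (at_left 1) sequentially"
      using r1 r01 by (simp add: filterlim_at order.strict_implies_not_eq)
    then have 1: "(\<lambda>k. \<bar>e (r k)\<bar>) \<longlonglongrightarrow> 0"
      using filterlim_compose[OF e(1)] tendsto_rabs_zero by blast
    show "(\<lambda>k. s k t) \<longlonglongrightarrow> 0"
    proof (rule tendsto_sandwich[OF _ _ tendsto_const 1])
      show "\<forall>\<^sub>F k in sequentially. s k t \<le> \<bar>e (r k)\<bar>"
      proof (rule always_eventually, rule allI)
        fix k show "s k t \<le> \<bar>e (r k)\<bar>"
          using e(2)[of "r k"] r01[of k] by (auto simp: s_def)
      qed
    qed (simp add: s_def)
  qed
  have sb: "norm (s k t) \<le> B\<^sup>2" for k t
  proof -
    have "(cmod (F (of_real (r k) * cis t)))\<^sup>2 \<le> B\<^sup>2" by (intro power_mono BF inb) auto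
    then show ?thesis
      unfolding s_def by (auto simp: max_def intro: order_trans[rotated])
  qed
  have sm: "s k \<in> borel_measurable (lebesgue_on {0..2*pi})" for k
    by (intro continuous_imp_measurable_on_sets_lebesgue scont) auto
  have "(\<lambda>k. integral\<^sup>L (lebesgue_on {0..2*pi}) (s k)) \<longlonglongrightarrow> integral\<^sup>L (lebesgue_on {0..2*pi}) (\<lambda>_. 0)"
    by (rule integral_dominated_convergence[where w = "\<lambda>_. B\<^sup>2"])
       (use sm slim sb in auto)
  moreover have "integral\<^sup>L (lebesgue_on {0..2*pi}) (s k) = integral {0..2*pi} (s k)" for k
    by (rule lebesgue_integral_eq_integral)
       (auto intro!: integrable_on_const sm
          finite_measure.integrable_const_bound[where B = "B\<^sup>2"] finite_measure_lebesgue_on simp: sb[simplified])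
  ultimately have sI: "(\<lambda>k. integral {0..2*pi} (s k)) \<longlonglongrightarrow> 0" by simp
  note GS = bounded_coeff_square_summable[OF G BG]
  note HS = bounded_coeff_square_summable[OF H BH]
  note FS = bounded_coeff_square_summable[OF F BF]
  have mono: "circle_mean G (r k) \<le> (\<Sum>j. (cmod (g j))\<^sup>2)" if "pser G g" "summable (\<lambda>j. (cmod (g j))\<^sup>2)" for k G g
  proof -
    have "(cmod (g j))\<^sup>2 * r k ^ (2 * j) \<le> (cmod (g j))\<^sup>2" for j
      using r01[of k] by (intro mult_left_le power_le_one) auto
    then show ?thesis
      using sums_le[OF _ parseval_circle[OF that(1) r01[of k]] summable_sums[OF that(2)]] by simp
  qed
  have main: "circle_mean F (r k) \<le> (\<Sum>j. (cmod (g j))\<^sup>2) + (\<Sum>j. (cmod (h j))\<^sup>2) + integral {0..2*pi} (s k) / (2*pi)" for k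
  proof -
    have i: "s k integrable_on {0..2*pi}" by (rule integrable_continuous_interval[OF scont])
    note ci = circle_integrable[OF hol(1) r01[of k]] circle_integrable[OF hol(2) r01[of k]] circle_integrable[OF hol(3) r01[of k]]
    have "integral {0..2*pi} (\<lambda>t. (cmod (F (of_real (r k) * cis t)))\<^sup>2) \<le>
      integral {0..2*pi} (\<lambda>t. (cmod (G (of_real (r k) * cis t)))\<^sup>2 + (cmod (H (of_real (r k) * cis t)))\<^sup>2 + s k t)"
      by (intro integral_le integrable_add ci i) (auto simp: s_def)
    also have "\<dots> = integral {0..2*pi} (\<lambda>t. (cmod (G (of_real (r k) * cis t)))\<^sup>2) +
        integral {0..2*pi} (\<lambda>t. (cmod (H (of_real (r k) * cis t)))\<^sup>2) + integral {0..2*pi} (s k)"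
      by (simp add: integral_add ci i integrable_add)
    finally have "circle_mean F (r k) \<le> circle_mean G (r k) + circle_mean H (r k) + integral {0..2*pi} (s k) / (2*pi)"
      unfolding circle_mean_def by (simp add: field_simps)
    then show ?thesis using mono[OF G GS(1), of k] mono[OF H HS(1), of k] by linarith
  qed
  have "(\<Sum>j<d. (cmod (f j))\<^sup>2) \<le> (\<Sum>j. (cmod (g j))\<^sup>2) + (\<Sum>j. (cmod (h j))\<^sup>2) + 0 / (2*pi)" for d
  proof (rule partial_sum_square_le[OF _ r1])
    show "(\<lambda>k. (\<Sum>j. (cmod (g j))\<^sup>2) + (\<Sum>j. (cmod (h j))\<^sup>2) + integral {0..2*pi} (s k) / (2*pi))
       \<longlonglongrightarrow> (\<Sum>j. (cmod (g j))\<^sup>2) + (\<Sum>j. (cmod (h j))\<^sup>2) + 0 / (2*pi)"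
      by (intro tendsto_intros sI) auto
    have "(\<Sum>j<d. (cmod (f j))\<^sup>2 * r k ^ (2*j)) \<le> circle_mean F (r k)" for k
        using parseval_circle[OF F r01[of k]] r01[of k]
        by (subst sums_unique[of _ "circle_mean F (r k)"]) (auto simp: sums_iff intro!: sum_le_suminf)
    then show "\<forall>\<^sub>F k in sequentially. (\<Sum>j<d. (cmod (f j))\<^sup>2 * r k ^ (2*j)) \<le>
      (\<Sum>j. (cmod (g j))\<^sup>2) + (\<Sum>j. (cmod (h j))\<^sup>2) + integral {0..2*pi} (s k) / (2*pi)"
      using main by (auto intro!: always_eventually intro: order_trans)
  qed
  then show ?thesis using suminf_le_const[OF FS(1)] by simp
qed

section \<open>Outer functions\<close>

text \<open>The exponent in \<open>outer\<close>; its real part is the Poisson integral of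
  \<open>v\<close>.\<close>

definition herglotz :: "(real \<Rightarrow> real) \<Rightarrow> complex \<Rightarrow> complex" where
  "herglotz v z = integral {0..2*pi} (\<lambda>t. (cis t + z) / (cis t - z) * complex_of_real (v t)) / complex_of_real (2*pi)"

lemma cis_minus_nonzero: "cmod z < 1 \<Longrightarrow> cis t - z \<noteq> 0"
  by (metis eq_iff_diff_eq_0 less_irrefl norm_cis)

lemma absolutely_integrable_continuous_times_real:
  fixes k :: "real \<Rightarrow> complex"
  assumes k: "continuous_on {a..b} k" and v: "v absolutely_integrable_on {a..b}"
  shows "(\<lambda>t. k t * complex_of_real (v t)) absolutely_integrable_on {a..b}"
proof (rule absolutely_integrable_bounded_measurable_product[OF bilinear_times])
  show "k \<in> borel_measurable (lebesgue_on {a..b})"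
    by (intro continuous_imp_measurable_on_sets_lebesgue k) auto
  show "bounded (k ` {a..b})"
    by (intro compact_imp_bounded compact_continuous_image k) auto
  show "(\<lambda>t. complex_of_real (v t)) absolutely_integrable_on {a..b}"
    using absolutely_integrable_linear[OF v bounded_linear_of_real] by (simp add: o_def)
qed auto

lemma herglotz_integrable:
  assumes "cmod z < 1" "v absolutely_integrable_on {0..2*pi}"
  shows "(\<lambda>t. (cis t + z) / (cis t - z) * complex_of_real (v t)) absolutely_integrable_on {0..2*pi}"
  by (intro absolutely_integrable_continuous_times_real assms continuous_intros)
     (use cis_minus_nonzero assms(1) in auto)

lemma herglotz_add:
  assumes "cmod z < 1" "v absolutely_integrable_on {0..2*pi}" "w absolutely_integrable_on {0..2*pi}"
  shows "herglotz (\<lambda>t. v t + w t) z = herglotz v z + herglotz w z"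
proof -
  note iv = herglotz_integrable[OF assms(1,2), THEN set_lebesgue_integral_eq_integral(1)]
    herglotz_integrable[OF assms(1,3), THEN set_lebesgue_integral_eq_integral(1)]
  show ?thesis
    unfolding herglotz_def of_real_add distrib_left integral_add[OF iv] by (rule add_divide_distrib)
qed

text \<open>With \<open>w = z * cis (- t)\<close> the kernel is
  \<open>(1 + w) / (1 - w) = 1 + 2 w + 2 w^2 + ...\<close>, integrated term by term. Partial sums
  are bounded by \<open>2 / (1 - |z|)\<close>, so \<open>|v|\<close> times this constant is a
  majorant. Holomorphy follows without differentiating under the integral.\<close>

lemma herglotz_pser:
  assumes v: "v absolutely_integrable_on {0..2*pi}"
  shows "pser (herglotz v) (\<lambda>n. (if n = 0 then 1 else 2) *
           integral {0..2*pi} (\<lambda>t. cis (- (real n * t)) * complex_of_real (v t)) / complex_of_real (2*pi))"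
  unfolding pser_def
proof
  fix z :: complex assume "z \<in> ball 0 1"
  then have z: "cmod z < 1" by simp
  define e :: "nat \<Rightarrow> complex" where "e n = (if n = 0 then 1 else 2)" for n
  have int: "(\<lambda>t. cis (- (real n * t)) * complex_of_real (v t)) integrable_on {0..2*pi}" for n
    by (intro set_lebesgue_integral_eq_integral(1) absolutely_integrable_continuous_times_real v continuous_intros)
  define S where "S N t = (\<Sum>n<N. e n * z ^ n * (cis (- (real n * t)) * complex_of_real (v t)))" for N t
  have Sint: "(S N has_integral (\<Sum>n<N. e n * z ^ n * integral {0..2*pi} (\<lambda>t. cis (- (real n * t)) * complex_of_real (v t)))) {0..2*pi}" for N
    unfolding S_def
    by (intro has_integral_sum has_integral_mult_right integrable_integral int) auto
  have ker: "(\<lambda>n. e n * z ^ n * cis (- (real n * t))) sums ((cis t + z) / (cis t - z))" for t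
  proof -
    define w where "w = z * cis (- t)"
    have w: "cmod w < 1" using z by (simp add: w_def norm_mult)
    then have w1: "1 - w \<noteq> 0" by auto
    have "(\<lambda>n. 2 * w ^ n) sums (2 * (1 / (1 - w)))"
      by (intro sums_mult geometric_sums w)
    from sums_diff[OF this sums_single[of 0 "\<lambda>_. 1"]]
    have "(\<lambda>n. e n * w ^ n) sums (2 * (1 / (1 - w)) - 1)"
      by (rule sums_cong[THEN iffD1, rotated]) (auto simp: e_def)
    moreover have "2 * (1 / (1 - w)) - 1 = (1 + w) / (1 - w)"
      using w1 by (simp add: field_simps)
    moreover have "(1 + w) / (1 - w) = (cis t + z) / (cis t - z)"
    proof -
      have "cis t * w = z" by (simp add: w_def cis_mult mult.left_commute)
      then have "cis t + z = cis t * (1 + w)" "cis t - z = cis t * (1 - w)"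
        by (simp_all add: algebra_simps)
      then show ?thesis by simp
    qed
    moreover have "e n * w ^ n = e n * z ^ n * cis (- (real n * t))" for n
      by (simp add: w_def power_mult_distrib Complex.DeMoivre)
    ultimately show ?thesis by simp
  qed
  have "(\<lambda>N. integral {0..2*pi} (S N)) \<longlonglongrightarrow>
      integral {0..2*pi} (\<lambda>t. (cis t + z) / (cis t - z) * complex_of_real (v t))"
  proof (rule dominated_convergence(2))
    show "S N integrable_on {0..2*pi}" for N using Sint by blast
    show "(\<lambda>t. 2 / (1 - cmod z) * \<bar>v t\<bar>) integrable_on {0..2*pi}"
      using v by (intro integrable_on_mult_right) (auto simp: absolutely_integrable_on_def)
    show "norm (S N t) \<le> 2 / (1 - cmod z) * \<bar>v t\<bar>" for N t
    proof -
      have "norm (S N t) \<le> (\<Sum>n<N. 2 * cmod z ^ n * \<bar>v t\<bar>)"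
        unfolding S_def by (rule sum_norm_le) (auto simp: norm_mult norm_power e_def intro!: mult_right_mono)
      also have "\<dots> = 2 * (\<Sum>n<N. cmod z ^ n) * \<bar>v t\<bar>"
        by (simp add: sum_distrib_left sum_distrib_right)
      also have "\<dots> \<le> 2 * (1 / (1 - cmod z)) * \<bar>v t\<bar>"
        using z by (intro mult_right_mono mult_left_mono) (auto simp: sum_gp_strict intro!: divide_right_mono)
      finally show ?thesis by simp
    qed
    show "(\<lambda>N. S N t) \<longlonglongrightarrow> (cis t + z) / (cis t - z) * complex_of_real (v t)" for t
      using sums_mult2[OF ker[of t], of "complex_of_real (v t)"]
      by (simp add: S_def sums_def mult.assoc)
  qed
  then have "(\<lambda>n. e n * z ^ n * integral {0..2*pi} (\<lambda>t. cis (- (real n * t)) * complex_of_real (v t)))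
      sums integral {0..2*pi} (\<lambda>t. (cis t + z) / (cis t - z) * complex_of_real (v t))"
    unfolding integral_unique[OF Sint] sums_def .
  from sums_divide[OF this, of "complex_of_real (2*pi)"]
  show "(\<lambda>n. (if n = 0 then 1 else 2) *
           integral {0..2*pi} (\<lambda>t. cis (- (real n * t)) * complex_of_real (v t)) / complex_of_real (2*pi) * z ^ n)
      sums herglotz v z"
    by (simp add: herglotz_def e_def mult_ac)
qed

lemma herglotz_holomorphic:
  "v absolutely_integrable_on {0..2*pi} \<Longrightarrow> herglotz v holomorphic_on ball 0 1"
  by (rule pser_holomorphic[OF herglotz_pser])

lemma herglotz_const:
  assumes "cmod z < 1"
  shows "herglotz (\<lambda>_. c) z = of_real c"
proof -
  have c: "(\<lambda>_. c) absolutely_integrable_on {0..2*pi}"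
    by (intro absolutely_integrable_continuous_real continuous_intros)
  have "integral {0..2*pi} (\<lambda>t. cis (- (real n * t)) * complex_of_real c) = (if n = 0 then of_real (2*pi) else 0) * of_real c" for n
    using has_integral_mult_left[OF cis_has_integral[of "- int n"], of "of_real c"]
    by (intro integral_unique) (auto simp: mult.commute)
  from pser_sums[OF herglotz_pser[OF c] assms, unfolded this]
  have "(\<lambda>n. if n = 0 then of_real c else 0) sums herglotz (\<lambda>_. c) z"
    by (rule sums_cong[THEN iffD1, rotated]) auto
  moreover have "(\<lambda>n. if n = 0 then complex_of_real c else 0) sums of_real c"
    by (rule sums_single)
  ultimately show ?thesis by (rule sums_unique2)
qed

text \<open>The real part of the kernel is the Poisson kernel
  \<open>(1 - |z|^2) / |cis t - z|^2\<close>, which is positive.\<close>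

lemma Re_herglotz_nonneg:
  assumes z: "cmod z < 1" and v: "v absolutely_integrable_on {0..2*pi}" and "\<And>t. v t \<ge> 0"
  shows "Re (herglotz v z) \<ge> 0"
proof -
  have P: "Re ((cis t + z) / (cis t - z)) \<ge> 0" for t
  proof -
    have "Re ((cis t + z) * cnj (cis t - z)) = (cmod (cis t))\<^sup>2 - (cmod z)\<^sup>2"
      unfolding cmod_power2 by (simp add: algebra_simps power2_eq_square)
    also have "\<dots> \<ge> 0" using z by (simp add: power_le_one)
    finally show ?thesis by (simp add: Re_divide_of_real complex_div_cnj[of "cis t + z"] divide_nonneg_nonneg
       del: complex_cnj_diff flip: of_real_power)
  qed
  note i = herglotz_integrable[OF z v, THEN set_lebesgue_integral_eq_integral(1)]
  have R: "Re \<circ> (\<lambda>t. (cis t + z) / (cis t - z) * complex_of_real (v t)) = (\<lambda>t. Re ((cis t + z) / (cis t - z)) * v t)"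
    by (simp only: o_def times_complex.simps Re_complex_of_real Im_complex_of_real mult_zero_right diff_zero)
  have "Re (integral {0..2*pi} (\<lambda>t. (cis t + z) / (cis t - z) * complex_of_real (v t))) =
      integral {0..2*pi} (\<lambda>t. Re ((cis t + z) / (cis t - z)) * v t)"
    using integral_linear[OF i bounded_linear_Re] unfolding R by simp
  also have "\<dots> \<ge> 0"
    by (intro integral_nonneg mult_nonneg_nonneg P assms integrable_linear[OF i bounded_linear_Re, unfolded R])
  finally show ?thesis by (simp add: herglotz_def Re_divide_of_real del: of_real_mult)
qed

text \<open>\<open>g k\<close> is the reciprocal of the outer function whose log-modulus is
  \<open>max u (-k)\<close>. Cutting \<open>u\<close> off from below bounds this reciprocal by
  \<open>exp k\<close>; as the cut-off only enlarges \<open>u\<close>, the product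
  \<open>a * g k\<close> has modulus at most 1.\<close>

lemma outer_approximate_inverse:
  assumes "outer a"
  shows "a holomorphic_on ball 0 1" "\<And>z. z \<in> ball 0 1 \<Longrightarrow> a z \<noteq> 0"
    and "\<exists>g :: nat \<Rightarrow> complex \<Rightarrow> complex. (\<forall>k. g k holomorphic_on ball 0 1 \<and>
            (\<forall>z\<in>ball 0 1. g k z \<noteq> 0 \<and> cmod (g k z) \<le> exp k \<and> cmod (a z * g k z) \<le> 1)) \<and>
            (\<lambda>k. a 0 * g k 0) \<longlonglongrightarrow> 1"
proof -
  from assms obtain c u where c: "cmod c = 1" and u: "u absolutely_integrable_on {0..2*pi}"
    and a: "\<And>z. z \<in> ball 0 1 \<Longrightarrow> a z = c * exp (herglotz u z)"
    unfolding outer_def herglotz_def by blast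
  show "a holomorphic_on ball 0 1"
    by (rule holomorphic_transform[where f = "\<lambda>z. c * exp (herglotz u z)"])
       (auto intro!: holomorphic_intros herglotz_holomorphic u simp: a)
  show "a z \<noteq> 0" if "z \<in> ball 0 1" for z using c that by (auto simp: a)
  have const: "(\<lambda>_. d) absolutely_integrable_on {0..2*pi}" for d :: real
    by (intro absolutely_integrable_continuous_real continuous_intros)
  define w where "w k t = max (u t) (- real k)" for k t
  have w: "w k absolutely_integrable_on {0..2*pi}" for k
    unfolding w_def by (intro absolutely_integrable_max_1 u const)
  \<comment> \<open>The amount added by the cut-off: nonnegative, dominated by \<open>|u|\<close>,
    and zero at \<open>t\<close> as soon as \<open>k\<close> is at least
    \<open>- u t\<close>.\<close>
  define d where "d k t = w k t - u t" for k t
  have d: "d k absolutely_integrable_on {0..2*pi}" for k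
    unfolding d_def by (intro set_integral_diff(1) w u)
  have ds: "herglotz (w k) z = herglotz (d k) z + herglotz u z" if "cmod z < 1" for k z
    using herglotz_add[OF that d[of k] u] by (simp add: d_def)
  \<comment> \<open>The factor \<open>cnj c\<close> cancels the unimodular constant of
    \<open>a\<close>, so that \<open>a 0 * g k 0\<close> tends to 1 and not merely to
    \<open>c\<close>.\<close>
  define g where "g k z = cnj c * exp (- herglotz (w k) z)" for k z
  have cc: "c * cnj c = 1" using c complex_norm_square[of c] by simp
  have ag: "a z * g k z = exp (- herglotz (d k) z)" if "cmod z < 1" for k z
  proof -
    have "a z * g k z = (c * cnj c) * (exp (herglotz u z) * exp (- herglotz (w k) z))"
      using that by (simp add: a g_def)
    also have "\<dots> = exp (- herglotz (d k) z)"
      by (simp add: cc ds[OF that] flip: exp_add)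
    finally show ?thesis .
  qed
  have "g k holomorphic_on ball 0 1" for k
    unfolding g_def by (intro holomorphic_intros herglotz_holomorphic w)
  moreover have "g k z \<noteq> 0" for k z using c by (auto simp: g_def)
  moreover have "cmod (g k z) \<le> exp k" if "cmod z < 1" for k z
  proof -
    have wk: "(\<lambda>t. w k t + real k) absolutely_integrable_on {0..2*pi}"
      by (intro set_integral_add(1) w const)
    have "0 \<le> Re (herglotz (\<lambda>t. w k t + real k) z)"
      by (rule Re_herglotz_nonneg[OF that wk]) (simp add: w_def max_def)
    also have "herglotz (\<lambda>t. w k t + real k) z = herglotz (w k) z + of_real (real k)"
      using herglotz_add[OF that w const] herglotz_const[OF that] by simp
    finally show ?thesis by (simp add: g_def norm_mult c)
  qed
  moreover have "cmod (a z * g k z) \<le> 1" if "cmod z < 1" for k z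
  proof -
    have "0 \<le> Re (herglotz (d k) z)"
      by (rule Re_herglotz_nonneg[OF that d]) (simp add: w_def d_def)
    then show ?thesis by (simp add: ag[OF that])
  qed
  moreover have "(\<lambda>k. a 0 * g k 0) \<longlonglongrightarrow> 1"
  proof -
    \<comment> \<open>At the origin the Herglotz kernel is identically 1, so
      \<open>herglotz (d k) 0\<close> is the mean of \<open>d k\<close>.\<close>
    have "(\<lambda>k. integral {0..2*pi} (\<lambda>t. complex_of_real (d k t))) \<longlonglongrightarrow> integral {0..2*pi} (\<lambda>t. 0)"
    proof (rule dominated_convergence(2))
      show "(\<lambda>t. complex_of_real (d k t)) integrable_on {0..2*pi}" for k
        using integrable_linear[OF set_lebesgue_integral_eq_integral(1)[OF d[of k]] bounded_linear_of_real]
        by (simp add: o_def)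
      show "(\<lambda>t. \<bar>u t\<bar>) integrable_on {0..2*pi}" using u by (auto simp: absolutely_integrable_on_def)
      show "norm (complex_of_real (d k t)) \<le> \<bar>u t\<bar>" for k t
        unfolding norm_of_real by (auto simp: d_def w_def)
      show "(\<lambda>k. complex_of_real (d k t)) \<longlonglongrightarrow> 0" for t
      proof (rule tendsto_eventually)
        have "\<forall>\<^sub>F k in sequentially. real k \<ge> - u t"
          using filterlim_at_top filterlim_real_sequentially by blast
        then show "\<forall>\<^sub>F k in sequentially. complex_of_real (d k t) = 0"
          by eventually_elim (auto simp: d_def w_def)
      qed
    qed
    then have "(\<lambda>k. herglotz (d k) 0) \<longlonglongrightarrow> 0"
      unfolding herglotz_def by (intro tendsto_divide_zero) (simp)
    then have "(\<lambda>k. exp (- herglotz (d k) 0)) \<longlonglongrightarrow> exp (- 0)" by (intro tendsto_intros)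
    then show ?thesis by (simp add: ag)
  qed
  ultimately show "\<exists>g :: nat \<Rightarrow> complex \<Rightarrow> complex. (\<forall>k. g k holomorphic_on ball 0 1 \<and>
            (\<forall>z\<in>ball 0 1. g k z \<noteq> 0 \<and> cmod (g k z) \<le> exp k \<and> cmod (a z * g k z) \<le> 1)) \<and>
            (\<lambda>k. a 0 * g k 0) \<longlonglongrightarrow> 1"
    by (intro exI[of _ g]) auto
qed

section \<open>Combinations of point evaluations\<close>

text \<open>The elements are functionals, not lists of nodes and weights. Different representations
  are thereby identified, repeated nodes are harmless, and linear operations are those of
  functions.\<close>

definition point_combinations :: "((complex \<Rightarrow> complex) \<Rightarrow> complex) set" where
  "point_combinations = {l. \<exists>(n::nat) p c. (\<forall>i<n. p i \<in> ball 0 1) \<and> l = (\<lambda>f. \<Sum>i<n. c i * f (p i))}"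

lemma point_combinationsI:
  "(\<And>i::nat. i < n \<Longrightarrow> p i \<in> ball 0 1) \<Longrightarrow> (\<lambda>f. \<Sum>i<n. c i * f (p i)) \<in> point_combinations"
  unfolding point_combinations_def by blast

lemma point_combinationsE:
  assumes "l \<in> point_combinations"
  obtains n :: nat and p c where "\<And>i. i < n \<Longrightarrow> p i \<in> ball 0 1" "l = (\<lambda>f. \<Sum>i<n. c i * f (p i))"
  using assms unfolding point_combinations_def by blast

lemma point_combinations_zero: "(\<lambda>f. 0) \<in> point_combinations"
  using point_combinationsI[of 0 "\<lambda>_. 0" "\<lambda>_. 0"] by simp

lemma point_combinations_eval: "z \<in> ball 0 1 \<Longrightarrow> (\<lambda>f. f z) \<in> point_combinations"
  using point_combinationsI[of "Suc 0" "\<lambda>_. z" "\<lambda>_. 1"] by (simp del: sum_constant add: lessThan_Suc)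

lemma point_combinations_scale:
  assumes "l \<in> point_combinations"
  shows "(\<lambda>f. a * l f) \<in> point_combinations"
  using assms
proof (rule point_combinationsE)
  fix n :: nat and p c assume h: "\<And>i. i < n \<Longrightarrow> p i \<in> ball 0 1" "l = (\<lambda>f. \<Sum>i<n. c i * f (p i))"
  have "(\<lambda>f. a * l f) = (\<lambda>f. \<Sum>i<n. (a * c i) * f (p i))"
    by (simp add: h(2) sum_distrib_left mult.assoc)
  then show ?thesis using point_combinationsI[of n p "\<lambda>i. a * c i"] h(1) by simp
qed

lemma point_combinations_add:
  assumes "l \<in> point_combinations" "m \<in> point_combinations"
  shows "(\<lambda>f. l f + m f) \<in> point_combinations"
proof -
  obtain n :: nat and p c where h: "\<And>i. i < n \<Longrightarrow> p i \<in> ball 0 1" "l = (\<lambda>f. \<Sum>i<n. c i * f (p i))"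
    using assms(1) by (rule point_combinationsE) blast
  obtain n' :: nat and p' c' where h': "\<And>i. i < n' \<Longrightarrow> p' i \<in> ball 0 1" "m = (\<lambda>f. \<Sum>i<n'. c' i * f (p' i))"
    using assms(2) by (rule point_combinationsE) blast
  define P where "P i = (if i < n then p i else p' (i - n))" for i
  define C where "C i = (if i < n then c i else c' (i - n))" for i
  have "(\<Sum>i<n+n'. C i * f (P i)) = (\<Sum>i<n. c i * f (p i)) + (\<Sum>i<n'. c' i * f (p' i))" for f
  proof -
    have "(\<Sum>i<n+n'. C i * f (P i)) = (\<Sum>i<n. C i * f (P i)) + (\<Sum>i<n'. C (n + i) * f (P (n + i)))"
    proof (induction n')
      case (Suc k)
      then show ?case by (simp add: add.assoc)
    qed simp
    then show ?thesis by (simp add: C_def P_def)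
  qed
  then have "(\<lambda>f. l f + m f) = (\<lambda>f. \<Sum>i<n+n'. C i * f (P i))"
    by (simp add: h(2) h'(2))
  moreover have "(\<lambda>f. \<Sum>i<n+n'. C i * f (P i)) \<in> point_combinations"
    by (rule point_combinationsI) (use h(1) h'(1) in \<open>auto simp: P_def\<close>)
  ultimately show ?thesis by simp
qed

lemma point_combinations_diff:
  assumes "l \<in> point_combinations" "m \<in> point_combinations"
  shows "(\<lambda>f. l f - m f) \<in> point_combinations"
  using point_combinations_add[OF assms(1) point_combinations_scale[OF assms(2), of "-1"]] by simp

lemma point_combinations_sum:
  assumes "finite A" "\<And>i. i \<in> A \<Longrightarrow> l i \<in> point_combinations"
  shows "(\<lambda>f. \<Sum>i\<in>A. l i f) \<in> point_combinations"
  using assms by (induction A rule: finite_induct) (auto intro: point_combinations_zero point_combinations_add)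

lemma point_combination_add:
  "l \<in> point_combinations \<Longrightarrow> l (\<lambda>z. f z + g z) = l f + l g"
  by (erule point_combinationsE) (simp add: distrib_left sum.distrib)

lemma point_combination_mult:
  "l \<in> point_combinations \<Longrightarrow> l (\<lambda>z. c * f z) = c * l f"
  by (erule point_combinationsE) (simp add: sum_distrib_left mult_ac)

lemma point_combination_diff:
  "l \<in> point_combinations \<Longrightarrow> l (\<lambda>z. f z - g z) = l f - l g"
  using point_combination_add[of l f "\<lambda>z. (-1) * g z"] point_combination_mult[of l "-1" g] by simp

lemma point_combination_zero: "l \<in> point_combinations \<Longrightarrow> l (\<lambda>z. 0) = 0"
  by (erule point_combinationsE) simp

lemma point_combination_sum:
  assumes "l \<in> point_combinations" "finite A"
  shows "l (\<lambda>z. \<Sum>i\<in>A. f i z) = (\<Sum>i\<in>A. l (f i))"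
  using assms(2) by (induction A rule: finite_induct)
    (simp_all add: point_combination_zero[OF assms(1)] point_combination_add[OF assms(1)])

lemma point_combination_pser:
  assumes "l \<in> point_combinations" "pser F f"
  shows "(\<lambda>j. f j * l (\<lambda>z. z ^ j)) sums l F"
proof -
  obtain n :: nat and p c where h: "\<And>i. i < n \<Longrightarrow> p i \<in> ball 0 1" "l = (\<lambda>f. \<Sum>i<n. c i * f (p i))"
    using assms(1) by (rule point_combinationsE) blast
  have "(\<lambda>j. \<Sum>i<n. c i * (f j * p i ^ j)) sums (\<Sum>i<n. c i * F (p i))"
    by (intro sums_sum sums_mult pser_sums[OF assms(2)]) (use h in auto)
  then show ?thesis by (simp add: h(2) sum_distrib_left mult_ac)
qed

text \<open>Finitely many nodes lie in a disc of radius \<open>r < 1\<close>, hence the geometric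
  decay, with constants that do not depend on \<open>F\<close>.\<close>

lemma point_combination_moments:
  assumes "l \<in> point_combinations"
  obtains C r where "0 \<le> C" "0 \<le> r" "r < 1"
    "\<And>F m. (\<And>z. z \<in> ball 0 1 \<Longrightarrow> cmod (F z) \<le> 1) \<Longrightarrow> cmod (l (\<lambda>z. F z * z ^ m)) \<le> C * r ^ m"
proof -
  obtain n :: nat and p c where h: "\<And>i. i < n \<Longrightarrow> p i \<in> ball 0 1" "l = (\<lambda>f. \<Sum>i<n. c i * f (p i))"
    using assms(1) by (rule point_combinationsE) blast
  \<comment> \<open>Inserting 0 keeps the maximum defined for the empty combination.\<close>
  define r where "r = Max (insert 0 ((\<lambda>i. cmod (p i)) ` {..<n}))"
  have r: "0 \<le> r" "r < 1" using h(1) by (auto simp: r_def)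
  have pr: "cmod (p i) \<le> r" if "i < n" for i using that by (auto simp: r_def intro!: Max_ge)
  have "cmod (l (\<lambda>z. F z * z ^ m)) \<le> (\<Sum>i<n. cmod (c i)) * r ^ m"
    if "\<And>z. z \<in> ball 0 1 \<Longrightarrow> cmod (F z) \<le> 1" for F m
    unfolding h(2) sum_distrib_right
  proof (rule sum_norm_le)
    fix i assume i: "i \<in> {..<n}"
    have "cmod (c i * (F (p i) * p i ^ m)) = cmod (c i) * (cmod (F (p i)) * cmod (p i) ^ m)"
      by (simp add: norm_mult norm_power)
    also have "\<dots> \<le> cmod (c i) * (1 * r ^ m)"
      using i pr h(1) that by (intro mult_left_mono mult_mono power_mono) auto
    finally show "cmod (c i * (F (p i) * p i ^ m)) \<le> cmod (c i) * r ^ m" by simp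
  qed
  with r show ?thesis by (intro that[of "\<Sum>i<n. cmod (c i)" r]) (auto intro: sum_nonneg)
qed

lemma moments_square_summable:
  assumes "l \<in> point_combinations" "\<And>z. z \<in> ball 0 1 \<Longrightarrow> cmod (F z) \<le> 1"
  shows "summable (\<lambda>m. (cmod (l (\<lambda>z. F z * z ^ m)))\<^sup>2)"
proof -
  obtain C r where C: "0 \<le> C" "0 \<le> r" "r < 1"
    "\<And>m. cmod (l (\<lambda>z. F z * z ^ m)) \<le> C * r ^ m"
    using point_combination_moments[OF assms(1)] assms(2) by metis
  have "r\<^sup>2 < 1" using C by (simp add: power_less_one_iff abs_square_less_1)
  then have "summable (\<lambda>m. C\<^sup>2 * (r\<^sup>2) ^ m)"
    using C by (intro summable_mult summable_geometric) simp
  moreover have "norm ((cmod (l (\<lambda>z. F z * z ^ m)))\<^sup>2) \<le> C\<^sup>2 * (r\<^sup>2) ^ m" for m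
  proof -
    have "(cmod (l (\<lambda>z. F z * z ^ m)))\<^sup>2 \<le> (C * r ^ m)\<^sup>2" by (intro power_mono C) auto
    then show ?thesis by (simp add: power_mult_distrib mult.commute flip: power_mult)
  qed
  ultimately show ?thesis by (rule summable_comparison_test'[where N = 0])
qed

lemma Cauchy_Schwarz_sums:
  fixes f x :: "nat \<Rightarrow> complex"
  assumes "(\<lambda>j. f j * x j) sums s" "summable (\<lambda>j. (cmod (f j))\<^sup>2)" "summable (\<lambda>j. (cmod (x j))\<^sup>2)"
  shows "(cmod s)\<^sup>2 \<le> (\<Sum>j. (cmod (f j))\<^sup>2) * (\<Sum>j. (cmod (x j))\<^sup>2)"
proof -
  have "(cmod (\<Sum>j<d. f j * x j))\<^sup>2 \<le> (\<Sum>j. (cmod (f j))\<^sup>2) * (\<Sum>j. (cmod (x j))\<^sup>2)" for d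
  proof -
    have "(cmod (\<Sum>j<d. f j * x j))\<^sup>2 \<le> (\<Sum>j<d. cmod (f j) * cmod (x j))\<^sup>2"
      by (intro power_mono sum_norm_le) (auto simp: norm_mult)
    also have "\<dots> \<le> (\<Sum>j<d. (cmod (f j))\<^sup>2) * (\<Sum>j<d. (cmod (x j))\<^sup>2)"
      by (rule Cauchy_Schwarz_ineq_sum)
    also have "\<dots> \<le> (\<Sum>j. (cmod (f j))\<^sup>2) * (\<Sum>j. (cmod (x j))\<^sup>2)"
      by (intro mult_mono sum_le_suminf assms sum_nonneg suminf_nonneg) auto
    finally show ?thesis .
  qed
  moreover have "(\<lambda>d. (cmod (\<Sum>j<d. f j * x j))\<^sup>2) \<longlonglongrightarrow> (cmod s)\<^sup>2"
    using assms(1) by (intro tendsto_intros) (simp add: sums_def)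
  ultimately show ?thesis by (intro LIMSEQ_le_const2) auto
qed

section \<open>The quadratic form of the kernel and its positivity\<close>

text \<open>Expanding \<open>1 / (1 - z * cnj w)\<close> as a geometric series shows that this is
  the double sum of \<open>c i * cnj (c j) * dBR_kernel b (p i) (p j)\<close>. Written through
  moments, it visibly depends on the functional alone and not on its nodes and weights.\<close>

definition defect_form :: "(complex \<Rightarrow> complex) \<Rightarrow> ((complex \<Rightarrow> complex) \<Rightarrow> complex) \<Rightarrow> real" where
  "defect_form b l = (\<Sum>m. (cmod (l (\<lambda>z. z ^ m)))\<^sup>2 - (cmod (l (\<lambda>z. b z * z ^ m)))\<^sup>2)"

lemma monomial_moments_square_summable:
  "l \<in> point_combinations \<Longrightarrow> summable (\<lambda>m. (cmod (l (\<lambda>z. z ^ m)))\<^sup>2)"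
  using moments_square_summable[of l "\<lambda>_. 1"] by simp

lemma defect_form_eq:
  assumes "Hinf_ball b" "l \<in> point_combinations"
  shows "defect_form b l = (\<Sum>m. (cmod (l (\<lambda>z. z ^ m)))\<^sup>2) - (\<Sum>m. (cmod (l (\<lambda>z. b z * z ^ m)))\<^sup>2)"
  unfolding defect_form_def
  by (rule suminf_diff[OF monomial_moments_square_summable moments_square_summable, symmetric])
     (use assms in \<open>auto simp: Hinf_ball_def\<close>)

lemma dBR_kernel_sums:
  assumes "cmod z < 1" "cmod w < 1"
  shows "(\<lambda>m. z ^ m * cnj (w ^ m) - (b z * z ^ m) * cnj (b w * w ^ m)) sums dBR_kernel b z w"
proof -
  have "cmod (z * cnj w) < 1"
    using mult_left_mono[of "cmod w" 1 "cmod z"] assms by (simp add: norm_mult)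
  from sums_mult[OF geometric_sums[OF this], of "1 - b z * cnj (b w)"]
  show ?thesis by (simp add: dBR_kernel_def algebra_simps)
qed

lemma kernel_quadratic_form:
  assumes b: "Hinf_ball b" and p: "\<forall>i<n::nat. p i \<in> ball 0 1"
  shows "(\<Sum>i<n. \<Sum>j<n. c i * cnj (c j) * (complex_of_real D * dBR_kernel b (p i) (p j) - f (p i) * cnj (f (p j))))
     = complex_of_real (D * defect_form b (\<lambda>f. \<Sum>i<n. c i * f (p i)) - (cmod (\<Sum>i<n. c i * f (p i)))\<^sup>2)"
proof -
  define l where "l f = (\<Sum>i<n. c i * f (p i))" for f
  have l: "l \<in> point_combinations" using point_combinationsI[of n p c] p by (simp add: l_def[abs_def])
  have sq: "(\<Sum>i<n. \<Sum>j<n. c i * cnj (c j) * (g (p i) * cnj (g (p j)))) = complex_of_real ((cmod (l g))\<^sup>2)" for g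
    unfolding complex_norm_square l_def by (simp add: sum_product mult_ac)
  have "(\<lambda>m. \<Sum>i<n. \<Sum>j<n. c i * cnj (c j) * (p i ^ m * cnj (p j ^ m) - (b (p i) * p i ^ m) * cnj (b (p j) * p j ^ m)))
      sums (\<Sum>i<n. \<Sum>j<n. c i * cnj (c j) * dBR_kernel b (p i) (p j))"
    by (intro sums_sum sums_mult dBR_kernel_sums) (use p in auto)
  also have "(\<lambda>m. \<Sum>i<n. \<Sum>j<n. c i * cnj (c j) * (p i ^ m * cnj (p j ^ m) - (b (p i) * p i ^ m) * cnj (b (p j) * p j ^ m)))
      = (\<lambda>m. complex_of_real ((cmod (l (\<lambda>z. z ^ m)))\<^sup>2 - (cmod (l (\<lambda>z. b z * z ^ m)))\<^sup>2))"
    unfolding of_real_diff sq[symmetric] by (simp only: right_diff_distrib sum_subtractf)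
  finally have 1: "(\<lambda>m. complex_of_real ((cmod (l (\<lambda>z. z ^ m)))\<^sup>2 - (cmod (l (\<lambda>z. b z * z ^ m)))\<^sup>2)) sums
     (\<Sum>i<n. \<Sum>j<n. c i * cnj (c j) * dBR_kernel b (p i) (p j))" .
  have "(\<lambda>m. (cmod (l (\<lambda>z. z ^ m)))\<^sup>2 - (cmod (l (\<lambda>z. b z * z ^ m)))\<^sup>2) sums defect_form b l"
    unfolding defect_form_def
    by (intro summable_sums summable_diff monomial_moments_square_summable moments_square_summable l)
       (use b in \<open>auto simp: Hinf_ball_def\<close>)
  from sums_unique2[OF 1 sums_of_real[OF this]]
  have 2: "(\<Sum>i<n. \<Sum>j<n. c i * cnj (c j) * dBR_kernel b (p i) (p j)) = complex_of_real (defect_form b l)" .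
  have "(\<Sum>i<n. \<Sum>j<n. c i * cnj (c j) * (complex_of_real D * dBR_kernel b (p i) (p j) - f (p i) * cnj (f (p j)))) =
     complex_of_real D * (\<Sum>i<n. \<Sum>j<n. c i * cnj (c j) * dBR_kernel b (p i) (p j)) -
     (\<Sum>i<n. \<Sum>j<n. c i * cnj (c j) * (f (p i) * cnj (f (p j))))"
    by (simp add: right_diff_distrib sum_subtractf sum_distrib_left mult_ac)
  then show ?thesis unfolding 2 sq by (simp add: l_def[abs_def])
qed

text \<open>Evaluated at nodes and weights representing \<open>l\<close>, the form of the kernel is
  \<open>D * defect_form b l - |l f|^2\<close>, so Aronszajn's condition says that \<open>f\<close>
  is a bounded functional on point combinations with respect to the seminorm
  \<open>sqrt (defect_form b l)\<close>. The number \<open>D\<close> stands for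
  \<open>C^2\<close>.\<close>

lemma psd_kernel_iff:
  assumes "Hinf_ball b"
  shows "psd_kernel (\<lambda>z w. complex_of_real D * dBR_kernel b z w - f z * cnj (f w)) \<longleftrightarrow>
     (\<forall>l\<in>point_combinations. (cmod (l f))\<^sup>2 \<le> D * defect_form b l)"
proof
  assume L: "psd_kernel (\<lambda>z w. complex_of_real D * dBR_kernel b z w - f z * cnj (f w))"
  show "\<forall>l\<in>point_combinations. (cmod (l f))\<^sup>2 \<le> D * defect_form b l"
  proof
    fix l assume "l \<in> point_combinations"
    then obtain n :: nat and p c where h: "\<forall>i<n. p i \<in> ball 0 1" "l = (\<lambda>f. \<Sum>i<n. c i * f (p i))"
      by (rule point_combinationsE) blast
    have "0 \<le> Re (complex_of_real (D * defect_form b (\<lambda>f. \<Sum>i<n. c i * f (p i)) - (cmod (\<Sum>i<n. c i * f (p i)))\<^sup>2))"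
      using L[unfolded psd_kernel_def, THEN spec[of _ n], THEN spec[of _ p], THEN spec[of _ c]] h(1)
      unfolding Let_def kernel_quadratic_form[OF assms h(1)] by blast
    then show "(cmod (l f))\<^sup>2 \<le> D * defect_form b l" by (simp add: h(2))
  qed
next
  assume R: "\<forall>l\<in>point_combinations. (cmod (l f))\<^sup>2 \<le> D * defect_form b l"
  show "psd_kernel (\<lambda>z w. complex_of_real D * dBR_kernel b z w - f z * cnj (f w))"
    unfolding psd_kernel_def
  proof (intro allI impI)
    fix n :: nat and p c :: "nat \<Rightarrow> complex"
    assume p: "\<forall>i<n. p i \<in> ball 0 1"
    from R point_combinationsI[of n p c] p show "let s = \<Sum>i<n. \<Sum>j<n. c i * cnj (c j) * (complex_of_real D * dBR_kernel b (p i) (p j) - f (p i) * cnj (f (p j)))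
        in s \<in> \<real> \<and> 0 \<le> Re s"
      unfolding kernel_quadratic_form[OF assms p] Let_def by auto
  qed
qed

text \<open>If \<open>|b|^2 + |f|^2 \<le> 1\<close> on the circle, the row \<open>(b, f)\<close>
  acts as a contraction from pairs of Hardy functions to Hardy functions. The claim is contractivity
  of its adjoint on the vector representing \<open>l\<close>; duality with polynomials takes the
  place of the adjoint.\<close>

lemma row_contraction:
  assumes b: "Hinf_ball b" and f: "Hinf_ball f"
    and ae: "AE t in lebesgue_on {0..2*pi}. \<exists>e. (e \<longlongrightarrow> 0) (at_left 1) \<and>
        (\<forall>r\<in>{0..<1}. (cmod (b (of_real r * cis t)))\<^sup>2 + (cmod (f (of_real r * cis t)))\<^sup>2 \<le> 1 + e r)"
    and l: "l \<in> point_combinations"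
  shows "(\<Sum>m. (cmod (l (\<lambda>z. b z * z ^ m)))\<^sup>2) + (\<Sum>m. (cmod (l (\<lambda>z. f z * z ^ m)))\<^sup>2)
     \<le> (\<Sum>m. (cmod (l (\<lambda>z. z ^ m)))\<^sup>2)"
proof -
  define y where "y m = l (\<lambda>z. b z * z ^ m)" for m
  define w where "w m = l (\<lambda>z. f z * z ^ m)" for m
  define X where "X = (\<Sum>m. (cmod (l (\<lambda>z. z ^ m)))\<^sup>2)"
  have b1: "cmod (b z) \<le> 1" and f1: "cmod (f z) \<le> 1" if "z \<in> ball 0 1" for z
    using b f that by (auto simp: Hinf_ball_def)
  have part: "(\<Sum>m<M. (cmod (y m))\<^sup>2) + (\<Sum>m<M. (cmod (w m))\<^sup>2) \<le> X" for M
  proof -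
    define S where "S = (\<Sum>m<M. (cmod (y m))\<^sup>2) + (\<Sum>m<M. (cmod (w m))\<^sup>2)"
    have S0: "S \<ge> 0" unfolding S_def by (intro add_nonneg_nonneg sum_nonneg) auto
    \<comment> \<open>With the conjugated moments as coefficients, \<open>l F\<close> becomes
      \<open>S\<close>, and the squared Hardy norm of \<open>F\<close> is at most \<open>S\<close>.
      Cauchy-Schwarz then gives \<open>S^2 \<le> S * X\<close>.\<close>
    define Y where "Y z = (\<Sum>m<M. cnj (y m) * z ^ m)" for z
    define W where "W z = (\<Sum>m<M. cnj (w m) * z ^ m)" for z
    define F where "F z = b z * Y z + f z * W z" for z
    have Yp: "pser Y (\<lambda>j. if j < M then cnj (y j) else 0)" and Wp: "pser W (\<lambda>j. if j < M then cnj (w j) else 0)"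
      unfolding Y_def W_def by (rule pser_polynomial)+
    have "F holomorphic_on ball 0 1"
      unfolding F_def using b f pser_holomorphic[OF Yp] pser_holomorphic[OF Wp]
      by (intro holomorphic_intros) (auto simp: Hinf_ball_def)
    then have Fp: "pser F (taylor_coeff F)" by (rule pser_taylor)
    define B where "B = (\<Sum>m<M. cmod (y m)) + (\<Sum>m<M. cmod (w m))"
    have YW: "cmod (Y z) \<le> (\<Sum>m<M. cmod (y m))" "cmod (W z) \<le> (\<Sum>m<M. cmod (w m))" if "z \<in> ball 0 1" for z
      unfolding Y_def W_def using that
      by (auto intro!: sum_norm_le simp: norm_mult norm_power mult_left_le power_le_one)
    have nn: "0 \<le> (\<Sum>m<M. cmod (y m))" "0 \<le> (\<Sum>m<M. cmod (w m))" by (auto intro: sum_nonneg)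
    have BY: "cmod (Y z) \<le> B" and BW: "cmod (W z) \<le> B" if "z \<in> ball 0 1" for z
      using YW[OF that] nn by (auto simp: B_def)
    have BF: "cmod (F z) \<le> B" if "z \<in> ball 0 1" for z
    proof -
      have "cmod (F z) \<le> cmod (b z) * cmod (Y z) + cmod (f z) * cmod (W z)"
        unfolding F_def by (rule order_trans[OF norm_triangle_ineq]) (simp add: norm_mult)
      also have "\<dots> \<le> 1 * (\<Sum>m<M. cmod (y m)) + 1 * (\<Sum>m<M. cmod (w m))"
        by (intro add_mono mult_mono b1 f1 YW that) auto
      finally show ?thesis by (simp add: B_def)
    qed
    have "(\<Sum>j. (cmod (taylor_coeff F j))\<^sup>2) \<le>
       (\<Sum>j. (cmod (if j < M then cnj (y j) else 0))\<^sup>2) + (\<Sum>j. (cmod (if j < M then cnj (w j) else 0))\<^sup>2)"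
    proof (rule coeff_square_sum_le[OF Fp Yp Wp BF BY BW])
      show "AE t in lebesgue_on {0..2*pi}. \<exists>e. (e \<longlongrightarrow> 0) (at_left 1) \<and>
        (\<forall>r\<in>{0..<1}. (cmod (F (of_real r * cis t)))\<^sup>2 \<le>
            (cmod (Y (of_real r * cis t)))\<^sup>2 + (cmod (W (of_real r * cis t)))\<^sup>2 + e r)"
        using ae
      proof eventually_elim
        fix t assume "\<exists>e. (e \<longlongrightarrow> 0) (at_left 1) \<and>
          (\<forall>r\<in>{0..<1}. (cmod (b (of_real r * cis t)))\<^sup>2 + (cmod (f (of_real r * cis t)))\<^sup>2 \<le> 1 + e r)"
        then obtain e where e: "(e \<longlongrightarrow> 0) (at_left 1)"
          "\<And>r. r \<in> {0..<1} \<Longrightarrow> (cmod (b (of_real r * cis t)))\<^sup>2 + (cmod (f (of_real r * cis t)))\<^sup>2 \<le> 1 + e r"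
          by blast
        show "\<exists>e. (e \<longlongrightarrow> 0) (at_left 1) \<and>
        (\<forall>r\<in>{0..<1}. (cmod (F (of_real r * cis t)))\<^sup>2 \<le>
            (cmod (Y (of_real r * cis t)))\<^sup>2 + (cmod (W (of_real r * cis t)))\<^sup>2 + e r)"
        \<comment> \<open>Cauchy-Schwarz in two complex dimensions costs the factor
          \<open>|b|^2 + |f|^2 \<le> 1 + e r\<close>; its excess over 1 multiplies
          \<open>|Y|^2 + |W|^2\<close>, which is at most \<open>2 B^2\<close>.\<close>
        proof (intro exI[of _ "\<lambda>r. \<bar>e r\<bar> * (B\<^sup>2 + B\<^sup>2)"] conjI ballI)
          show "((\<lambda>r. \<bar>e r\<bar> * (B\<^sup>2 + B\<^sup>2)) \<longlongrightarrow> 0) (at_left 1)"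
            by (intro tendsto_mult_left_zero tendsto_rabs_zero e(1))
          fix r :: real assume r: "r \<in> {0..<1}"
          define z where "z = of_real r * cis t"
          have z: "z \<in> ball 0 1" using r by (simp add: z_def norm_mult)
          have "(cmod (F z))\<^sup>2 \<le> (cmod (b z) * cmod (Y z) + cmod (f z) * cmod (W z))\<^sup>2"
            unfolding F_def by (intro power_mono order_trans[OF norm_triangle_ineq]) (auto simp: norm_mult)
          also have "\<dots> \<le> ((cmod (b z))\<^sup>2 + (cmod (f z))\<^sup>2) * ((cmod (Y z))\<^sup>2 + (cmod (W z))\<^sup>2)"
          proof -
            have "0 \<le> (cmod (b z) * cmod (W z) - cmod (f z) * cmod (Y z))\<^sup>2" by simp
            then show ?thesis by (simp add: power2_eq_square algebra_simps)
          qed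
          also have "\<dots> \<le> (1 + \<bar>e r\<bar>) * ((cmod (Y z))\<^sup>2 + (cmod (W z))\<^sup>2)"
            using e(2)[OF r] by (intro mult_right_mono) (auto simp: z_def)
          also have "\<dots> \<le> (cmod (Y z))\<^sup>2 + (cmod (W z))\<^sup>2 + \<bar>e r\<bar> * (B\<^sup>2 + B\<^sup>2)"
          proof -
            have "\<bar>e r\<bar> * ((cmod (Y z))\<^sup>2 + (cmod (W z))\<^sup>2) \<le> \<bar>e r\<bar> * (B\<^sup>2 + B\<^sup>2)"
              by (intro mult_left_mono add_mono power_mono BY BW z) auto
            then show ?thesis by (simp add: algebra_simps)
          qed
          finally show "(cmod (F (of_real r * cis t)))\<^sup>2 \<le> (cmod (Y (of_real r * cis t)))\<^sup>2 +
             (cmod (W (of_real r * cis t)))\<^sup>2 + \<bar>e r\<bar> * (B\<^sup>2 + B\<^sup>2)" by (simp add: z_def)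
        qed
      qed
    qed
    also have "\<dots> = S"
    proof -
      have "(\<Sum>j. (cmod (if j < M then cnj (v j) else 0))\<^sup>2) = (\<Sum>j<M. (cmod (v j))\<^sup>2)" for v
        by (subst suminf_finite[of "{..<M}"]) auto
      then show ?thesis by (simp add: S_def)
    qed
    finally have FS: "(\<Sum>j. (cmod (taylor_coeff F j))\<^sup>2) \<le> S" .
    have "l F = (\<Sum>m<M. cnj (y m) * y m) + (\<Sum>m<M. cnj (w m) * w m)"
    proof -
      have "F = (\<lambda>z. (\<Sum>m<M. cnj (y m) * (b z * z ^ m)) + (\<Sum>m<M. cnj (w m) * (f z * z ^ m)))"
        by (simp add: F_def Y_def W_def sum_distrib_left mult_ac fun_eq_iff)
      then show ?thesis
        by (simp add: point_combination_add[OF l] point_combination_sum[OF l] point_combination_mult[OF l] y_def w_def)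
    qed
    also have "\<dots> = of_real S"
      unfolding S_def of_real_add of_real_sum complex_norm_square by (simp add: mult.commute)
    finally have "S\<^sup>2 = (cmod (l F))\<^sup>2" by simp
    also have "\<dots> \<le> (\<Sum>j. (cmod (taylor_coeff F j))\<^sup>2) * X"
      unfolding X_def
      by (intro Cauchy_Schwarz_sums point_combination_pser l Fp bounded_coeff_square_summable(1)[OF Fp BF]
          monomial_moments_square_summable)
    also have "\<dots> \<le> S * X"
      using FS by (intro mult_right_mono) (auto simp: X_def intro!: suminf_nonneg monomial_moments_square_summable l)
    finally have "S * S \<le> S * X" by (simp add: power2_eq_square)
    moreover have "X \<ge> 0" by (auto simp: X_def intro!: suminf_nonneg monomial_moments_square_summable l)
    ultimately have "S \<le> X" using S0 by (cases "S = 0") auto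
    then show ?thesis by (simp add: S_def)
  qed
  have "(\<lambda>M. (\<Sum>m<M. (cmod (y m))\<^sup>2) + (\<Sum>m<M. (cmod (w m))\<^sup>2)) \<longlonglongrightarrow> (\<Sum>m. (cmod (y m))\<^sup>2) + (\<Sum>m. (cmod (w m))\<^sup>2)"
    by (intro tendsto_add summable_LIMSEQ) (auto simp: y_def w_def intro!: moments_square_summable l b1 f1)
  then have "(\<Sum>m. (cmod (y m))\<^sup>2) + (\<Sum>m. (cmod (w m))\<^sup>2) \<le> X"
    by (rule LIMSEQ_le_const2) (use part in auto)
  then show ?thesis by (simp add: X_def y_def w_def)
qed

section \<open>The space \<open>H(b)\<close> as a dual space\<close>

lemma cmod_parallelogram: "(cmod (x + y))\<^sup>2 + (cmod (x - y))\<^sup>2 = 2 * (cmod x)\<^sup>2 + 2 * (cmod y)\<^sup>2"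
  unfolding cmod_power2 by (simp add: power2_eq_square algebra_simps)

text \<open>The second assumption is positivity of the kernel. Isolating it keeps the duality
  arguments independent of \<open>a\<close>; for the given \<open>b\<close> it is a by-product of
  the row contraction.\<close>

locale Hb_space =
  fixes b :: "complex \<Rightarrow> complex"
  assumes ball: "Hinf_ball b"
    and defect_nonneg: "\<And>l. l \<in> point_combinations \<Longrightarrow> 0 \<le> defect_form b l"
begin

abbreviation "Q \<equiv> defect_form b"
abbreviation "N \<equiv> Hb_norm b"

lemma defect_form_sums:
  assumes "l \<in> point_combinations"
  shows "(\<lambda>m. (cmod (l (\<lambda>z. z ^ m)))\<^sup>2 - (cmod (l (\<lambda>z. b z * z ^ m)))\<^sup>2) sums Q l"
  unfolding defect_form_def
  by (intro summable_sums summable_diff monomial_moments_square_summable moments_square_summable assms)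
     (use ball in \<open>auto simp: Hinf_ball_def\<close>)

lemma defect_form_scale:
  assumes "l \<in> point_combinations"
  shows "Q (\<lambda>f. a * l f) = (cmod a)\<^sup>2 * Q l"
proof (rule sums_unique2)
  show "(\<lambda>m. (cmod (a * l (\<lambda>z. z ^ m)))\<^sup>2 - (cmod (a * l (\<lambda>z. b z * z ^ m)))\<^sup>2) sums Q (\<lambda>f. a * l f)"
    by (rule defect_form_sums[OF point_combinations_scale[OF assms]])
  show "(\<lambda>m. (cmod (a * l (\<lambda>z. z ^ m)))\<^sup>2 - (cmod (a * l (\<lambda>z. b z * z ^ m)))\<^sup>2) sums ((cmod a)\<^sup>2 * Q l)"
    using sums_mult[OF defect_form_sums[OF assms], of "(cmod a)\<^sup>2"]
    by (simp add: norm_mult power_mult_distrib right_diff_distrib)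
qed

lemma defect_form_parallelogram:
  assumes l: "l \<in> point_combinations" and m: "m \<in> point_combinations"
  shows "Q (\<lambda>f. l f + m f) + Q (\<lambda>f. l f - m f) = 2 * Q l + 2 * Q m"
proof (rule sums_unique2)
  have e: "((cmod (x + y))\<^sup>2 - (cmod (x' + y'))\<^sup>2) + ((cmod (x - y))\<^sup>2 - (cmod (x' - y'))\<^sup>2) =
     2 * ((cmod x)\<^sup>2 - (cmod x')\<^sup>2) + 2 * ((cmod y)\<^sup>2 - (cmod y')\<^sup>2)" for x y x' y'
    using cmod_parallelogram[of x y] cmod_parallelogram[of x' y'] by (simp add: algebra_simps)
  show "(\<lambda>k. 2 * ((cmod (l (\<lambda>z. z ^ k)))\<^sup>2 - (cmod (l (\<lambda>z. b z * z ^ k)))\<^sup>2) +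
      2 * ((cmod (m (\<lambda>z. z ^ k)))\<^sup>2 - (cmod (m (\<lambda>z. b z * z ^ k)))\<^sup>2)) sums (2 * Q l + 2 * Q m)"
    by (intro sums_add sums_mult defect_form_sums l m)
  show "(\<lambda>k. 2 * ((cmod (l (\<lambda>z. z ^ k)))\<^sup>2 - (cmod (l (\<lambda>z. b z * z ^ k)))\<^sup>2) +
      2 * ((cmod (m (\<lambda>z. z ^ k)))\<^sup>2 - (cmod (m (\<lambda>z. b z * z ^ k)))\<^sup>2)) sums (Q (\<lambda>f. l f + m f) + Q (\<lambda>f. l f - m f))"
    unfolding e[symmetric]
    by (intro sums_add defect_form_sums[OF point_combinations_add[OF l m]] defect_form_sums[OF point_combinations_diff[OF l m]])
qed

lemma in_Hb_iff:
  "in_Hb b f \<longleftrightarrow> (\<exists>C\<ge>0. \<forall>l\<in>point_combinations. (cmod (l f))\<^sup>2 \<le> C\<^sup>2 * Q l)"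
  unfolding in_Hb_def psd_kernel_iff[OF ball] by simp

lemma Hb_norm_eq:
  "N f = Inf {C. 0 \<le> C \<and> (\<forall>l\<in>point_combinations. (cmod (l f))\<^sup>2 \<le> C\<^sup>2 * Q l)}"
  unfolding Hb_norm_def psd_kernel_iff[OF ball] by simp

lemma in_Hb_leI:
  assumes "0 \<le> C" "\<And>l. l \<in> point_combinations \<Longrightarrow> (cmod (l f))\<^sup>2 \<le> C\<^sup>2 * Q l"
  shows "in_Hb b f" "N f \<le> C"
proof -
  show "in_Hb b f" using assms unfolding in_Hb_iff by blast
  show "N f \<le> C" unfolding Hb_norm_eq
    by (rule cInf_lower) (use assms in \<open>auto intro!: bdd_belowI[of _ 0]\<close>)
qed

lemma Hb_norm_nonneg:
  assumes "in_Hb b f"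
  shows "0 \<le> N f"
  unfolding Hb_norm_eq by (rule cInf_greatest) (use assms in \<open>auto simp: in_Hb_iff\<close>)

text \<open>The infimum defining the norm is attained. If \<open>Q l > 0\<close>, every admissible
  constant is at least \<open>|l f| / sqrt (Q l)\<close>, hence so is the infimum; if
  \<open>Q l = 0\<close>, a single admissible constant already forces
  \<open>l f = 0\<close>.\<close>

lemma Hb_norm_bound:
  assumes f: "in_Hb b f" and l: "l \<in> point_combinations"
  shows "(cmod (l f))\<^sup>2 \<le> (N f)\<^sup>2 * Q l"
proof (cases "Q l = 0")
  case True
  then show ?thesis using f l unfolding in_Hb_iff by fastforce
next
  case False
  then have pos: "Q l > 0" using defect_nonneg[OF l] by simp
  have "sqrt ((cmod (l f))\<^sup>2 / Q l) \<le> N f"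
    unfolding Hb_norm_eq
  proof (rule cInf_greatest)
    show "{C. 0 \<le> C \<and> (\<forall>l\<in>point_combinations. (cmod (l f))\<^sup>2 \<le> C\<^sup>2 * Q l)} \<noteq> {}"
      using f by (auto simp: in_Hb_iff)
    fix C assume "C \<in> {C. 0 \<le> C \<and> (\<forall>l\<in>point_combinations. (cmod (l f))\<^sup>2 \<le> C\<^sup>2 * Q l)}"
    then show "sqrt ((cmod (l f))\<^sup>2 / Q l) \<le> C"
      using l pos by (intro real_le_lsqrt) (auto simp: field_simps)
  qed
  then have "(sqrt ((cmod (l f))\<^sup>2 / Q l))\<^sup>2 \<le> (N f)\<^sup>2"
    using pos by (intro power_mono) auto
  then show ?thesis using pos by (simp add: field_simps)
qed

lemma Hb_norm_apply:
  assumes "in_Hb b f" "l \<in> point_combinations"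
  shows "cmod (l f) \<le> N f * sqrt (Q l)"
  by (rule power2_le_imp_le)
     (use Hb_norm_bound[OF assms] Hb_norm_nonneg[OF assms(1)] defect_nonneg[OF assms(2)]
      in \<open>auto simp: power_mult_distrib\<close>)

lemma in_Hb_leI':
  assumes "0 \<le> C" "\<And>l. l \<in> point_combinations \<Longrightarrow> cmod (l f) \<le> C * sqrt (Q l)"
  shows "in_Hb b f" "N f \<le> C"
proof -
  have "(cmod (l f))\<^sup>2 \<le> C\<^sup>2 * Q l" if "l \<in> point_combinations" for l
    using power_mono[OF assms(2)[OF that], of 2] defect_nonneg[OF that] by (simp add: power_mult_distrib)
  from in_Hb_leI[OF assms(1) this] show "in_Hb b f" "N f \<le> C" by auto
qed

lemma in_Hb_add:
  assumes "in_Hb b f" "in_Hb b g"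
  shows "in_Hb b (\<lambda>z. f z + g z)" "N (\<lambda>z. f z + g z) \<le> N f + N g"
proof -
  have *: "cmod (l (\<lambda>z. f z + g z)) \<le> (N f + N g) * sqrt (Q l)" if "l \<in> point_combinations" for l
    unfolding point_combination_add[OF that]
    using norm_triangle_ineq[of "l f" "l g"] Hb_norm_apply[OF assms(1) that] Hb_norm_apply[OF assms(2) that]
    by (simp add: distrib_right)
  show "in_Hb b (\<lambda>z. f z + g z)" "N (\<lambda>z. f z + g z) \<le> N f + N g"
    using in_Hb_leI'[OF _ *] Hb_norm_nonneg assms by auto
qed

lemma in_Hb_scale_le:
  assumes "in_Hb b f"
  shows "in_Hb b (\<lambda>z. c * f z)" "N (\<lambda>z. c * f z) \<le> cmod c * N f"
proof -
  have *: "cmod (l (\<lambda>z. c * f z)) \<le> (cmod c * N f) * sqrt (Q l)" if "l \<in> point_combinations" for l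
    using mult_left_mono[OF Hb_norm_apply[OF assms that], of "cmod c"]
    by (simp add: point_combination_mult[OF that] norm_mult mult.assoc)
  show "in_Hb b (\<lambda>z. c * f z)" "N (\<lambda>z. c * f z) \<le> cmod c * N f"
    using in_Hb_leI'[OF _ *] Hb_norm_nonneg assms by auto
qed

lemmas in_Hb_scale = in_Hb_scale_le(1)

lemma Hb_norm_scale:
  assumes "in_Hb b f"
  shows "N (\<lambda>z. c * f z) = cmod c * N f"
proof (cases "c = 0")
  case True
  then show ?thesis
    using in_Hb_scale_le[OF assms, of 0] Hb_norm_nonneg[of "\<lambda>z. 0"] by simp
next
  case False
  have "N f \<le> cmod (1 / c) * N (\<lambda>z. c * f z)"
    using in_Hb_scale_le(2)[OF in_Hb_scale[OF assms, of c], of "1 / c"] False by simp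
  then have "cmod c * N f \<le> N (\<lambda>z. c * f z)"
    using False by (simp add: norm_divide field_simps)
  with in_Hb_scale_le(2)[OF assms, of c] show ?thesis by simp
qed

lemma in_Hb_zero: "in_Hb b (\<lambda>z. 0)" "N (\<lambda>z. 0) = 0"
proof -
  have *: "cmod (l (\<lambda>z. 0)) \<le> 0 * sqrt (Q l)" if "l \<in> point_combinations" for l
    by (simp add: point_combination_zero[OF that])
  show "in_Hb b (\<lambda>z. 0)" using in_Hb_leI'[OF _ *] by simp
  then show "N (\<lambda>z. 0) = 0" using in_Hb_leI'(2)[OF _ *] Hb_norm_nonneg by force
qed

lemma in_Hb_minus: "in_Hb b f \<Longrightarrow> in_Hb b (\<lambda>z. - f z)"
  using in_Hb_scale[of f "-1"] by simp

lemma Hb_norm_minus: "in_Hb b f \<Longrightarrow> N (\<lambda>z. - f z) = N f"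
  using Hb_norm_scale[of f "-1"] by simp

lemma in_Hb_diff:
  assumes "in_Hb b f" "in_Hb b g"
  shows "in_Hb b (\<lambda>z. f z - g z)" "N (\<lambda>z. f z - g z) \<le> N f + N g"
  using in_Hb_add[OF assms(1) in_Hb_minus[OF assms(2)]] Hb_norm_minus[OF assms(2)] by auto

lemma in_Hb_sum:
  assumes "finite A" "\<And>i. i \<in> A \<Longrightarrow> in_Hb b (f i)"
  shows "in_Hb b (\<lambda>z. \<Sum>i\<in>A. f i z)" "N (\<lambda>z. \<Sum>i\<in>A. f i z) \<le> (\<Sum>i\<in>A. N (f i))"
proof -
  have "in_Hb b (\<lambda>z. \<Sum>i\<in>A. f i z) \<and> N (\<lambda>z. \<Sum>i\<in>A. f i z) \<le> (\<Sum>i\<in>A. N (f i))"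
    using assms
  proof (induction A rule: finite_induct)
    case empty
    then show ?case by (simp add: in_Hb_zero)
  next
    case (insert i A)
    then show ?case using in_Hb_add[of "f i" "\<lambda>z. \<Sum>i\<in>A. f i z"] by fastforce
  qed
  then show "in_Hb b (\<lambda>z. \<Sum>i\<in>A. f i z)" "N (\<lambda>z. \<Sum>i\<in>A. f i z) \<le> (\<Sum>i\<in>A. N (f i))" by auto
qed

text \<open>A weighted arithmetic-geometric mean inequality. The weight \<open>t = 2\<close> will
  match the factors of the parallelogram law of \<open>Q\<close>.\<close>

lemma Re_apply_le:
  assumes f: "in_Hb b f" and l: "l \<in> point_combinations" and t: "t > 0"
  shows "2 * Re (l f) \<le> t * (N f)\<^sup>2 + Q l / t"
proof -
  have "2 * Re (l f) \<le> 2 * (N f * sqrt (Q l))"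
    using complex_Re_le_cmod[of "l f"] Hb_norm_apply[OF f l] by linarith
  also have "\<dots> \<le> t * (N f)\<^sup>2 + Q l / t"
  proof -
    have "0 \<le> (sqrt t * N f - sqrt (Q l / t))\<^sup>2" by simp
    also have "\<dots> = t * (N f)\<^sup>2 + Q l / t - 2 * (sqrt t * sqrt (Q l / t)) * N f"
      using t defect_nonneg[OF l] by (simp add: power2_diff power_mult_distrib)
    also have "sqrt t * sqrt (Q l / t) = sqrt (Q l)" using t by (simp flip: real_sqrt_mult)
    finally show ?thesis by (simp add: mult_ac)
  qed
  finally show ?thesis .
qed

text \<open>The quadratic form of the dual norm, \<open>N f\<^sup>2 = sup (2 Re l f - Q l)\<close>, is what makes the
  parallelogram law accessible without a Riesz representation.\<close>

lemma in_Hb_ReI: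
  assumes D: "\<And>l. l \<in> point_combinations \<Longrightarrow> 2 * Re (l f) \<le> D + Q l"
  shows "in_Hb b f" "(N f)\<^sup>2 \<le> D"
proof -
  have Q0: "Q (\<lambda>f. 0) = 0" using defect_form_scale[OF point_combinations_zero, of 0] by simp
  have D0: "D \<ge> 0" using D[OF point_combinations_zero] Q0 by simp
  have "(cmod (l f))\<^sup>2 \<le> (sqrt D)\<^sup>2 * Q l" if l: "l \<in> point_combinations" for l
  proof (cases "l f = 0")
    case True
    then show ?thesis using D0 defect_nonneg[OF l] by simp
  next
    case False
    define s where "s = cmod (l f)"
    have s: "s > 0" using False by (simp add: s_def)
    define w where "w = cnj (l f) / s"
    have "cnj (l f) * l f = of_real s * of_real s"
      using complex_norm_square[of "l f"] by (simp add: s_def power2_eq_square mult.commute)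
    then have w: "w * l f = s" "cmod w = 1"
      using s by (simp_all add: w_def norm_divide) (simp add: s_def)
    \<comment> \<open>\<open>w\<close> rotates \<open>l f\<close> onto the positive axis, so the
      hypothesis for the multiples \<open>t * w * l\<close> is a quadratic inequality in
      \<open>t\<close>. The value \<open>t = s / Q l\<close> is optimal; if \<open>Q l = 0\<close>,
      the choice \<open>t = (D + 1) / s\<close> contradicts it.\<close>
    have key: "2 * t * s \<le> D + t\<^sup>2 * Q l" for t :: real
    proof -
      have "Q (\<lambda>f. (of_real t * w) * l f) = t\<^sup>2 * Q l"
        unfolding defect_form_scale[OF l] by (simp add: norm_mult w(2))
      moreover have "Re ((of_real t * w) * l f) = t * s"
        unfolding mult.assoc w(1) by simp
      ultimately show ?thesis
        using D[OF point_combinations_scale[OF l, of "of_real t * w"]] by simp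
    qed
    show ?thesis
    proof (cases "Q l = 0")
      case True
      then show ?thesis using key[of "(D + 1) / s"] s D0 by simp
    next
      case nz: False
      then have Q: "Q l > 0" using defect_nonneg[OF l] by simp
      have "2 * (s / Q l) * s \<le> D + s\<^sup>2 / Q l"
        using key[of "s / Q l"] Q by (simp add: power2_eq_square)
      then have "s\<^sup>2 / Q l \<le> D" by (simp add: power2_eq_square)
      then show ?thesis using Q D0 by (simp add: s_def field_simps)
    qed
  qed
  from in_Hb_leI[OF _ this] D0 have *: "in_Hb b f" "N f \<le> sqrt D" by auto
  then show "in_Hb b f" by simp
  show "(N f)\<^sup>2 \<le> D" using power_mono[OF *(2) Hb_norm_nonneg[OF *(1)], of 2] D0 by simp
qed

text \<open>Apply \<open>l + m\<close> to \<open>f\<close> and \<open>l - m\<close> to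
  \<open>g\<close>. The parallelogram law of \<open>Q\<close> separates the variables, leaving
  \<open>f + g\<close> paired with \<open>l\<close> and \<open>f - g\<close> paired with
  \<open>m\<close>; the suprema over \<open>l\<close> and over \<open>m\<close> are then taken in
  turn.\<close>

lemma Hb_norm_parallelogram_le:
  assumes f: "in_Hb b f" and g: "in_Hb b g"
  shows "(N (\<lambda>z. f z + g z))\<^sup>2 + (N (\<lambda>z. f z - g z))\<^sup>2 \<le> 2 * (N f)\<^sup>2 + 2 * (N g)\<^sup>2"
proof -
  have key: "2 * Re (l (\<lambda>z. f z + g z)) - Q l + (2 * Re (m (\<lambda>z. f z - g z)) - Q m) \<le> 2 * (N f)\<^sup>2 + 2 * (N g)\<^sup>2"
    if l: "l \<in> point_combinations" and m: "m \<in> point_combinations" for l m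
  proof -
    have "2 * Re (l f + m f) \<le> 2 * (N f)\<^sup>2 + Q (\<lambda>f. l f + m f) / 2"
      using Re_apply_le[OF f point_combinations_add[OF l m], of 2] by simp
    moreover have "2 * Re (l g - m g) \<le> 2 * (N g)\<^sup>2 + Q (\<lambda>f. l f - m f) / 2"
      using Re_apply_le[OF g point_combinations_diff[OF l m], of 2] by simp
    ultimately show ?thesis
      using defect_form_parallelogram[OF l m]
      by (simp add: point_combination_add[OF l] point_combination_diff[OF m] algebra_simps)
  qed
  define D where "D = 2 * (N f)\<^sup>2 + 2 * (N g)\<^sup>2"
  have "2 * Re (m (\<lambda>z. f z - g z)) \<le> (D - (N (\<lambda>z. f z + g z))\<^sup>2) + Q m" if m: "m \<in> point_combinations" for m
  proof -
    have "2 * Re (l (\<lambda>z. f z + g z)) \<le> (D - (2 * Re (m (\<lambda>z. f z - g z)) - Q m)) + Q l" if "l \<in> point_combinations" for l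
      using key[OF that m] by (simp add: D_def)
    from in_Hb_ReI(2)[OF this] show ?thesis by simp
  qed
  from in_Hb_ReI(2)[OF this] show ?thesis by (simp add: D_def)
qed

text \<open>The converse inequality is the previous one applied to \<open>f + g\<close> and
  \<open>f - g\<close>, whose sum and difference are \<open>2 f\<close> and
  \<open>2 g\<close>.\<close>

lemma Hb_norm_parallelogram:
  assumes f: "in_Hb b f" and g: "in_Hb b g"
  shows "(N (\<lambda>z. f z + g z))\<^sup>2 + (N (\<lambda>z. f z - g z))\<^sup>2 = 2 * (N f)\<^sup>2 + 2 * (N g)\<^sup>2"
proof (rule antisym[OF Hb_norm_parallelogram_le[OF f g]])
  note fg = in_Hb_add(1)[OF f g] in_Hb_diff(1)[OF f g]
  have "(N (\<lambda>z. 2 * f z))\<^sup>2 + (N (\<lambda>z. 2 * g z))\<^sup>2 \<le>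
      2 * (N (\<lambda>z. f z + g z))\<^sup>2 + 2 * (N (\<lambda>z. f z - g z))\<^sup>2"
    using Hb_norm_parallelogram_le[OF fg] by simp
  then show "2 * (N f)\<^sup>2 + 2 * (N g)\<^sup>2 \<le> (N (\<lambda>z. f z + g z))\<^sup>2 + (N (\<lambda>z. f z - g z))\<^sup>2"
    by (simp add: Hb_norm_scale[OF f] Hb_norm_scale[OF g] power_mult_distrib)
qed

section \<open>Real inner product, point evaluations and completeness\<close>

definition re_inner :: "(complex \<Rightarrow> complex) \<Rightarrow> (complex \<Rightarrow> complex) \<Rightarrow> real" where
  "re_inner f g = ((N (\<lambda>z. f z + g z))\<^sup>2 - (N (\<lambda>z. f z - g z))\<^sup>2) / 4"

text \<open>In the polarization sum the odd powers of \<i> contribute only to the imaginary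
  part.\<close>

lemma Re_Hb_inner: "Re (Hb_inner b f g) = re_inner f g"
proof -
  have "{..<4::nat} = {0, 1, 2, 3}" by auto
  then show ?thesis by (simp add: Hb_inner_def re_inner_def power3_eq_cube)
qed

text \<open>A form of additivity in the second argument, obtained from the parallelogram law for
  \<open>F + y\<close> and \<open>F - y\<close> against \<open>x\<close>. It is the shape in which
  the gliding hump uses linearity.\<close>

lemma re_inner_diff:
  assumes F: "in_Hb b F" and x: "in_Hb b x" and y: "in_Hb b y"
  shows "re_inner F (\<lambda>z. x z + y z) - re_inner F (\<lambda>z. x z - y z) = 2 * re_inner F y"
proof -
  have 1: "(N (\<lambda>z. F z + y z + x z))\<^sup>2 + (N (\<lambda>z. F z + y z - x z))\<^sup>2 = 2 * (N (\<lambda>z. F z + y z))\<^sup>2 + 2 * (N x)\<^sup>2"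
    by (rule Hb_norm_parallelogram[OF in_Hb_add(1)[OF F y] x])
  have 2: "(N (\<lambda>z. F z - y z + x z))\<^sup>2 + (N (\<lambda>z. F z - y z - x z))\<^sup>2 = 2 * (N (\<lambda>z. F z - y z))\<^sup>2 + 2 * (N x)\<^sup>2"
    by (rule Hb_norm_parallelogram[OF in_Hb_diff(1)[OF F y] x])
  have e: "(\<lambda>z. F z + y z + x z) = (\<lambda>z. F z + (x z + y z))" "(\<lambda>z. F z + y z - x z) = (\<lambda>z. F z - (x z - y z))"
    "(\<lambda>z. F z - y z + x z) = (\<lambda>z. F z + (x z - y z))" "(\<lambda>z. F z - y z - x z) = (\<lambda>z. F z - (x z + y z))"
    by (auto simp: algebra_simps)
  show ?thesis using 1 2 unfolding re_inner_def e by (simp add: field_simps)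
qed

lemma re_inner_le:
  assumes F: "in_Hb b F" and y: "in_Hb b y"
  shows "\<bar>re_inner F y\<bar> \<le> N F * N y"
proof -
  have "(N (\<lambda>z. F z + y z))\<^sup>2 \<le> (N F + N y)\<^sup>2" "(N (\<lambda>z. F z - y z))\<^sup>2 \<le> (N F + N y)\<^sup>2"
    using in_Hb_add[OF F y] in_Hb_diff[OF F y] by (auto intro!: power_mono Hb_norm_nonneg)
  then show ?thesis using Hb_norm_parallelogram[OF F y]
    by (auto simp: re_inner_def power2_sum abs_le_iff)
qed

lemma re_inner_self_scale:
  assumes F: "in_Hb b F"
  shows "re_inner F (\<lambda>z. of_real t * F z) = t * (N F)\<^sup>2"
proof -
  have "(\<lambda>z. F z + of_real t * F z) = (\<lambda>z. of_real (1 + t) * F z)"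
    "(\<lambda>z. F z - of_real t * F z) = (\<lambda>z. of_real (1 - t) * F z)"
    by (auto simp: algebra_simps)
  then have "re_inner F (\<lambda>z. of_real t * F z) = ((1 + t)\<^sup>2 * (N F)\<^sup>2 - (1 - t)\<^sup>2 * (N F)\<^sup>2) / 4"
    unfolding re_inner_def by (simp only: Hb_norm_scale[OF F] norm_of_real power_mult_distrib power2_abs)
  also have "\<dots> = t * (N F)\<^sup>2" by (simp add: power2_eq_square algebra_simps)
  finally show ?thesis .
qed

text \<open>The squared norm of evaluation at \<open>z\<close> is the diagonal kernel value
  \<open>(1 - |b z|^2) / (1 - |z|^2)\<close>, here estimated term by term against the geometric
  series in \<open>|z|\<close>.\<close>

lemma Hb_eval_bound:
  assumes f: "in_Hb b f" and z: "cmod z < 1"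
  shows "cmod (f z) \<le> N f / (1 - cmod z)"
proof -
  have l: "(\<lambda>f. f z) \<in> point_combinations" using point_combinations_eval[of z] z by simp
  have "Q (\<lambda>f. f z) \<le> 1 / (1 - cmod z)"
  proof (rule sums_le)
    show "(\<lambda>m. (cmod (z ^ m))\<^sup>2 - (cmod (b z * z ^ m))\<^sup>2) sums Q (\<lambda>f. f z)"
      by (rule defect_form_sums[OF l])
    show "(\<lambda>m. cmod z ^ m) sums (1 / (1 - cmod z))" by (intro geometric_sums) (use z in simp)
    show "(cmod (z ^ m))\<^sup>2 - (cmod (b z * z ^ m))\<^sup>2 \<le> cmod z ^ m" for m
    proof -
      have "(cmod (z ^ m))\<^sup>2 \<le> cmod z ^ m"
        using z by (simp add: norm_power power2_eq_square mult_left_le power_le_one)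
      then show ?thesis by (smt (verit) zero_le_power2)
    qed
  qed
  also have "\<dots> \<le> (1 / (1 - cmod z))\<^sup>2"
    using z by (intro self_le_power) auto
  finally have "sqrt (Q (\<lambda>f. f z)) \<le> 1 / (1 - cmod z)"
    using z by (intro real_le_lsqrt) auto
  then have "N f * sqrt (Q (\<lambda>f. f z)) \<le> N f * (1 / (1 - cmod z))"
    by (intro mult_left_mono Hb_norm_nonneg f)
  then show ?thesis using Hb_norm_apply[OF f l] by simp
qed

text \<open>Evaluations are bounded, so the limit can be taken pointwise; an \<open>l\<close>
  involves finitely many nodes, so its estimates survive the limit. The rate is the one produced by
  the gliding hump, and \<open>4/3\<close> is the sum of the powers of \<open>1/4\<close>.
  Convergence is locally uniform, which makes the holomorphic members a closed subspace.\<close>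

lemma Hb_complete:
  assumes x: "\<And>k. in_Hb b (x k)" and d: "\<And>k. N (\<lambda>z. x (Suc k) z - x k z) \<le> (1/4) ^ k"
  obtains y where "in_Hb b y" "\<And>k. N (\<lambda>z. y z - x k z) \<le> 4/3 * (1/4) ^ k"
    "(\<And>k. x k holomorphic_on ball 0 1) \<Longrightarrow> y holomorphic_on ball 0 1"
proof -
  \<comment> \<open>Keeping the subtracted tail turns the bound into an exact geometric sum, so the
    induction closes without loss.\<close>
  have tel: "N (\<lambda>z. x (k + j) z - x k z) \<le> 4/3 * (1/4) ^ k - 4/3 * (1/4) ^ (k + j)" for k j
  proof (induction j)
    case 0
    then show ?case by (simp add: in_Hb_zero)
  next
    case (Suc j)
    have e: "(\<lambda>z. x (k + Suc j) z - x k z) = (\<lambda>z. (x (Suc (k + j)) z - x (k + j) z) + (x (k + j) z - x k z))"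
      by auto
    have "N (\<lambda>z. x (k + Suc j) z - x k z) \<le> N (\<lambda>z. x (Suc (k + j)) z - x (k + j) z) + N (\<lambda>z. x (k + j) z - x k z)"
      unfolding e by (rule in_Hb_add(2)[OF in_Hb_diff(1)[OF x x] in_Hb_diff(1)[OF x x]])
    also have "\<dots> \<le> (1/4) ^ (k + j) + (4/3 * (1/4) ^ k - 4/3 * (1/4) ^ (k + j))"
      by (intro add_mono d Suc.IH)
    finally show ?case by simp
  qed
  have tel': "N (\<lambda>z. x j z - x k z) \<le> 4/3 * (1/4) ^ k" if "k \<le> j" for k j
  proof -
    have "N (\<lambda>z. x j z - x k z) \<le> 4/3 * (1/4) ^ k - 4/3 * (1/4) ^ j"
      using tel[of k "j - k"] that by simp
    moreover have "0 \<le> (1/4 :: real) ^ j" by simp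
    ultimately show ?thesis by linarith
  qed
  have pt: "dist (x j z) (x k z) \<le> 4/3 * (1/4) ^ k / (1 - cmod z)" if "k \<le> j" "cmod z < 1" for j k z
  proof -
    have "cmod (x j z - x k z) \<le> N (\<lambda>z. x j z - x k z) / (1 - cmod z)"
      by (rule Hb_eval_bound[OF in_Hb_diff(1)[OF x x] that(2)])
    also have "\<dots> \<le> 4/3 * (1/4) ^ k / (1 - cmod z)"
      using that by (intro divide_right_mono tel') auto
    finally show ?thesis by (simp add: dist_norm)
  qed
  have conv: "convergent (\<lambda>k. x k z)" if z: "cmod z < 1" for z
  proof -
    have "(\<lambda>k. 4/3 * (1/4) ^ k / (1 - cmod z)) \<longlonglongrightarrow> 4/3 * 0 / (1 - cmod z)"
      by (intro tendsto_intros LIMSEQ_power_zero) (use z in auto)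
    then have lim0: "(\<lambda>k. 4/3 * (1/4) ^ k / (1 - cmod z)) \<longlonglongrightarrow> 0" by simp
    have "Cauchy (\<lambda>k. x k z)"
      unfolding Cauchy_altdef
    proof (intro allI impI)
      fix e :: real assume "0 < e"
      then obtain M where M: "\<And>k. k \<ge> M \<Longrightarrow> 4/3 * (1/4) ^ k / (1 - cmod z) < e"
        using order_tendstoD(2)[OF lim0, of e] by (auto simp: eventually_sequentially)
      show "\<exists>M. \<forall>m\<ge>M. \<forall>n>m. dist (x m z) (x n z) < e"
        using pt[OF _ z] M by (intro exI[of _ M]) (smt (verit) dist_commute less_imp_le_nat)
    qed
    then show ?thesis by (rule Cauchy_convergent)
  qed
  define y where "y z = lim (\<lambda>k. x k z)" for z
  have lim: "(\<lambda>k. x k z) \<longlonglongrightarrow> y z" if "cmod z < 1" for z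
    using conv[OF that] by (simp add: y_def convergent_LIMSEQ_iff)
  have ldist: "cmod (l (\<lambda>z. y z - x k z)) \<le> 4/3 * (1/4) ^ k * sqrt (Q l)" if l: "l \<in> point_combinations" for k l
  proof -
    obtain n :: nat and p c where h: "\<And>i. i < n \<Longrightarrow> p i \<in> ball 0 1" "l = (\<lambda>f. \<Sum>i<n. c i * f (p i))"
      using l by (rule point_combinationsE) blast
    have "(\<lambda>j. l (\<lambda>z. x j z - x k z)) \<longlonglongrightarrow> l (\<lambda>z. y z - x k z)"
      unfolding h(2) by (intro tendsto_intros lim) (use h(1) in auto)
    then have "(\<lambda>j. cmod (l (\<lambda>z. x j z - x k z))) \<longlonglongrightarrow> cmod (l (\<lambda>z. y z - x k z))" by (rule tendsto_norm)
    moreover have "cmod (l (\<lambda>z. x j z - x k z)) \<le> 4/3 * (1/4) ^ k * sqrt (Q l)" if "j \<ge> k" for j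
      using Hb_norm_apply[OF in_Hb_diff(1)[OF x x] l, of j k] tel'[OF that] defect_nonneg[OF l]
      by (meson mult_right_mono order_trans real_sqrt_ge_zero)
    ultimately show ?thesis by (intro LIMSEQ_le_const2) auto
  qed
  have D: "in_Hb b (\<lambda>z. y z - x k z)" "N (\<lambda>z. y z - x k z) \<le> 4/3 * (1/4) ^ k" for k
    using in_Hb_leI'[OF _ ldist] by auto
  have "in_Hb b (\<lambda>z. (y z - x 0 z) + x 0 z)" by (rule in_Hb_add(1)[OF D(1) x])
  then have yin: "in_Hb b y" by simp
  have "y holomorphic_on ball 0 1" if hol: "\<And>k. x k holomorphic_on ball 0 1"
  proof (rule holomorphic_uniform_sequence[OF open_ball hol])
    fix w :: complex assume "w \<in> ball 0 1"
    then have w: "cmod w < 1" by simp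
    define s where "s = (1 - cmod w) / 2"
    have s: "s > 0" using w by (simp add: s_def)
    have zs: "1 - cmod z \<ge> s" if "z \<in> cball w s" for z
      using that norm_triangle_ineq2[of z w] by (simp add: s_def dist_norm norm_minus_commute)
    have "uniform_limit (cball w s) x y sequentially"
    proof (rule uniform_limitI)
      fix e :: real assume e: "e > 0"
      have "(\<lambda>k. 4/3 * (1/4) ^ k / s) \<longlonglongrightarrow> 4/3 * 0 / s"
        by (intro tendsto_intros LIMSEQ_power_zero) (use s in auto)
      then have "\<forall>\<^sub>F k in sequentially. 4/3 * (1/4) ^ k / s < e"
        using order_tendstoD(2) e by fastforce
      then show "\<forall>\<^sub>F k in sequentially. \<forall>z\<in>cball w s. dist (x k z) (y z) < e"
      proof eventually_elim
        fix k assume k: "4/3 * (1/4) ^ k / s < e"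
        show "\<forall>z\<in>cball w s. dist (x k z) (y z) < e"
        proof
          fix z assume z: "z \<in> cball w s"
          have "dist (x k z) (y z) \<le> N (\<lambda>z. y z - x k z) / (1 - cmod z)"
            using Hb_eval_bound[OF D(1)[of k], of z] zs[OF z] s by (simp add: dist_norm norm_minus_commute)
          also have "\<dots> \<le> (4/3 * (1/4) ^ k) / s"
            by (intro frac_le D zs z s) auto
          finally show "dist (x k z) (y z) < e" using k by simp
        qed
      qed
    qed
    moreover have "cball w s \<subseteq> ball 0 1"
      using zs s by force
    ultimately show "\<exists>d>0. cball w d \<subseteq> ball 0 1 \<and> uniform_limit (cball w d) x y sequentially"
      using s by blast
  qed
  with yin D(2) show ?thesis by (intro that) auto
qed

end

section \<open>Uniform boundedness\<close>

context Hb_space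
begin

text \<open>Sokal's gliding hump argument. The second condition on \<open>p\<close>, a form of sublinearity, ensures
  that one of the two points \<open>x \<plusminus> y\<close> carries at least the value of \<open>p\<close> at \<open>y\<close>.\<close>

lemma gliding_hump:
  fixes p :: "nat \<Rightarrow> (complex \<Rightarrow> complex) \<Rightarrow> real" and U :: "nat \<Rightarrow> real"
  assumes X: "\<And>x. x \<in> X \<Longrightarrow> in_Hb b x" "(\<lambda>z. 0) \<in> X"
    "\<And>x y. x \<in> X \<Longrightarrow> y \<in> X \<Longrightarrow> (\<lambda>z. x z + y z) \<in> X"
    "\<And>x y. x \<in> X \<Longrightarrow> y \<in> X \<Longrightarrow> (\<lambda>z. x z - y z) \<in> X"
    and complete: "\<And>x. (\<And>k. x k \<in> X) \<Longrightarrow> (\<And>k. N (\<lambda>z. x (Suc k) z - x k z) \<le> (1/4) ^ k) \<Longrightarrow>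
        \<exists>y\<in>X. \<forall>k. N (\<lambda>z. y z - x k z) \<le> 4/3 * (1/4) ^ k"
    and Lip: "\<And>n x y. x \<in> X \<Longrightarrow> y \<in> X \<Longrightarrow> p n y - U n * N (\<lambda>z. x z - y z) \<le> p n x"
    and sym: "\<And>n x y. x \<in> X \<Longrightarrow> y \<in> X \<Longrightarrow> 2 * p n y \<le> p n (\<lambda>z. x z + y z) + p n (\<lambda>z. x z - y z)"
    and near: "\<And>n \<rho>. 0 < \<rho> \<Longrightarrow> \<exists>y\<in>X. N y \<le> \<rho> \<and> 3/4 * \<rho> * U n \<le> p n y"
    and pointwise: "\<And>x. x \<in> X \<Longrightarrow> \<exists>M. \<forall>n. p n x \<le> M"
  shows "\<exists>M. \<forall>n. U n \<le> M"
proof (rule ccontr)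
  assume "\<not> (\<exists>M. \<forall>n. U n \<le> M)"
  \<comment> \<open>Growth \<open>16^k\<close> against steps of size \<open>4^(-k)\<close> leaves a
    net growth of \<open>4^k\<close>.\<close>
  then have "\<exists>n. U n \<ge> 16 ^ k" for k :: nat by (meson linear not_le)
  then obtain \<nu> where \<nu>: "U (\<nu> k) \<ge> 16 ^ k" for k by metis
  have "\<exists>x. \<forall>k. x k \<in> X \<and> (N (\<lambda>z. x (Suc k) z - x k z) \<le> (1/4) ^ k \<and>
      3/4 * (1/4) ^ k * U (\<nu> k) \<le> p (\<nu> k) (x (Suc k)))"
  proof (rule dependent_nat_choice)
    show "\<exists>x. x \<in> X" using X(2) by blast
    fix x k assume x: "x \<in> X"
    obtain y where y: "y \<in> X" "N y \<le> (1/4) ^ k" "3/4 * (1/4) ^ k * U (\<nu> k) \<le> p (\<nu> k) y"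
      using near[of "(1/4) ^ k" "\<nu> k"] by auto
    have "p (\<nu> k) y \<le> p (\<nu> k) (\<lambda>z. x z + y z) \<or> p (\<nu> k) y \<le> p (\<nu> k) (\<lambda>z. x z - y z)"
      using sym[OF x y(1), of "\<nu> k"] by linarith
    then show "\<exists>x'. x' \<in> X \<and> (N (\<lambda>z. x' z - x z) \<le> (1/4) ^ k \<and> 3/4 * (1/4) ^ k * U (\<nu> k) \<le> p (\<nu> k) x')"
    proof
      assume "p (\<nu> k) y \<le> p (\<nu> k) (\<lambda>z. x z + y z)"
      then show ?thesis using X(3)[OF x y(1)] y by (intro exI[of _ "\<lambda>z. x z + y z"]) auto
    next
      assume "p (\<nu> k) y \<le> p (\<nu> k) (\<lambda>z. x z - y z)"
      then show ?thesis using X(4)[OF x y(1)] y Hb_norm_minus[OF X(1)[OF y(1)]]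
        by (intro exI[of _ "\<lambda>z. x z - y z"]) auto
    qed
  qed
  then obtain x where x: "\<And>k. x k \<in> X" "\<And>k. N (\<lambda>z. x (Suc k) z - x k z) \<le> (1/4) ^ k"
      "\<And>k. 3/4 * (1/4) ^ k * U (\<nu> k) \<le> p (\<nu> k) (x (Suc k))" by blast
  obtain y where y: "y \<in> X" "\<And>k. N (\<lambda>z. y z - x k z) \<le> 4/3 * (1/4) ^ k"
    using complete[OF x(1,2)] by blast
  obtain M where M: "\<And>n. p n y \<le> M" using pointwise[OF y(1)] by blast
  \<comment> \<open>\<open>5/12 = 3/4 - 1/3\<close>: the factor \<open>3/4\<close> comes from
    \<open>near\<close>, and \<open>1/3 = 4/3 * 1/4\<close> is the most that the steps after
    \<open>k\<close> can take away.\<close>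
  have lower: "5/12 * 4 ^ k \<le> M" for k :: nat
  proof -
    have U0: "U (\<nu> k) \<ge> 0" using order_trans[OF _ \<nu>[of k]] by simp
    have "U (\<nu> k) * N (\<lambda>z. y z - x (Suc k) z) \<le> U (\<nu> k) * (4/3 * (1/4) ^ Suc k)"
      by (intro mult_left_mono y(2) U0)
    then have "5/12 * (1/4) ^ k * U (\<nu> k) \<le> M"
      using Lip[OF y(1) x(1), of "\<nu> k" "Suc k"] x(3)[of k] M[of "\<nu> k"] by (simp add: algebra_simps)
    moreover have "5/12 * (1/4) ^ k * 16 ^ k \<le> 5/12 * (1/4) ^ k * U (\<nu> k)"
      by (intro mult_left_mono \<nu>) auto
    moreover have "(1/4) ^ k * 16 ^ k = (4::real) ^ k" by (simp flip: power_mult_distrib)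
    ultimately show ?thesis by (simp add: mult.assoc)
  qed
  obtain k :: nat where "12/5 * M < 4 ^ k" using real_arch_pow[of 4 "12/5 * M"] by auto
  then show False using lower[of k] by simp
qed

text \<open>Uniform boundedness for the real functionals \<open>re_inner (F n)\<close>. Their norm
  is \<open>N (F n)\<close>, attained on real multiples of \<open>F n\<close> itself, which supplies
  the nearly extremal vectors.\<close>

lemma weakly_bounded_imp_bounded:
  fixes F :: "nat \<Rightarrow> complex \<Rightarrow> complex"
  assumes F: "\<And>n. in_Hb b (F n)" and bd: "\<And>g. in_Hb b g \<Longrightarrow> \<exists>M. \<forall>n. \<bar>re_inner (F n) g\<bar> \<le> M"
  shows "\<exists>M. \<forall>n. N (F n) \<le> M"
proof (rule gliding_hump[where X = "{x. in_Hb b x}" and p = "\<lambda>n g. \<bar>re_inner (F n) g\<bar>"])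
  show "\<exists>y\<in>{x. in_Hb b x}. \<forall>k. N (\<lambda>z. y z - x k z) \<le> 4/3 * (1/4) ^ k"
    if "\<And>k. x k \<in> {x. in_Hb b x}" "\<And>k. N (\<lambda>z. x (Suc k) z - x k z) \<le> (1/4) ^ k" for x
    using Hb_complete[of x] that by (metis mem_Collect_eq)
  show "\<bar>re_inner (F n) y\<bar> - N (F n) * N (\<lambda>z. x z - y z) \<le> \<bar>re_inner (F n) x\<bar>"
    if "x \<in> {x. in_Hb b x}" "y \<in> {x. in_Hb b x}" for n x y
  proof -
    \<comment> \<open>Half sum and half difference write \<open>x\<close> and \<open>y\<close> as
      \<open>u + v\<close> and \<open>u - v\<close>, the form that \<open>re_inner_diff\<close>
      handles.\<close>
    define u where "u = (\<lambda>z. (1/2) * (x z + y z))"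
    define v where "v = (\<lambda>z. (1/2) * (x z - y z))"
    have uv: "in_Hb b u" "in_Hb b v" "N v = N (\<lambda>z. x z - y z) / 2"
      unfolding u_def v_def using that in_Hb_scale[OF in_Hb_add(1), of x y "1/2"]
        in_Hb_scale[OF in_Hb_diff(1), of x y "1/2"] Hb_norm_scale[OF in_Hb_diff(1), of x y "1/2"]
      by simp_all
    have e: "(\<lambda>z. u z + v z) = x" "(\<lambda>z. u z - v z) = y" by (auto simp: u_def v_def field_simps)
    have "re_inner (F n) x - re_inner (F n) y = 2 * re_inner (F n) v"
      using re_inner_diff[OF F uv(1,2), of n] unfolding e .
    moreover have "\<bar>re_inner (F n) v\<bar> \<le> N (F n) * N (\<lambda>z. x z - y z) / 2"
      using re_inner_le[OF F uv(2), of n] uv(3) by simp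
    ultimately show ?thesis by linarith
  qed
  show "2 * \<bar>re_inner (F n) y\<bar> \<le> \<bar>re_inner (F n) (\<lambda>z. x z + y z)\<bar> + \<bar>re_inner (F n) (\<lambda>z. x z - y z)\<bar>"
    if "x \<in> {x. in_Hb b x}" "y \<in> {x. in_Hb b x}" for n x y
    using re_inner_diff[OF F, of x y n] that by simp
  show "\<exists>y\<in>{x. in_Hb b x}. N y \<le> \<rho> \<and> 3/4 * \<rho> * N (F n) \<le> \<bar>re_inner (F n) y\<bar>" if "0 < \<rho>" for n \<rho>
  proof (cases "N (F n) = 0")
    case True
    then show ?thesis using that by (intro bexI[of _ "\<lambda>z. 0"]) (auto simp: in_Hb_zero)
  next
    case False
    then have pos: "N (F n) > 0" using Hb_norm_nonneg[OF F, of n] by simp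
    show ?thesis
    proof (intro bexI[of _ "\<lambda>z. of_real (\<rho> / N (F n)) * F n z"] conjI)
      show "N (\<lambda>z. of_real (\<rho> / N (F n)) * F n z) \<le> \<rho>"
        using pos that by (simp only: Hb_norm_scale[OF F] norm_of_real) simp
      show "3/4 * \<rho> * N (F n) \<le> \<bar>re_inner (F n) (\<lambda>z. of_real (\<rho> / N (F n)) * F n z)\<bar>"
        using pos that by (simp only: re_inner_self_scale[OF F]) (simp add: power2_eq_square)
      show "(\<lambda>z. of_real (\<rho> / N (F n)) * F n z) \<in> {x. in_Hb b x}"
        using in_Hb_scale[OF F] by blast
    qed
  qed
qed (use bd in \<open>auto simp: in_Hb_zero in_Hb_add in_Hb_diff\<close>)

text \<open>The Banach-Steinhaus theorem on the holomorphic members of H(b), where taking Taylor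
  coefficients is linear. Completeness of this subspace is the last clause of
  \<open>Hb_complete\<close>.\<close>

lemma operators_uniformly_bounded:
  fixes T :: "nat \<Rightarrow> (complex \<Rightarrow> complex) \<Rightarrow> complex \<Rightarrow> complex"
  defines "X \<equiv> {x. in_Hb b x \<and> x holomorphic_on ball 0 1}"
  assumes T: "\<And>n x. x \<in> X \<Longrightarrow> in_Hb b (T n x)"
    and add: "\<And>n x y. x \<in> X \<Longrightarrow> y \<in> X \<Longrightarrow> T n (\<lambda>z. x z + y z) = (\<lambda>z. T n x z + T n y z)"
    and scale: "\<And>n x c. x \<in> X \<Longrightarrow> T n (\<lambda>z. c * x z) = (\<lambda>z. c * T n x z)"
    and cont: "\<And>n. \<exists>C. \<forall>x\<in>X. N (T n x) \<le> C * N x"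
    and pointwise: "\<And>x. x \<in> X \<Longrightarrow> \<exists>M. \<forall>n. N (T n x) \<le> M"
  shows "\<exists>M. \<forall>n. \<forall>x\<in>X. N (T n x) \<le> M * N x"
proof -
  have X: "\<And>x. x \<in> X \<Longrightarrow> in_Hb b x" "(\<lambda>z. 0) \<in> X"
    "\<And>x y. x \<in> X \<Longrightarrow> y \<in> X \<Longrightarrow> (\<lambda>z. x z + y z) \<in> X"
    "\<And>x y. x \<in> X \<Longrightarrow> y \<in> X \<Longrightarrow> (\<lambda>z. x z - y z) \<in> X"
    "\<And>x c. x \<in> X \<Longrightarrow> (\<lambda>z. c * x z) \<in> X"
    by (auto simp: X_def in_Hb_zero in_Hb_add in_Hb_diff in_Hb_scale intro!: holomorphic_intros)
  have diff: "T n (\<lambda>z. x z - y z) = (\<lambda>z. T n x z - T n y z)" if "x \<in> X" "y \<in> X" for n x y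
    using add[OF that(1) X(5)[OF that(2), of "-1"], of n] scale[OF that(2), of n "-1"] by simp
  define B where "B n = (\<lambda>x. N (T n x)) ` {x \<in> X. N x \<le> 1}" for n
  define U where "U n = Sup (B n)" for n
  have bdd: "bdd_above (B n)" for n
  proof -
    obtain C where C: "\<forall>x\<in>X. N (T n x) \<le> C * N x" using cont by blast
    have "N (T n x) \<le> \<bar>C\<bar>" if "x \<in> X" "N x \<le> 1" for x
    proof -
      have "N (T n x) \<le> C * N x" using C that by blast
      also have "\<dots> \<le> \<bar>C\<bar> * 1"
        using that Hb_norm_nonneg[OF X(1)[OF that(1)]] by (intro mult_mono) auto
      finally show ?thesis by simp
    qed
    then show ?thesis unfolding B_def by (intro bdd_aboveI2) auto
  qed
  have T0: "N (T n (\<lambda>z. 0)) = 0" for n using scale[OF X(2), of n 0] by (simp add: in_Hb_zero)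
  have ne: "0 \<in> B n" for n
    unfolding B_def using X(2) T0 by (intro image_eqI[of _ _ "\<lambda>z. 0"]) (auto simp: in_Hb_zero)
  have U0: "U n \<ge> 0" for n unfolding U_def by (rule cSup_upper[OF ne bdd])
  have TU: "N (T n x) \<le> U n * N x" if x: "x \<in> X" for n x
  proof (cases "N x = 0")
    case True
    then show ?thesis using cont[of n] x by fastforce
  next
    case False
    then have pos: "N x > 0" using Hb_norm_nonneg[OF X(1)[OF x]] by simp
    define y where "y = (\<lambda>z. of_real (1 / N x) * x z)"
    have "N y = 1" using pos unfolding y_def by (simp only: Hb_norm_scale[OF X(1)[OF x]] norm_of_real) simp
    moreover have "y \<in> X" unfolding y_def by (rule X(5)[OF x])
    ultimately have "N (T n y) \<le> U n" unfolding U_def B_def[symmetric]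
      by (intro cSup_upper[OF _ bdd]) (auto simp: B_def)
    moreover have "N (T n y) = N (T n x) / N x"
      using pos unfolding y_def scale[OF x] by (simp only: Hb_norm_scale[OF T[OF x]] norm_of_real) simp
    ultimately show ?thesis using pos by (simp add: field_simps)
  qed
  have "\<exists>M. \<forall>n. U n \<le> M"
  proof (rule gliding_hump[where X = X and p = "\<lambda>n x. N (T n x)"])
    show "\<exists>y\<in>X. \<forall>k. N (\<lambda>z. y z - x k z) \<le> 4/3 * (1/4) ^ k"
      if x: "\<And>k. x k \<in> X" "\<And>k. N (\<lambda>z. x (Suc k) z - x k z) \<le> (1/4) ^ k" for x
    proof -
      obtain y where "in_Hb b y" "\<And>k. N (\<lambda>z. y z - x k z) \<le> 4/3 * (1/4) ^ k"
        "(\<And>k. x k holomorphic_on ball 0 1) \<Longrightarrow> y holomorphic_on ball 0 1"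
        using Hb_complete[of x] X(1)[OF x(1)] x(2) by blast
      moreover have "\<And>k. x k holomorphic_on ball 0 1" using x(1) by (auto simp: X_def)
      ultimately show ?thesis unfolding X_def by blast
    qed
    show "N (T n y) - U n * N (\<lambda>z. x z - y z) \<le> N (T n x)" if x: "x \<in> X" and y: "y \<in> X" for n x y
    proof -
      have "N (T n y) = N (\<lambda>z. T n x z - T n (\<lambda>z. x z - y z) z)"
        unfolding diff[OF x y] by simp
      also have "\<dots> \<le> N (T n x) + N (T n (\<lambda>z. x z - y z))"
        by (intro in_Hb_diff T X x y)
      finally show ?thesis using TU[OF X(4)[OF x y], of n] by simp
    qed
    show "2 * N (T n y) \<le> N (T n (\<lambda>z. x z + y z)) + N (T n (\<lambda>z. x z - y z))" if x: "x \<in> X" and y: "y \<in> X" for n x y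
    proof -
      have "2 * N (T n y) = N (\<lambda>z. 2 * T n y z)" by (simp add: Hb_norm_scale[OF T[OF y]])
      also have "(\<lambda>z. 2 * T n y z) = (\<lambda>z. T n (\<lambda>z. x z + y z) z - T n (\<lambda>z. x z - y z) z)"
        unfolding add[OF x y] diff[OF x y] by auto
      also have "N \<dots> \<le> N (T n (\<lambda>z. x z + y z)) + N (T n (\<lambda>z. x z - y z))"
        by (intro in_Hb_diff T X x y)
      finally show ?thesis .
    qed
    show "\<exists>y\<in>X. N y \<le> \<rho> \<and> 3/4 * \<rho> * U n \<le> N (T n y)" if \<rho>: "0 < \<rho>" for n \<rho>
    proof (cases "U n = 0")
      case True
      then show ?thesis using X(2) \<rho> T0 by (intro bexI[of _ "\<lambda>z. 0"]) (auto simp: in_Hb_zero)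
    next
      case False
      \<comment> \<open>The operator norm is a supremum that may not be attained; here the factor
        \<open>3/4\<close> is spent.\<close>
      then have "3/4 * U n < Sup (B n)" using U0[of n] by (simp add: U_def)
      then obtain h where h: "h \<in> X" "N h \<le> 1" "3/4 * U n < N (T n h)"
        using less_cSupD[OF ex_in_conv[THEN iffD1, OF exI, OF ne], of "3/4 * U n" n] unfolding B_def by blast
      show ?thesis
      proof (intro bexI[of _ "\<lambda>z. of_real \<rho> * h z"] conjI)
        show "(\<lambda>z. of_real \<rho> * h z) \<in> X" by (rule X(5)[OF h(1)])
        show "N (\<lambda>z. of_real \<rho> * h z) \<le> \<rho>"
          using h(2) \<rho> by (simp add: Hb_norm_scale[OF X(1)[OF h(1)]] mult_left_le)
        show "3/4 * \<rho> * U n \<le> N (T n (\<lambda>z. of_real \<rho> * h z))"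
          using mult_left_mono[OF less_imp_le[OF h(3)], of \<rho>] \<rho>
          unfolding scale[OF h(1)] by (simp add: Hb_norm_scale[OF T[OF h(1)]])
      qed
    qed
  qed (use X pointwise in auto)
  then obtain M where "\<And>n. U n \<le> M" by blast
  then have "N (T n x) \<le> M * N x" if "x \<in> X" for n x
    using TU[OF that, of n] Hb_norm_nonneg[OF X(1)[OF that]] by (meson mult_right_mono order_trans)
  then show ?thesis by blast
qed

end

section \<open>A lower bound for the norm of monomials\<close>

text \<open>The trapezoidal rule with \<open>n\<close> equispaced nodes for Cauchy's integral of the
  \<open>j\<close>-th coefficient over \<open>|z| = 1/2\<close>. A Taylor coefficient is not itself
  a point combination, only a limit of these. The exponent \<open>k * (n - j)\<close> stands for
  \<open>- k * j\<close> modulo \<open>n\<close> when \<open>j \<le> n\<close>.\<close>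

definition dft_coeff :: "nat \<Rightarrow> nat \<Rightarrow> (complex \<Rightarrow> complex) \<Rightarrow> complex" where
  "dft_coeff n j f = (\<Sum>k<n. 2 ^ j / of_nat n * cis (2 * pi / n) ^ (k * (n - j)) * f (cis (2 * pi / n) ^ k / 2))"

lemma dft_coeff_point_combination: "dft_coeff n j \<in> point_combinations"
proof -
  have "(\<lambda>f. \<Sum>k<n. 2 ^ j / of_nat n * cis (2 * pi / n) ^ (k * (n - j)) * f (cis (2 * pi / n) ^ k / 2)) \<in> point_combinations"
    by (rule point_combinationsI) (simp add: norm_divide norm_power)
  then show ?thesis by (simp add: dft_coeff_def[abs_def])
qed

text \<open>Independent of \<open>n\<close>, hence a majorant for Tannery's theorem.\<close>

lemma dft_coeff_monomial_bound: "cmod (dft_coeff n j (\<lambda>z. z ^ m)) \<le> 2 ^ j * (1/2) ^ m"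
proof -
  have "cmod (dft_coeff n j (\<lambda>z. z ^ m)) \<le> (\<Sum>k<n. 2 ^ j / real n * (1/2) ^ m)"
    unfolding dft_coeff_def
    by (rule sum_norm_le) (simp add: norm_mult norm_divide norm_power power_divide)
  also have "\<dots> \<le> 2 ^ j * (1/2) ^ m" by (cases "n = 0") auto
  finally show ?thesis .
qed

text \<open>Summation over roots of unity filters the exponents congruent to \<open>j\<close> modulo
  \<open>n\<close>; below \<open>n\<close> there is only \<open>j\<close> itself.\<close>

lemma dft_coeff_monomial:
  assumes "m < n" "j < n"
  shows "dft_coeff n j (\<lambda>z. z ^ m) = (if m = j then 1 else 0)"
proof -
  define w where "w = cis (2 * pi / n)"
  define M where "M = n - j + m"
  have w: "w = exp (2 * of_real pi * \<i> * of_nat 1 / of_nat n)"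
    by (simp add: w_def cis_conv_exp mult_ac)
  have wM: "w ^ i = exp (2 * of_real pi * \<i> * of_nat i / of_nat n)" for i
    unfolding w by (simp flip: exp_of_nat_mult add: mult_ac)
  have "dft_coeff n j (\<lambda>z. z ^ m) = (\<Sum>k<n. 2 ^ j / of_nat n * (1/2) ^ m * (w ^ M) ^ k)"
    unfolding dft_coeff_def w_def[symmetric] M_def
    by (intro sum.cong refl) (simp add: power_divide power_add power_mult_distrib mult_ac flip: power_mult)
  also have "\<dots> = 2 ^ j / of_nat n * (1/2) ^ m * (\<Sum>k<n. (w ^ M) ^ k)"
    by (simp add: sum_distrib_left)
  also have "\<dots> = (if m = j then 1 else 0)"
  proof (cases "m = j")
    case True
    then have "w ^ M = 1" using assms complex_root_unity_eq_1[of n n] by (simp add: M_def wM)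
    then show ?thesis using assms True by (simp add: power_divide)
  next
    case False
    have "\<not> n dvd M"
    proof
      assume "n dvd M"
      then obtain c where c: "M = n * c" by blast
      have M: "0 < M" "M < n * 2" "M \<noteq> n" using assms False by (auto simp: M_def)
      then have "0 < c" "c < 2" using c by simp_all
      then show False using c M(3) by (simp add: numeral_2_eq_2 less_Suc_eq)
    qed
    then have "w ^ M \<noteq> 1" using assms complex_root_unity_eq_1[of n M] by (simp add: wM)
    moreover have "(w ^ M) ^ n = 1"
    proof -
      have "w ^ n = 1" using assms complex_root_unity_eq_1[of n n] by (simp add: wM)
      then show ?thesis by (metis mult.commute power_mult power_one)
    qed
    ultimately show ?thesis using False by (simp add: sum_gp_strict)
  qed
  finally show ?thesis .
qed

text \<open>The defining inequality for the functional
  \<open>\<Sum>j\<le>d. x j * dft_coeff n j\<close>, in the limit of large \<open>n\<close>. The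
  coefficients of \<open>b z^m\<close> are those of \<open>b\<close> shifted by \<open>m\<close>,
  which explains \<open>\<beta> (j - m)\<close>. Terms with \<open>m > d\<close> are dropped before
  the limit, which only weakens the bound; they would vanish in the limit, since
  \<open>b z^m\<close> then has no coefficient up to \<open>d\<close>.\<close>

lemma coefficient_inequality:
  assumes b: "Hinf_ball b" and \<beta>: "pser b \<beta>" and F: "pser F f" and D: "0 \<le> D"
    and le: "\<And>l. l \<in> point_combinations \<Longrightarrow> (cmod (l F))\<^sup>2 \<le> D * defect_form b l"
  shows "(cmod (\<Sum>j\<le>d. f j * x j))\<^sup>2 \<le>
     D * ((\<Sum>j\<le>d. (cmod (x j))\<^sup>2) - (\<Sum>m\<le>d. (cmod (\<Sum>j\<le>d. (if j < m then 0 else \<beta> (j - m)) * x j))\<^sup>2))"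
proof -
  define l where "l n = (\<lambda>g. \<Sum>j\<le>d. x j * dft_coeff n j g)" for n
  have l: "l n \<in> point_combinations" for n
    unfolding l_def
    by (rule point_combinations_sum) (auto intro: point_combinations_scale dft_coeff_point_combination)
  define C where "C = (\<Sum>j\<le>d. cmod (x j) * 2 ^ j)"
  have bd: "cmod (l n (\<lambda>z. z ^ m)) \<le> C * (1/2) ^ m" for n m
    unfolding l_def C_def sum_distrib_right
    by (rule sum_norm_le) (auto simp: norm_mult mult.assoc intro!: mult_left_mono dft_coeff_monomial_bound)
  define X where "X m = (if m \<le> d then x m else 0)" for m
  have lim: "(\<lambda>n. l n (\<lambda>z. z ^ m)) \<longlonglongrightarrow> X m" for m
  proof (rule tendsto_eventually, rule eventually_sequentiallyI[of "Suc (max m d)"])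
    fix n assume "Suc (max m d) \<le> n"
    then have "l n (\<lambda>z. z ^ m) = (\<Sum>j\<le>d. x j * (if m = j then 1 else 0))"
      unfolding l_def by (intro sum.cong refl arg_cong2[where f = "(*)"] dft_coeff_monomial) auto
    then show "l n (\<lambda>z. z ^ m) = X m" by (simp add: X_def sum.delta if_distrib cong: if_cong)
  qed
  have limF: "(\<lambda>n. l n G) \<longlonglongrightarrow> (\<Sum>j\<le>d. g j * x j)" if G: "pser G g" for G g
  proof -
    have "(\<lambda>n. \<Sum>j. g j * l n (\<lambda>z. z ^ j)) \<longlonglongrightarrow> (\<Sum>j. g j * X j)"
    proof (rule tannerys_theorem[THEN conjunct2, THEN conjunct2])
      show "\<forall>\<^sub>F (k, n) in at_top \<times>\<^sub>F sequentially. norm (g k * l n (\<lambda>z. z ^ k)) \<le> C * (cmod (g k) * (1/2) ^ k)"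
        by (intro always_eventually) (auto simp: norm_mult mult.left_commute[of C] intro!: mult_left_mono bd)
      show "summable (\<lambda>k. C * (cmod (g k) * (1/2) ^ k))"
        by (intro summable_mult pser_summable_norm[OF G]) auto
      show "(\<lambda>n. g k * l n (\<lambda>z. z ^ k)) \<longlonglongrightarrow> g k * X k" for k
        by (intro tendsto_intros lim)
    qed simp
    moreover have "(\<Sum>j. g j * l n (\<lambda>z. z ^ j)) = l n G" for n
      using point_combination_pser[OF l G] by (simp add: sums_iff)
    moreover have "(\<Sum>j. g j * X j) = (\<Sum>j\<le>d. g j * x j)"
      by (subst suminf_finite[of "{..d}"]) (auto simp: X_def)
    ultimately show ?thesis by simp
  qed
  have limX: "(\<lambda>n. \<Sum>m. (cmod (l n (\<lambda>z. z ^ m)))\<^sup>2) \<longlonglongrightarrow> (\<Sum>j\<le>d. (cmod (x j))\<^sup>2)"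
  proof -
    have "(\<lambda>n. \<Sum>m. (cmod (l n (\<lambda>z. z ^ m)))\<^sup>2) \<longlonglongrightarrow> (\<Sum>m. (cmod (X m))\<^sup>2)"
    proof (rule tannerys_theorem[THEN conjunct2, THEN conjunct2])
      show "\<forall>\<^sub>F (k, n) in at_top \<times>\<^sub>F sequentially. norm ((cmod (l n (\<lambda>z. z ^ k)))\<^sup>2) \<le> C\<^sup>2 * (1/4) ^ k"
      proof (rule always_eventually, clarify)
        fix k n
        have "(cmod (l n (\<lambda>z. z ^ k)))\<^sup>2 \<le> (C * (1/2) ^ k)\<^sup>2" by (intro power_mono bd) simp
        also have "\<dots> = C\<^sup>2 * ((1/2)\<^sup>2) ^ k"
          by (simp add: power_mult_distrib mult.commute flip: power_mult)
        finally show "norm ((cmod (l n (\<lambda>z. z ^ k)))\<^sup>2) \<le> C\<^sup>2 * (1/4) ^ k" by (simp add: power2_eq_square)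
      qed
      show "summable (\<lambda>k. C\<^sup>2 * (1/4) ^ k)" by (intro summable_mult summable_geometric) simp
      show "(\<lambda>n. (cmod (l n (\<lambda>z. z ^ k)))\<^sup>2) \<longlonglongrightarrow> (cmod (X k))\<^sup>2" for k
        by (intro tendsto_intros lim)
    qed simp
    moreover have "(\<Sum>m. (cmod (X m))\<^sup>2) = (\<Sum>j\<le>d. (cmod (x j))\<^sup>2)"
      by (subst suminf_finite[of "{..d}"]) (auto simp: X_def)
    ultimately show ?thesis by simp
  qed
  have shift: "pser (\<lambda>z. b z * z ^ m) (\<lambda>j. if j < m then 0 else \<beta> (j - m))" for m
    unfolding pser_def
  proof
    fix z :: complex assume "z \<in> ball 0 1"
    then have "(\<lambda>j. \<beta> j * z ^ j * z ^ m) sums (b z * z ^ m)"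
      by (intro sums_mult2 pser_sums[OF \<beta>]) simp
    then have "(\<lambda>j. (if j + m < m then 0 else \<beta> (j + m - m)) * z ^ (j + m)) sums (b z * z ^ m)"
      by (simp add: power_add mult.assoc)
    from sums_zero_iff_shift[THEN iffD1, OF _ this]
    show "(\<lambda>j. (if j < m then 0 else \<beta> (j - m)) * z ^ j) sums (b z * z ^ m)" by simp
  qed
  have b1: "cmod (b z) \<le> 1" if "z \<in> ball 0 1" for z using b that by (simp add: Hinf_ball_def)
  have le': "(cmod (l n F))\<^sup>2 \<le> D * ((\<Sum>m. (cmod (l n (\<lambda>z. z ^ m)))\<^sup>2) - (\<Sum>m\<le>d. (cmod (l n (\<lambda>z. b z * z ^ m)))\<^sup>2))" for n
  proof -
    have "(\<Sum>m\<le>d. (cmod (l n (\<lambda>z. b z * z ^ m)))\<^sup>2) \<le> (\<Sum>m. (cmod (l n (\<lambda>z. b z * z ^ m)))\<^sup>2)"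
      by (intro sum_le_suminf moments_square_summable l b1) auto
    then show ?thesis
      using order_trans[OF le[OF l, of n] mult_left_mono[OF _ D]] unfolding defect_form_eq[OF b l] by simp
  qed
  show ?thesis
  proof (rule LIMSEQ_le)
    show "(\<lambda>n. (cmod (l n F))\<^sup>2) \<longlonglongrightarrow> (cmod (\<Sum>j\<le>d. f j * x j))\<^sup>2"
      by (intro tendsto_intros limF F)
    show "(\<lambda>n. D * ((\<Sum>m. (cmod (l n (\<lambda>z. z ^ m)))\<^sup>2) - (\<Sum>m\<le>d. (cmod (l n (\<lambda>z. b z * z ^ m)))\<^sup>2)))
      \<longlonglongrightarrow> D * ((\<Sum>j\<le>d. (cmod (x j))\<^sup>2) - (\<Sum>m\<le>d. (cmod (\<Sum>j\<le>d. (if j < m then 0 else \<beta> (j - m)) * x j))\<^sup>2))"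
      by (intro tendsto_intros limX limF shift)
  qed (use le' in blast)
qed

text \<open>In operator terms the test vector is \<open>b p\<close>, and its defect is
  \<open>\<parallel>b p\<parallel>^2 - \<parallel>T(cnj b) (b p)\<parallel>^2\<close>. Since
  \<open>\<parallel>b p\<parallel>^2\<close> is the inner product of \<open>p\<close> with
  \<open>T(cnj b) (b p)\<close>, Cauchy-Schwarz bounds the defect by
  \<open>\<parallel>p\<parallel>^2 - \<parallel>b p\<parallel>^2\<close>. The argument runs on
  sections up to degree \<open>d\<close>.\<close>

lemma monomial_coefficient_bound:
  assumes b: "Hinf_ball b" and \<beta>: "pser b \<beta>" and D: "0 \<le> D"
    and le: "\<And>l. l \<in> point_combinations \<Longrightarrow> (cmod (l (\<lambda>z. \<kappa> * z ^ n)))\<^sup>2 \<le> D * defect_form b l"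
    and p: "pser p P" and pB: "\<And>z. z \<in> ball 0 1 \<Longrightarrow> cmod (p z) \<le> B"
  defines "R \<equiv> \<lambda>n. \<Sum>i\<le>n. \<beta> i * P (n - i)"
  shows "(cmod (\<kappa> * R n))\<^sup>2 \<le> D * ((\<Sum>j. (cmod (P j))\<^sup>2) - (\<Sum>j. (cmod (R j))\<^sup>2))"
proof -
  define W where "W = (\<Sum>j. (cmod (P j))\<^sup>2)"
  note PS = bounded_coeff_square_summable(1)[OF p pB]
  have Rp: "pser (\<lambda>z. b z * p z) R" unfolding R_def by (rule pser_mult[OF \<beta> p])
  have RB: "cmod (b z * p z) \<le> B" if "z \<in> ball 0 1" for z
    using mult_mono[of "cmod (b z)" 1 "cmod (p z)" B] pB[OF that] b that by (simp add: norm_mult Hinf_ball_def)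
  note RS = bounded_coeff_square_summable(1)[OF Rp RB]
  have kp: "pser (\<lambda>z. \<kappa> * z ^ n) (\<lambda>j. if j = n then \<kappa> else 0)"
  proof -
    have "(\<lambda>j. (if j = n then \<kappa> else 0) * z ^ j) sums (\<kappa> * z ^ n)" for z
      using sums_single[of n "\<lambda>j. \<kappa> * z ^ j"] by (rule sums_cong[THEN iffD1, rotated]) auto
    then show ?thesis by (simp add: pser_def)
  qed
  have main: "(cmod (\<kappa> * R n))\<^sup>2 \<le> D * (W - (\<Sum>j\<le>d. (cmod (R j))\<^sup>2))" if d: "n \<le> d" for d
  proof -
    define S where "S = (\<Sum>j\<le>d. (cmod (R j))\<^sup>2)"
    \<comment> \<open>The conjugated coefficients of \<open>T(cnj b)\<close> applied to the section
      of \<open>b p\<close>.\<close>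
    define y where "y m = (\<Sum>j\<le>d. (if j < m then 0 else \<beta> (j - m)) * cnj (R j))" for m
    define Y where "Y = (\<Sum>m\<le>d. (cmod (y m))\<^sup>2)"
    have "(cmod (\<Sum>j\<le>d. (if j = n then \<kappa> else 0) * cnj (R j)))\<^sup>2 \<le> D * ((\<Sum>j\<le>d. (cmod (cnj (R j)))\<^sup>2) - Y)"
      unfolding Y_def y_def by (rule coefficient_inequality[OF b \<beta> kp D le])
    moreover have "(\<Sum>j\<le>d. (if j = n then \<kappa> else 0) * cnj (R j)) = \<kappa> * cnj (R n)"
      using d by (simp add: if_distrib[of "\<lambda>c. c * _"] cong: if_cong)
    ultimately have 1: "(cmod (\<kappa> * R n))\<^sup>2 \<le> D * (S - Y)" by (simp add: norm_mult S_def)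
    have "(\<Sum>m\<le>d. P m * y m) = (\<Sum>m\<le>d. \<Sum>j\<le>d. P m * ((if j < m then 0 else \<beta> (j - m)) * cnj (R j)))"
      by (simp add: y_def sum_distrib_left)
    also have "\<dots> = (\<Sum>j\<le>d. \<Sum>m\<le>d. P m * ((if j < m then 0 else \<beta> (j - m)) * cnj (R j)))"
      by (rule sum.swap)
    also have "\<dots> = (\<Sum>j\<le>d. R j * cnj (R j))"
    proof (intro sum.cong refl)
      fix j assume j: "j \<in> {..d}"
      have "(\<Sum>m\<le>d. P m * ((if j < m then 0 else \<beta> (j - m)) * cnj (R j))) =
          (\<Sum>m\<le>j. P m * ((if j < m then 0 else \<beta> (j - m)) * cnj (R j)))"
        by (rule sum.mono_neutral_right) (use j in auto)
      also have "\<dots> = (\<Sum>m\<le>j. P m * \<beta> (j - m)) * cnj (R j)"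
        by (simp add: sum_distrib_right mult.assoc)
      also have "(\<Sum>m\<le>j. P m * \<beta> (j - m)) = R j"
        unfolding R_def by (subst sum.nat_diff_reindex[symmetric, of _ "Suc j", simplified lessThan_Suc_atMost]) (auto simp: mult.commute intro!: sum.cong)
      finally show "(\<Sum>m\<le>d. P m * ((if j < m then 0 else \<beta> (j - m)) * cnj (R j))) = R j * cnj (R j)" .
    qed
    also have "\<dots> = of_real S" unfolding S_def of_real_sum complex_norm_square ..
    finally have "S\<^sup>2 = (cmod (\<Sum>m\<le>d. P m * y m))\<^sup>2" by simp
    also have "\<dots> \<le> (\<Sum>m\<le>d. cmod (P m) * cmod (y m))\<^sup>2"
      by (intro power_mono sum_norm_le) (auto simp: norm_mult)
    also have "\<dots> \<le> (\<Sum>m\<le>d. (cmod (P m))\<^sup>2) * Y"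
      unfolding Y_def by (rule Cauchy_Schwarz_ineq_sum)
    also have "\<dots> \<le> W * Y"
      unfolding W_def by (intro mult_right_mono sum_le_suminf PS) (auto simp: Y_def intro: sum_nonneg)
    finally have 2: "S\<^sup>2 \<le> W * Y" .
    have W0: "W \<ge> 0" unfolding W_def by (intro suminf_nonneg PS) auto
    have Y0: "Y \<ge> 0" by (auto simp: Y_def intro: sum_nonneg)
    \<comment> \<open>Combine \<open>S^2 \<le> W * Y\<close> with
      \<open>2 * W * S \<le> W^2 + S^2\<close> and divide by \<open>W\<close>.\<close>
    have "S - Y \<le> W - S"
    proof (cases "W = 0")
      case True
      then show ?thesis using 2 Y0 by simp
    next
      case False
      have "0 \<le> (W - S)\<^sup>2" by simp
      then have "W * (2 * S) \<le> W * (W + Y)" using 2 by (simp add: power2_eq_square algebra_simps)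
      then show ?thesis using False W0 by simp
    qed
    then show ?thesis using 1 mult_left_mono[OF _ D] unfolding S_def by (meson order_trans)
  qed
  have "(\<lambda>d. D * (W - (\<Sum>j\<le>d. (cmod (R j))\<^sup>2))) \<longlonglongrightarrow> D * (W - (\<Sum>j. (cmod (R j))\<^sup>2))"
    by (intro tendsto_intros summable_LIMSEQ' RS)
  then show ?thesis
    unfolding W_def[symmetric] by (rule LIMSEQ_le_const) (use main in blast)
qed

text \<open>Test with \<open>p = g k * q\<close>. Then \<open>b p = \<phi> (a * g k) q\<close>,
  whose \<open>n\<close>-th coefficient tends to \<open>S\<close>, while at the boundary
  \<open>|p|^2 - |b p|^2 = |a p|^2 \<le> |q|^2\<close>, and \<open>q\<close> has squared norm
  \<open>S\<close>. The outcome is \<open>|\<kappa>|^2 * S^2 \<le> D * S\<close>.\<close>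

lemma monomial_norm_lower_bound:
  assumes b: "Hinf_ball b" and a: "\<And>z. z \<in> ball 0 1 \<Longrightarrow> a z \<noteq> 0"
    and g: "\<And>k. g k holomorphic_on ball 0 1" "\<And>k z. z \<in> ball 0 1 \<Longrightarrow> cmod (g k z) \<le> G k"
      "\<And>k z. z \<in> ball 0 1 \<Longrightarrow> cmod (a z * g k z) \<le> 1" "(\<lambda>k::nat. a 0 * g k 0) \<longlonglongrightarrow> 1"
    and ahol: "a holomorphic_on ball 0 1"
    and ae: "AE t in lebesgue_on {0..2*pi}.
        ((\<lambda>r. (cmod (b (of_real r * cis t)))\<^sup>2 + (cmod (a (of_real r * cis t)))\<^sup>2) \<longlongrightarrow> 1) (at_left 1)"
    and \<phi>: "pser (\<lambda>z. b z / a z) \<phi>" and D: "0 \<le> D"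
    and le: "\<And>l. l \<in> point_combinations \<Longrightarrow> (cmod (l (\<lambda>z. \<kappa> * z ^ n)))\<^sup>2 \<le> D * defect_form b l"
  shows "(cmod \<kappa>)\<^sup>2 * (\<Sum>i\<le>n. (cmod (\<phi> i))\<^sup>2) \<le> D"
proof -
  define q where "q z = (\<Sum>j<Suc n. cnj (\<phi> (n - j)) * z ^ j)" for z
  define qc where "qc j = (if j < Suc n then cnj (\<phi> (n - j)) else 0)" for j
  have q: "pser q qc" unfolding q_def qc_def by (rule pser_polynomial)
  define K where "K = (\<Sum>j<Suc n. cmod (\<phi> (n - j)))"
  have K: "cmod (q z) \<le> K" if "z \<in> ball 0 1" for z
    unfolding q_def K_def using that
    by (intro sum_norm_le) (auto simp: norm_mult norm_power mult_left_le power_le_one)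
  have K0: "K \<ge> 0" unfolding K_def by (rule sum_nonneg) simp
  define S where "S = (\<Sum>i\<le>n. (cmod (\<phi> i))\<^sup>2)"
  have qS: "(\<Sum>j. (cmod (qc j))\<^sup>2) = S"
  proof -
    have "(\<Sum>j. (cmod (qc j))\<^sup>2) = (\<Sum>j<Suc n. (cmod (\<phi> (n - j)))\<^sup>2)"
      by (subst suminf_finite[of "{..<Suc n}"]) (auto simp: qc_def)
    also have "\<dots> = S" unfolding S_def using sum.nat_diff_reindex[of "\<lambda>i. (cmod (\<phi> i))\<^sup>2" "Suc n"]
      by (simp only: lessThan_Suc_atMost diff_Suc_Suc)
    finally show ?thesis .
  qed
  note \<beta> = pser_taylor[OF b[unfolded Hinf_ball_def, THEN conjunct1]]
  define c where "c k = taylor_coeff (\<lambda>z. a z * g k z)" for k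
  have c: "pser (\<lambda>z. a z * g k z) (c k)" for k
    unfolding c_def by (intro pser_taylor holomorphic_intros ahol g)
  have c0: "(\<lambda>k. c k 0) \<longlonglongrightarrow> 1"
  proof -
    have "c k 0 = a 0 * g k 0" for k by (simp add: c_def taylor_coeff_def)
    then show ?thesis using g(4) by simp
  qed
  \<comment> \<open>By Parseval the squared coefficients of \<open>a * g k\<close> sum to at most 1,
    and in the limit the constant coefficient uses up all of this.\<close>
  have cj: "(\<lambda>k. c k j) \<longlonglongrightarrow> 0" if "j > 0" for j
  proof -
    have le: "(cmod (c k j))\<^sup>2 \<le> 1 - (cmod (c k 0))\<^sup>2" for k
    proof -
      have "(\<Sum>i\<in>{0,j}. (cmod (c k i))\<^sup>2) \<le> (\<Sum>i. (cmod (c k i))\<^sup>2)"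
        by (intro sum_le_suminf bounded_coeff_square_summable(1)[OF c g(3)]) auto
      also have "\<dots> \<le> 1\<^sup>2" by (rule bounded_coeff_square_summable(2)[OF c g(3)])
      finally show ?thesis using that by simp
    qed
    have "(\<lambda>k. 1 - (cmod (c k 0))\<^sup>2) \<longlonglongrightarrow> 1 - (cmod 1)\<^sup>2"
      by (intro tendsto_intros c0)
    then have "(\<lambda>k. 1 - (cmod (c k 0))\<^sup>2) \<longlonglongrightarrow> 0" by simp
    then have "(\<lambda>k. (cmod (c k j))\<^sup>2) \<longlonglongrightarrow> 0"
      by (rule tendsto_sandwich[OF always_eventually always_eventually tendsto_const, rotated 2]) (use le in auto)
    then have "(\<lambda>k. sqrt ((cmod (c k j))\<^sup>2)) \<longlonglongrightarrow> sqrt 0" by (rule tendsto_real_sqrt)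
    then have "(\<lambda>k. cmod (c k j)) \<longlonglongrightarrow> 0" by simp
    then show ?thesis by (rule tendsto_norm_zero_cancel)
  qed
  define r where "r k m = (\<Sum>i\<le>m. c k i * qc (m - i))" for k m
  have r: "pser (\<lambda>z. a z * g k z * q z) (r k)" for k
    unfolding r_def by (rule pser_mult[OF c q])
  have rlim: "(\<lambda>k. r k m) \<longlonglongrightarrow> qc m" for m
  proof -
    have "(\<lambda>k. r k m) \<longlonglongrightarrow> (\<Sum>i\<le>m. (if i = 0 then 1 else 0) * qc (m - i))"
      unfolding r_def by (intro tendsto_intros) (auto intro: c0 cj)
    also have "(\<Sum>i\<le>m. (if i = 0 then 1 else 0) * qc (m - i)) = qc m"
      by (simp add: if_distrib[of "\<lambda>c. c * _"] sum.delta cong: if_cong)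
    finally show ?thesis .
  qed
  define R where "R k m = (\<Sum>i\<le>m. \<phi> i * r k (m - i))" for k m
  have bound: "(cmod (\<kappa> * R k n))\<^sup>2 \<le> D * S" for k
  proof -
    define p where "p z = g k z * q z" for z
    have phol: "p holomorphic_on ball 0 1"
      unfolding p_def by (intro holomorphic_intros g pser_holomorphic[OF q])
    note p = pser_taylor[OF phol]
    have G0: "G k \<ge> 0" using order_trans[OF norm_ge_zero g(2)[of 0 k]] by simp
    \<comment> \<open>The factor \<open>max 1\<close> makes \<open>B\<close> a common bound for
      \<open>p\<close>, \<open>b p\<close> and \<open>q\<close>.\<close>
    define B where "B = max 1 (G k) * K"
    have BK: "K \<le> B" using mult_right_mono[of 1 "max 1 (G k)" K] K0 by (simp add: B_def)
    have pB: "cmod (p z) \<le> B" if "z \<in> ball 0 1" for z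
      unfolding p_def norm_mult B_def using g(2)[OF that, of k] K[OF that] G0 K0
      by (intro mult_mono) auto
    have qB: "cmod (q z) \<le> B" if "z \<in> ball 0 1" for z using K[OF that] BK by simp
    have bpB: "cmod (b z * p z) \<le> B" if "z \<in> ball 0 1" for z
      using mult_mono[of "cmod (b z)" 1 "cmod (p z)" B] pB[OF that] b that by (simp add: norm_mult Hinf_ball_def)
    define R' where "R' = (\<lambda>m. \<Sum>i\<le>m. taylor_coeff b i * taylor_coeff p (m - i))"
    have bp: "pser (\<lambda>z. b z * p z) R'" unfolding R'_def by (rule pser_mult[OF \<beta> p])
    \<comment> \<open>Cancelling \<open>a\<close> gives \<open>b p\<close> again, so by uniqueness
      its coefficients are those of \<open>\<phi>\<close> convolved with \<open>r k\<close>, whose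
      limit is known.\<close>
    have "pser (\<lambda>z. (b z / a z) * (a z * g k z * q z)) (R k)"
      unfolding R_def by (rule pser_mult[OF \<phi> r])
    then have "pser (\<lambda>z. b z * p z) (R k)"
      by (rule pser_cong) (use a in \<open>auto simp: p_def\<close>)
    from taylor_coeff_pser[OF this] taylor_coeff_pser[OF bp] have RR: "R k = R'" by simp
    have 1: "(cmod (\<kappa> * R k n))\<^sup>2 \<le> D * ((\<Sum>j. (cmod (taylor_coeff p j))\<^sup>2) - (\<Sum>j. (cmod (R k j))\<^sup>2))"
      unfolding RR R'_def by (rule monomial_coefficient_bound[OF b \<beta> D le p pB])
    have "(\<Sum>j. (cmod (taylor_coeff p j))\<^sup>2) \<le> (\<Sum>j. (cmod (R' j))\<^sup>2) + (\<Sum>j. (cmod (qc j))\<^sup>2)"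
    proof (rule coeff_square_sum_le[OF p bp q pB bpB qB])
      show "AE t in lebesgue_on {0..2*pi}. \<exists>e. (e \<longlongrightarrow> 0) (at_left 1) \<and>
        (\<forall>r\<in>{0..<1}. (cmod (p (of_real r * cis t)))\<^sup>2 \<le>
            (cmod (b (of_real r * cis t) * p (of_real r * cis t)))\<^sup>2 + (cmod (q (of_real r * cis t)))\<^sup>2 + e r)"
        using ae
      proof eventually_elim
        fix t
        define E where "E r = (cmod (b (of_real r * cis t)))\<^sup>2 + (cmod (a (of_real r * cis t)))\<^sup>2" for r
        assume "((\<lambda>r. (cmod (b (of_real r * cis t)))\<^sup>2 + (cmod (a (of_real r * cis t)))\<^sup>2) \<longlongrightarrow> 1) (at_left 1)"
        then have E: "(E \<longlongrightarrow> 1) (at_left 1)" by (simp add: E_def[abs_def])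
        show "\<exists>e. (e \<longlongrightarrow> 0) (at_left 1) \<and>
        (\<forall>r\<in>{0..<1}. (cmod (p (of_real r * cis t)))\<^sup>2 \<le>
            (cmod (b (of_real r * cis t) * p (of_real r * cis t)))\<^sup>2 + (cmod (q (of_real r * cis t)))\<^sup>2 + e r)"
        proof (intro exI[of _ "\<lambda>r. \<bar>1 - E r\<bar> * B\<^sup>2"] conjI ballI)
          have "((\<lambda>r. \<bar>1 - E r\<bar> * B\<^sup>2) \<longlongrightarrow> \<bar>1 - 1\<bar> * B\<^sup>2) (at_left 1)"
            by (intro tendsto_intros E)
          then show "((\<lambda>r. \<bar>1 - E r\<bar> * B\<^sup>2) \<longlongrightarrow> 0) (at_left 1)" by simp
          fix r :: real assume "r \<in> {0..<1}"
          define z where "z = of_real r * cis t"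
          have z: "z \<in> ball 0 1" using \<open>r \<in> {0..<1}\<close> by (simp add: z_def norm_mult)
          have e: "a z * p z = (a z * g k z) * q z" by (simp add: p_def)
          have "cmod (a z * p z) \<le> cmod (q z)"
            unfolding e norm_mult[of _ "q z"]
            using mult_right_mono[OF g(3)[OF z, of k] norm_ge_zero[of "q z"]] by simp
          then have "(cmod (a z * p z))\<^sup>2 \<le> (cmod (q z))\<^sup>2" by (intro power_mono) auto
          moreover have "E r = (cmod (b z))\<^sup>2 + (cmod (a z))\<^sup>2" by (simp add: E_def z_def)
          then have "(cmod (p z))\<^sup>2 = (cmod (b z * p z))\<^sup>2 + (cmod (a z * p z))\<^sup>2 + (1 - E r) * (cmod (p z))\<^sup>2"
            by (simp add: norm_mult power_mult_distrib algebra_simps)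
          moreover have "(1 - E r) * (cmod (p z))\<^sup>2 \<le> \<bar>1 - E r\<bar> * B\<^sup>2"
            using pB[OF z] by (intro mult_mono power_mono) auto
          ultimately show "(cmod (p (of_real r * cis t)))\<^sup>2 \<le>
            (cmod (b (of_real r * cis t) * p (of_real r * cis t)))\<^sup>2 + (cmod (q (of_real r * cis t)))\<^sup>2 + \<bar>1 - E r\<bar> * B\<^sup>2"
            unfolding z_def[symmetric] by linarith
        qed
      qed
    qed
    then have "(\<Sum>j. (cmod (taylor_coeff p j))\<^sup>2) - (\<Sum>j. (cmod (R k j))\<^sup>2) \<le> S"
      by (simp add: RR qS)
    from order_trans[OF 1 mult_left_mono[OF this D]] show ?thesis .
  qed
  have "(\<lambda>k. R k n) \<longlonglongrightarrow> (\<Sum>i\<le>n. \<phi> i * qc (n - i))"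
    unfolding R_def by (intro tendsto_intros rlim)
  also have "(\<Sum>i\<le>n. \<phi> i * qc (n - i)) = of_real S"
    unfolding S_def of_real_sum complex_norm_square by (intro sum.cong) (auto simp: qc_def)
  finally have "(\<lambda>k. (cmod (\<kappa> * R k n))\<^sup>2) \<longlonglongrightarrow> (cmod (\<kappa> * of_real S))\<^sup>2" by (intro tendsto_intros)
  then have "(cmod (\<kappa> * of_real S))\<^sup>2 \<le> D * S"
    by (rule LIMSEQ_le_const2) (use bound in auto)
  then have "S * ((cmod \<kappa>)\<^sup>2 * S) \<le> S * D"
    by (simp add: norm_mult power_mult_distrib power2_eq_square mult_ac)
  moreover have "S \<ge> 0" by (auto simp: S_def intro: sum_nonneg)
  ultimately have "(cmod \<kappa>)\<^sup>2 * S \<le> D" using D by (cases "S = 0") auto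
  then show ?thesis by (simp add: S_def)
qed

section \<open>Cesaro means and the growth of \<open>\<phi>\<close>\<close>

text \<open>The coefficient is thus the product of the factors \<open>1 + \<alpha> / k\<close> for
  \<open>k\<close> from 1 to \<open>n\<close>, the form used for comparing growth.\<close>

lemma gchoose_diagonal_Suc:
  "((real (Suc n) + \<alpha>) gchoose Suc n) = (1 + \<alpha> / Suc n) * ((real n + \<alpha>) gchoose n)"
proof -
  have "(real (Suc n) + \<alpha>) / real (Suc n) = 1 + \<alpha> / Suc n"
    by (simp add: add_divide_distrib del: of_nat_Suc)
  moreover have "real (Suc n) + \<alpha> - 1 = real n + \<alpha>" by simp
  ultimately show ?thesis using gbinomial_absorption'[of "Suc n" "real (Suc n) + \<alpha>"] by simp
qed

lemma gchoose_diagonal_pos: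
  assumes "\<alpha> \<ge> 0"
  shows "((real n + \<alpha>) gchoose n) > 0"
proof (induction n)
  case (Suc n)
  then show ?case unfolding gchoose_diagonal_Suc using assms by (intro mult_pos_pos add_pos_nonneg) auto
qed simp

text \<open>With \<open>x = \<alpha> / k\<close> each factor satisfies
  \<open>(1 + x)^2 \<le> (1 + x^2) (1 + 2 x)\<close>, and the product of the \<open>1 + x^2\<close>
  stays below the exponential of \<open>\<alpha>^2\<close> times the sum of inverse squares.
  Comparing with the coefficient for \<open>2 \<alpha>\<close>, not with a power of
  \<open>n\<close>, leaves a series that can be summed in closed form.\<close>

lemma gchoose_diagonal_square_le:
  assumes "\<alpha> \<ge> 0"
  obtains C where "C > 0" "\<And>n. ((real n + \<alpha>) gchoose n)\<^sup>2 \<le> C * ((real n + 2 * \<alpha>) gchoose n)"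
proof -
  have s: "summable (\<lambda>k. inverse (real (Suc k) ^ 2))"
    by (rule summable_Suc_iff[of "\<lambda>k. inverse (real k ^ 2)", THEN iffD2], rule inverse_power_summable) simp
  define E where "E n = exp (\<alpha>\<^sup>2 * (\<Sum>k<n. inverse (real (Suc k) ^ 2)))" for n
  have le: "((real n + \<alpha>) gchoose n)\<^sup>2 \<le> E n * ((real n + 2 * \<alpha>) gchoose n)" for n
  proof (induction n)
    case 0
    then show ?case by (simp add: E_def)
  next
    case (Suc n)
    define x where "x = \<alpha> / Suc n"
    have x: "x \<ge> 0" using assms by (simp add: x_def)
    have "(1 + x)\<^sup>2 \<le> (1 + x\<^sup>2) * (1 + 2 * x)"
      using x by (simp add: power2_eq_square algebra_simps)
    also have "\<dots> \<le> exp (x\<^sup>2) * (1 + 2 * x)"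
      using x by (intro mult_right_mono exp_ge_add_one_self) auto
    finally have 1: "(1 + x)\<^sup>2 \<le> exp (x\<^sup>2) * (1 + 2 * x)" .
    have "((real (Suc n) + \<alpha>) gchoose Suc n)\<^sup>2 = (1 + x)\<^sup>2 * ((real n + \<alpha>) gchoose n)\<^sup>2"
      unfolding gchoose_diagonal_Suc x_def by (simp add: power_mult_distrib)
    also have "\<dots> \<le> (exp (x\<^sup>2) * (1 + 2 * x)) * (E n * ((real n + 2 * \<alpha>) gchoose n))"
      using x by (intro mult_mono 1 Suc.IH) auto
    also have "\<dots> = (E n * exp (x\<^sup>2)) * ((1 + 2 * x) * ((real n + 2 * \<alpha>) gchoose n))"
      by (simp only: mult_ac)
    also have "E n * exp (x\<^sup>2) = E (Suc n)"
      unfolding E_def x_def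
      by (simp add: distrib_left divide_inverse power_mult_distrib power_inverse flip: exp_add)
    also have "(1 + 2 * x) * ((real n + 2 * \<alpha>) gchoose n) = ((real (Suc n) + 2 * \<alpha>) gchoose Suc n)"
      unfolding gchoose_diagonal_Suc x_def by simp
    finally show ?case .
  qed
  define C where "C = exp (\<alpha>\<^sup>2 * (\<Sum>k. inverse (real (Suc k) ^ 2)))"
  have EC: "E n \<le> C" for n
    unfolding E_def C_def by (intro exp_le_cancel_iff[THEN iffD2] mult_left_mono sum_le_suminf s) auto
  show ?thesis
  proof (rule that[of C])
    show "((real n + \<alpha>) gchoose n)\<^sup>2 \<le> C * ((real n + 2 * \<alpha>) gchoose n)" for n
      using le[of n] mult_right_mono[OF EC[of n], of "(real n + 2 * \<alpha>) gchoose n"]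
        gchoose_diagonal_pos[of "2 * \<alpha>" n] assms by linarith
  qed (simp add: C_def)
qed

text \<open>Upper negation turns this into the binomial series with exponent
  \<open>- \<alpha> - 1\<close>.\<close>

lemma gchoose_diagonal_sums:
  assumes "0 \<le> r" "r < 1"
  shows "(\<lambda>n. ((real n + \<alpha>) gchoose n) * r ^ n) sums (1 - r) powr (- \<alpha> - 1)"
proof -
  have "(\<lambda>n. ((- \<alpha> - 1) gchoose n) * (- r) ^ n) sums (1 + - r) powr (- \<alpha> - 1)"
    by (rule gen_binomial_real) (use assms in auto)
  moreover have "((- \<alpha> - 1) gchoose n) * (- r) ^ n = ((real n + \<alpha>) gchoose n) * r ^ n" for n
  proof -
    have e: "- \<alpha> - 1 = - (\<alpha> + 1)" by simp
    show ?thesis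
      unfolding add.commute[of "real n" \<alpha>] gbinomial_minus' power_minus[of r] e by (simp only: mult_ac)
  qed
  ultimately show ?thesis by simp
qed

text \<open>Cauchy-Schwarz with \<open>|z|^j\<close> shared equally between the factors bounds
  \<open>|\<Phi> z|^2\<close> by \<open>\<Sum>j. |\<phi> j|^2 r^j\<close> times a geometric series.
  That product has the partial sums in \<open>S\<close> as its coefficients, so it is at most
  \<open>C (1 - r)^(- 2 \<alpha> - 1)\<close>; the square root gives the exponent.\<close>

lemma power_series_growth:
  assumes \<phi>: "pser \<Phi> \<phi>" and z: "cmod z < 1" and \<alpha>: "\<alpha> \<ge> 0"
    and S: "\<And>n. (\<Sum>i\<le>n. (cmod (\<phi> i))\<^sup>2) \<le> C * ((real n + 2 * \<alpha>) gchoose n)"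
  shows "cmod (\<Phi> z) \<le> sqrt C * (1 - cmod z) powr (- \<alpha> - 1/2)"
proof -
  define r where "r = cmod z"
  have r: "0 \<le> r" "r < 1" using z by (auto simp: r_def)
  have C: "C \<ge> 0"
    using order_trans[OF _ S[of 0], of 0] by simp
  note gs = gchoose_diagonal_sums[OF r, of "2 * \<alpha>"]
  have t: "summable (\<lambda>j. (cmod (\<phi> j))\<^sup>2 * r ^ j)"
  proof (rule summable_comparison_test'[where N = 0])
    show "summable (\<lambda>j. C * (((real j + 2 * \<alpha>) gchoose j) * r ^ j))"
      using gs by (intro summable_mult) (simp add: sums_iff)
    show "norm ((cmod (\<phi> j))\<^sup>2 * r ^ j) \<le> C * (((real j + 2 * \<alpha>) gchoose j) * r ^ j)" for j
    proof -
      have "(cmod (\<phi> j))\<^sup>2 \<le> (\<Sum>i\<le>j. (cmod (\<phi> i))\<^sup>2)" by (intro member_le_sum) auto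
      with S[of j] have "(cmod (\<phi> j))\<^sup>2 \<le> C * ((real j + 2 * \<alpha>) gchoose j)" by linarith
      from mult_right_mono[OF this, of "r ^ j"] show ?thesis using r by (simp add: mult.assoc)
    qed
  qed
  have geo: "(\<lambda>j. r ^ j) sums (1 / (1 - r))" by (intro geometric_sums) (use r in simp)
  \<comment> \<open>For \<open>z = 0\<close> this is 0, hence only \<open>|u| \<le> 1\<close> is
    claimed.\<close>
  define u where "u = sgn z"
  have u: "z = u * of_real r" "cmod u \<le> 1" by (auto simp: u_def r_def sgn_eq norm_divide)
  have sq: "(sqrt r ^ j)\<^sup>2 = r ^ j" for j
    using r by (metis power_mult mult.commute real_sqrt_pow2)
  have f2: "(cmod (\<phi> j * of_real (sqrt r) ^ j))\<^sup>2 = (cmod (\<phi> j))\<^sup>2 * r ^ j" for j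
    using r by (simp add: norm_mult norm_power power_mult_distrib sq)
  have x2: "(cmod ((u * of_real (sqrt r)) ^ j))\<^sup>2 \<le> r ^ j" for j
  proof -
    have "(cmod ((u * of_real (sqrt r)) ^ j))\<^sup>2 = ((cmod u * sqrt r)\<^sup>2) ^ j"
      using r by (simp add: norm_mult norm_power mult.commute flip: power_mult)
    also have "\<dots> = ((cmod u)\<^sup>2 * r) ^ j" using r by (simp add: power_mult_distrib)
    also have "\<dots> \<le> r ^ j"
      using r u(2) by (intro power_mono) (auto simp: mult_left_le_one_le power_le_one)
    finally show ?thesis .
  qed
  have xs: "summable (\<lambda>j. (cmod ((u * of_real (sqrt r)) ^ j))\<^sup>2)"
  proof (rule summable_comparison_test'[where N = 0 and g = "\<lambda>j. r ^ j"])
    show "summable (\<lambda>j. r ^ j)" using geo by (rule sums_summable)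
    show "norm ((cmod ((u * of_real (sqrt r)) ^ j))\<^sup>2) \<le> r ^ j" for j
      using x2[of j] by (simp only: real_norm_def abs_power2)
  qed
  have "(\<lambda>j. \<phi> j * of_real (sqrt r) ^ j * (u * of_real (sqrt r)) ^ j) sums \<Phi> z"
  proof -
    have "z = of_real (sqrt r) * (u * of_real (sqrt r))"
      using r u(1) by (simp add: mult.left_commute flip: of_real_mult)
    then have e: "\<phi> j * z ^ j = \<phi> j * of_real (sqrt r) ^ j * (u * of_real (sqrt r)) ^ j" for j
      by (metis power_mult_distrib mult.assoc)
    show ?thesis using pser_sums[OF \<phi> z] unfolding e .
  qed
  from Cauchy_Schwarz_sums[OF this _ xs]
  have "(cmod (\<Phi> z))\<^sup>2 \<le> (\<Sum>j. (cmod (\<phi> j))\<^sup>2 * r ^ j) * (\<Sum>j. (cmod ((u * of_real (sqrt r)) ^ j))\<^sup>2)"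
    unfolding f2 using t by simp
  also have "\<dots> \<le> (\<Sum>j. (cmod (\<phi> j))\<^sup>2 * r ^ j) * (\<Sum>j. r ^ j)"
    using geo r by (intro mult_left_mono suminf_le x2 xs suminf_nonneg t) (auto simp: sums_iff)
  also have "\<dots> = (\<Sum>k. \<Sum>i\<le>k. (cmod (\<phi> i))\<^sup>2 * r ^ i * r ^ (k - i))"
    using Cauchy_product_sums[of "\<lambda>j. (cmod (\<phi> j))\<^sup>2 * r ^ j" "\<lambda>j. r ^ j"] t geo r by (simp add: sums_iff)
  also have "\<dots> \<le> (\<Sum>k. C * (((real k + 2 * \<alpha>) gchoose k) * r ^ k))"
  proof (rule suminf_le)
    show "(\<Sum>i\<le>k. (cmod (\<phi> i))\<^sup>2 * r ^ i * r ^ (k - i)) \<le> C * (((real k + 2 * \<alpha>) gchoose k) * r ^ k)" for k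
    proof -
      have "(\<Sum>i\<le>k. (cmod (\<phi> i))\<^sup>2 * r ^ i * r ^ (k - i)) = (\<Sum>i\<le>k. (cmod (\<phi> i))\<^sup>2) * r ^ k"
        unfolding sum_distrib_right by (intro sum.cong refl) (simp add: mult.assoc flip: power_add)
      then show ?thesis using mult_right_mono[OF S[of k], of "r ^ k"] r by (simp add: mult.assoc)
    qed
    show "summable (\<lambda>k. \<Sum>i\<le>k. (cmod (\<phi> i))\<^sup>2 * r ^ i * r ^ (k - i))"
      using Cauchy_product_sums[of "\<lambda>j. (cmod (\<phi> j))\<^sup>2 * r ^ j" "\<lambda>j. r ^ j"] t geo r by (simp add: sums_iff)
    show "summable (\<lambda>k. C * (((real k + 2 * \<alpha>) gchoose k) * r ^ k))"
      using gs by (intro summable_mult) (simp add: sums_iff)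
  qed
  also have "\<dots> = C * (1 - r) powr (- (2 * \<alpha>) - 1)"
    using sums_mult[OF gs, of C] by (simp add: sums_iff)
  also have "\<dots> = (sqrt C * (1 - r) powr (- \<alpha> - 1/2))\<^sup>2"
  proof -
    have "(- \<alpha> - 1/2) + (- \<alpha> - 1/2) = - (2 * \<alpha>) - 1" by simp
    then show ?thesis using C unfolding power_mult_distrib
      by (simp only: real_sqrt_pow2 power2_eq_square[of "_ powr _"] flip: powr_add)
  qed
  finally have "cmod (\<Phi> z) \<le> sqrt C * (1 - r) powr (- \<alpha> - 1/2)"
    by (rule power2_le_imp_le) (use C in simp)
  then show ?thesis by (simp add: r_def)
qed

lemma taylor_coeff_add:
  assumes "f holomorphic_on ball 0 1" "g holomorphic_on ball 0 1"
  shows "taylor_coeff (\<lambda>z. f z + g z) j = taylor_coeff f j + taylor_coeff g j"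
  using taylor_coeff_pser[OF pser_add[OF pser_taylor[OF assms(1)] pser_taylor[OF assms(2)]]] by simp

lemma taylor_coeff_cmult:
  assumes "f holomorphic_on ball 0 1"
  shows "taylor_coeff (\<lambda>z. c * f z) j = c * taylor_coeff f j"
  using taylor_coeff_pser[OF pser_cmult[OF pser_taylor[OF assms]]] by simp

lemma cesaro_add:
  assumes "f holomorphic_on ball 0 1" "g holomorphic_on ball 0 1"
  shows "cesaro \<alpha> n (\<lambda>z. f z + g z) = (\<lambda>z. cesaro \<alpha> n f z + cesaro \<alpha> n g z)"
  by (rule ext) (simp only: cesaro_def taylor_coeff_add[OF assms] distrib_left distrib_right sum.distrib)

lemma cesaro_cmult:
  assumes "f holomorphic_on ball 0 1"
  shows "cesaro \<alpha> n (\<lambda>z. c * f z) = (\<lambda>z. c * cesaro \<alpha> n f z)"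
  by (simp add: cesaro_def taylor_coeff_cmult[OF assms] sum_distrib_left mult_ac fun_eq_iff)

text \<open>Only the top coefficient survives, which is what makes the Cesaro means yield a bound for the
  norm of \<open>z\<^sup>n\<close>.\<close>

lemma cesaro_shift:
  assumes "f holomorphic_on ball 0 1"
  shows "cesaro \<alpha> n (\<lambda>z. f z * z ^ n) = (\<lambda>z. (f 0 / of_real ((real n + \<alpha>) gchoose n)) * z ^ n)"
proof -
  note f = pser_taylor[OF assms]
  have m: "pser (\<lambda>z. z ^ n) (\<lambda>j. if j = n then 1 else 0)"
  proof -
    have "(\<lambda>j. (if j = n then 1 else 0) * z ^ j) sums (z ^ n)" for z :: complex
      using sums_single[of n "\<lambda>j. z ^ j"] by (rule sums_cong[THEN iffD1, rotated]) auto
    then show ?thesis by (simp add: pser_def)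
  qed
  have tc: "taylor_coeff (\<lambda>z. z ^ n * f z) j = (\<Sum>i\<le>j. (if i = n then 1 else 0) * taylor_coeff f (j - i))" for j
    using taylor_coeff_pser[OF pser_mult[OF m f]] by (rule fun_cong)
  have lo: "taylor_coeff (\<lambda>z. f z * z ^ n) j = 0" if "j < n" for j
    using tc[of j] that by (simp add: mult.commute)
  have top: "taylor_coeff (\<lambda>z. f z * z ^ n) n = f 0"
  proof -
    have "(\<Sum>i\<le>n. (if i = n then 1 else 0) * taylor_coeff f (n - i)) = (\<Sum>i\<le>n. if i = n then taylor_coeff f 0 else 0)"
      by (intro sum.cong) auto
    then show ?thesis using tc[of n] by (simp add: mult.commute) (simp add: taylor_coeff_def)
  qed
  have "cesaro \<alpha> n (\<lambda>z. f z * z ^ n) z = (f 0 / of_real ((real n + \<alpha>) gchoose n)) * z ^ n" for z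
  proof -
    have "cesaro \<alpha> n (\<lambda>z. f z * z ^ n) z = (\<Sum>j\<in>{n}. complex_of_real (real (n choose j) / ((real n + \<alpha>) gchoose j))
                        * taylor_coeff (\<lambda>z. f z * z ^ n) j * z ^ j)"
      unfolding cesaro_def by (rule sum.mono_neutral_right) (auto simp: lo)
    then show ?thesis by (simp add: top)
  qed
  then show ?thesis by blast
qed

section \<open>Cesaro means as operators on H(b)\<close>

context Hb_space
begin

text \<open>Cauchy's estimate on \<open>|z| = 1/2\<close>, where \<open>Hb_eval_bound\<close> gives
  \<open>2 * N f\<close>.\<close>

lemma taylor_coeff_bound:
  assumes f: "in_Hb b f" and hol: "f holomorphic_on ball 0 1"
  shows "cmod (taylor_coeff f j) \<le> 2 ^ (j + 1) * N f"
proof -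
  have c: "cball 0 (1/2) \<subseteq> ball (0::complex) 1" by auto
  have "cmod ((deriv ^^ j) f 0) \<le> fact j * (2 * N f) / (1/2) ^ j"
  proof (rule Cauchy_inequality)
    show "f holomorphic_on ball 0 (1/2)" by (rule holomorphic_on_subset[OF hol]) auto
    show "continuous_on (cball 0 (1/2)) f"
      by (rule holomorphic_on_imp_continuous_on[OF holomorphic_on_subset[OF hol c]])
    show "cmod (f x) \<le> 2 * N f" if "cmod (0 - x) = 1/2" for x
    proof -
      have "cmod x = 1/2" using that by simp
      then have "cmod (f x) \<le> N f / (1 - 1/2)" using Hb_eval_bound[OF f, of x] by (simp only:)
      then show ?thesis by simp
    qed
  qed simp
  then show ?thesis by (simp add: taylor_coeff_def norm_divide field_simps power_divide)
qed

text \<open>For fixed \<open>n\<close> a finite sum, so crude constants suffice; uniformity in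
  \<open>n\<close> is left to Banach-Steinhaus.\<close>

lemma cesaro_bounded:
  assumes z: "\<And>j. in_Hb b (\<lambda>z. z ^ j)"
  shows "\<exists>C. \<forall>x\<in>{x. in_Hb b x \<and> x holomorphic_on ball 0 1}. N (cesaro \<alpha> n x) \<le> C * N x"
proof -
  define w where "w j = complex_of_real (real (n choose j) / ((real n + \<alpha>) gchoose j))" for j
  have "N (cesaro \<alpha> n x) \<le> (\<Sum>j=0..n. cmod (w j) * 2 ^ (j + 1) * N (\<lambda>z. z ^ j)) * N x"
    if x: "in_Hb b x" "x holomorphic_on ball 0 1" for x
  proof -
    have "N (cesaro \<alpha> n x) = N (\<lambda>z. \<Sum>j=0..n. (w j * taylor_coeff x j) * z ^ j)"
      by (simp add: cesaro_def[abs_def] w_def)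
    also have "\<dots> \<le> (\<Sum>j=0..n. N (\<lambda>z. (w j * taylor_coeff x j) * z ^ j))"
      by (intro in_Hb_sum in_Hb_scale z) auto
    also have "\<dots> \<le> (\<Sum>j=0..n. (cmod (w j) * 2 ^ (j + 1) * N (\<lambda>z. z ^ j)) * N x)"
    proof (intro sum_mono)
      fix j
      have "N (\<lambda>z. (w j * taylor_coeff x j) * z ^ j) = cmod (w j) * cmod (taylor_coeff x j) * N (\<lambda>z. z ^ j)"
        unfolding Hb_norm_scale[OF z] norm_mult ..
      also have "\<dots> \<le> cmod (w j) * (2 ^ (j + 1) * N x) * N (\<lambda>z. z ^ j)"
        by (intro mult_right_mono mult_left_mono taylor_coeff_bound x Hb_norm_nonneg z) auto
      finally show "N (\<lambda>z. (w j * taylor_coeff x j) * z ^ j) \<le> (cmod (w j) * 2 ^ (j + 1) * N (\<lambda>z. z ^ j)) * N x"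
        by (simp add: mult_ac)
    qed
    finally show ?thesis by (simp add: sum_distrib_right)
  qed
  then show ?thesis by blast
qed

text \<open>Both notions of convergence include membership of every \<open>F n\<close>. Boundedness
  is uniform boundedness in the weak case and the triangle inequality in the norm case.\<close>

lemma convergent_imp_norm_bounded:
  assumes h: "in_Hb b h" and conv: "Hb_weak_conv b F h \<or> Hb_norm_conv b F h"
  shows "in_Hb b (F n)" "\<exists>M. \<forall>n. N (F n) \<le> M"
proof -
  show Fin: "in_Hb b (F n)" for n using conv by (auto simp: Hb_weak_conv_def Hb_norm_conv_def)
  from conv show "\<exists>M. \<forall>n. N (F n) \<le> M"
  proof
    assume w: "Hb_weak_conv b F h"
    show ?thesis
    proof (rule weakly_bounded_imp_bounded[OF Fin])
      fix g assume "in_Hb b g"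
      then have "(\<lambda>n. Hb_inner b (F n) g) \<longlonglongrightarrow> Hb_inner b h g" using w by (auto simp: Hb_weak_conv_def)
      then have "(\<lambda>n. re_inner (F n) g) \<longlonglongrightarrow> re_inner h g"
        unfolding Re_Hb_inner[symmetric] by (rule tendsto_Re)
      then have "Bseq (\<lambda>n. re_inner (F n) g)" by (intro convergent_imp_Bseq convergentI)
      then show "\<exists>M. \<forall>n. \<bar>re_inner (F n) g\<bar> \<le> M" by (auto simp: Bseq_def)
    qed
  next
    assume "Hb_norm_conv b F h"
    then have "Bseq (\<lambda>n. N (\<lambda>z. F n z - h z))"
      by (intro convergent_imp_Bseq convergentI) (auto simp: Hb_norm_conv_def)
    then obtain M where "\<And>n. norm (N (\<lambda>z. F n z - h z)) \<le> M" unfolding Bseq_def by blast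
    then have M: "N (\<lambda>z. F n z - h z) \<le> M" for n using abs_le_D1 by (metis real_norm_def)
    have "N (F n) \<le> M + N h" for n
      using in_Hb_add(2)[OF in_Hb_diff(1)[OF Fin[of n] h] h] M[of n] by simp
    then show ?thesis by blast
  qed
qed

end

theorem theorem6p12:
  fixes b a :: "complex \<Rightarrow> complex" and \<alpha> :: real
  assumes b_ball: "Hinf_ball b"
    and b_nonext: "\<not> extreme_Hinf b"
    and a_outer: "outer a"
    and a0: "Im (a 0) = 0" "Re (a 0) > 0"
    and a_bdry: "AE t in lebesgue_on {0..2*pi}. \<exists>A B. radial_limit a t A \<and> radial_limit b t B \<and>
                    (cmod A)^2 + (cmod B)^2 = 1"
    and alpha: "\<alpha> \<ge> 0"
    and conv: "(\<forall>h. in_Hb b h \<longrightarrow> Hb_weak_conv b (\<lambda>n. cesaro \<alpha> n h) h) \<or>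
               (\<forall>h. in_Hb b h \<longrightarrow> Hb_norm_conv b (\<lambda>n. cesaro \<alpha> n h) h)"
  shows "\<exists>C r0. r0 < 1 \<and> (\<forall>z. r0 < cmod z \<and> cmod z < 1 \<longrightarrow>
           cmod (b z / a z) \<le> C * (1 - cmod z) powr (- \<alpha> - 1/2))"
proof -
  note ahol = outer_approximate_inverse(1)[OF a_outer] and anz = outer_approximate_inverse(2)[OF a_outer]
  obtain g :: "nat \<Rightarrow> complex \<Rightarrow> complex" where g: "\<And>k. g k holomorphic_on ball 0 1"
      "\<And>k z. z \<in> ball 0 1 \<Longrightarrow> cmod (g k z) \<le> exp k"
      "\<And>k z. z \<in> ball 0 1 \<Longrightarrow> cmod (a z * g k z) \<le> 1" "(\<lambda>k. a 0 * g k 0) \<longlonglongrightarrow> 1"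
    and gnz: "g 0 0 \<noteq> 0"
    using outer_approximate_inverse(3)[OF a_outer] by (metis centre_in_ball zero_less_one)
  have ae: "AE t in lebesgue_on {0..2*pi}.
        ((\<lambda>r. (cmod (b (of_real r * cis t)))\<^sup>2 + (cmod (a (of_real r * cis t)))\<^sup>2) \<longlongrightarrow> 1) (at_left 1)"
    using a_bdry
  proof eventually_elim
    fix t assume "\<exists>A B. radial_limit a t A \<and> radial_limit b t B \<and> (cmod A)\<^sup>2 + (cmod B)\<^sup>2 = 1"
    then obtain A B where AB: "radial_limit a t A" "radial_limit b t B" "(cmod A)\<^sup>2 + (cmod B)\<^sup>2 = 1" by blast
    have "((\<lambda>r. (cmod (b (of_real r * cis t)))\<^sup>2 + (cmod (a (of_real r * cis t)))\<^sup>2) \<longlongrightarrow> (cmod B)\<^sup>2 + (cmod A)\<^sup>2) (at_left 1)"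
      using AB(1,2) unfolding radial_limit_def by (intro tendsto_intros)
    then show "((\<lambda>r. (cmod (b (of_real r * cis t)))\<^sup>2 + (cmod (a (of_real r * cis t)))\<^sup>2) \<longlongrightarrow> 1) (at_left 1)"
      using AB(3) by (simp add: add.commute)
  qed
  \<comment> \<open>Index 0 gives \<open>|g 0| \<le> exp 0 = 1\<close>, so
    \<open>|f| \<le> |a|\<close> on the disc, while \<open>f\<close> does not vanish at the
    origin.\<close>
  define f where "f z = a z * g 0 z" for z
  have fhol: "f holomorphic_on ball 0 1" unfolding f_def by (intro holomorphic_intros ahol g)
  have f: "Hinf_ball f" using fhol g(3)[of _ 0] by (simp add: Hinf_ball_def f_def)
  have fa: "cmod (f z) \<le> cmod (a z)" if "z \<in> ball 0 1" for z
    using g(2)[OF that, of 0] by (simp add: f_def norm_mult mult_left_le)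
  have f0: "f 0 \<noteq> 0" using gnz anz[of 0] by (simp add: f_def)
  have aef: "AE t in lebesgue_on {0..2*pi}. \<exists>e. (e \<longlongrightarrow> 0) (at_left 1) \<and>
        (\<forall>r\<in>{0..<1}. (cmod (b (of_real r * cis t)))\<^sup>2 + (cmod (f (of_real r * cis t)))\<^sup>2 \<le> 1 + e r)"
    using ae
  proof eventually_elim
    fix t
    define E where "E r = (cmod (b (of_real r * cis t)))\<^sup>2 + (cmod (a (of_real r * cis t)))\<^sup>2" for r
    assume "((\<lambda>r. (cmod (b (of_real r * cis t)))\<^sup>2 + (cmod (a (of_real r * cis t)))\<^sup>2) \<longlongrightarrow> 1) (at_left 1)"
    then have "((\<lambda>r. E r - 1) \<longlongrightarrow> 1 - 1) (at_left 1)" unfolding E_def by (intro tendsto_intros)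
    moreover have "(cmod (b (of_real r * cis t)))\<^sup>2 + (cmod (f (of_real r * cis t)))\<^sup>2 \<le> 1 + (E r - 1)"
      if "r \<in> {0..<1}" for r
      using power_mono[OF fa[of "of_real r * cis t"], of 2] that by (simp add: E_def norm_mult)
    ultimately show "\<exists>e. (e \<longlongrightarrow> 0) (at_left 1) \<and>
        (\<forall>r\<in>{0..<1}. (cmod (b (of_real r * cis t)))\<^sup>2 + (cmod (f (of_real r * cis t)))\<^sup>2 \<le> 1 + e r)"
      by (intro exI[of _ "\<lambda>r. E r - 1"]) auto
  qed
  have f1: "cmod (f z) \<le> 1" if "z \<in> ball 0 1" for z using f that by (simp add: Hinf_ball_def)
  \<comment> \<open>A single term of the second series in \<open>row_contraction\<close>. It yields
    both positivity of the kernel and norm at most 1 for all \<open>f z^n\<close>.\<close>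
  have fQ: "(cmod (l (\<lambda>z. f z * z ^ n)))\<^sup>2 \<le> defect_form b l" if l: "l \<in> point_combinations" for l n
  proof -
    have "(\<Sum>m\<in>{n}. (cmod (l (\<lambda>z. f z * z ^ m)))\<^sup>2) \<le> (\<Sum>m. (cmod (l (\<lambda>z. f z * z ^ m)))\<^sup>2)"
      by (intro sum_le_suminf moments_square_summable l f1) auto
    then show ?thesis
      using row_contraction[OF b_ball f aef l] by (simp add: defect_form_eq[OF b_ball l])
  qed
  interpret Hb_space b
    by unfold_locales (use b_ball fQ order_trans[OF zero_le_power2] in blast)+
  have fn: "in_Hb b (\<lambda>z. f z * z ^ n)" "N (\<lambda>z. f z * z ^ n) \<le> 1" for n
    using in_Hb_leI[of 1 "\<lambda>z. f z * z ^ n"] fQ by auto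
  have fnhol: "(\<lambda>z. f z * z ^ n) holomorphic_on ball 0 1" for n
    by (intro holomorphic_intros fhol)
  have cb: "in_Hb b (cesaro \<alpha> n h)" "\<exists>M. \<forall>n. N (cesaro \<alpha> n h) \<le> M" if "in_Hb b h" for h n
    using convergent_imp_norm_bounded[OF that, of "\<lambda>n. cesaro \<alpha> n h"] conv that by auto
  define \<kappa> where "\<kappa> n = f 0 / of_real ((real n + \<alpha>) gchoose n)" for n
  have cf: "cesaro \<alpha> n (\<lambda>z. f z * z ^ n) = (\<lambda>z. \<kappa> n * z ^ n)" for n
    unfolding \<kappa>_def by (rule cesaro_shift[OF fhol])
  have knz: "\<kappa> n \<noteq> 0" for n
    using f0 gchoose_diagonal_pos[OF alpha, of n] by (simp add: \<kappa>_def)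
  \<comment> \<open>The convergence hypothesis places the Cesaro mean of \<open>f z^n\<close> in
    H(b), and this mean is a nonzero multiple of \<open>z^n\<close>.\<close>
  have zin: "in_Hb b (\<lambda>z. z ^ n)" for n
    using in_Hb_scale[OF cb(1)[OF fn(1)[of n], of n], of "1 / \<kappa> n"] knz[of n] unfolding cf by simp
  have "\<exists>M. \<forall>n. \<forall>x\<in>{x. in_Hb b x \<and> x holomorphic_on ball 0 1}. N (cesaro \<alpha> n x) \<le> M * N x"
    by (rule operators_uniformly_bounded)
       (use cb cesaro_add cesaro_cmult cesaro_bounded[OF zin] in blast)+
  then obtain M where M: "\<And>n x. in_Hb b x \<Longrightarrow> x holomorphic_on ball 0 1 \<Longrightarrow> N (cesaro \<alpha> n x) \<le> M * N x"
    by blast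
  have "N (\<lambda>z. \<kappa> n * z ^ n) \<le> \<bar>M\<bar>" for n
  proof -
    have "N (\<lambda>z. \<kappa> n * z ^ n) \<le> M * N (\<lambda>z. f z * z ^ n)"
      using M[OF fn(1) fnhol, of n n] unfolding cf .
    also have "\<dots> \<le> \<bar>M\<bar> * 1"
      using fn(2)[of n] Hb_norm_nonneg[OF fn(1), of n] by (intro mult_mono) auto
    finally show ?thesis by simp
  qed
  then have kl: "(cmod (l (\<lambda>z. \<kappa> n * z ^ n)))\<^sup>2 \<le> M\<^sup>2 * defect_form b l" if "l \<in> point_combinations" for l n
    using Hb_norm_bound[OF in_Hb_scale[OF zin] that, of "\<kappa> n" n]
      mult_right_mono[OF power_mono[of "N (\<lambda>z. \<kappa> n * z ^ n)" "\<bar>M\<bar>" 2] defect_nonneg[OF that]]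
      Hb_norm_nonneg[OF in_Hb_scale[OF zin]] by fastforce
  define \<phi> where "\<phi> = taylor_coeff (\<lambda>z. b z / a z)"
  have \<phi>: "pser (\<lambda>z. b z / a z) \<phi>"
    unfolding \<phi>_def using b_ball anz
    by (intro pser_taylor holomorphic_intros ahol) (auto simp: Hinf_ball_def)
  obtain C where C: "C > 0" "\<And>n. ((real n + \<alpha>) gchoose n)\<^sup>2 \<le> C * ((real n + 2 * \<alpha>) gchoose n)"
    using gchoose_diagonal_square_le[OF alpha] by blast
  \<comment> \<open>\<open>M\<close> bounds the Cesaro operators, \<open>f 0\<close> enters through
    \<open>\<kappa> n\<close>, and \<open>C\<close> is the cost of replacing the squared binomial
    coefficient.\<close>
  define C' where "C' = (M\<^sup>2 / (cmod (f 0))\<^sup>2) * C"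
  have S: "(\<Sum>i\<le>n. (cmod (\<phi> i))\<^sup>2) \<le> C' * ((real n + 2 * \<alpha>) gchoose n)" for n
  proof -
    have "(cmod (\<kappa> n))\<^sup>2 * (\<Sum>i\<le>n. (cmod (\<phi> i))\<^sup>2) \<le> M\<^sup>2"
      by (rule monomial_norm_lower_bound[OF b_ball anz g ahol ae \<phi> _ kl]) auto
    moreover have "(cmod (\<kappa> n))\<^sup>2 = (cmod (f 0))\<^sup>2 / ((real n + \<alpha>) gchoose n)\<^sup>2"
      by (simp add: \<kappa>_def norm_divide power_divide)
    ultimately have "(\<Sum>i\<le>n. (cmod (\<phi> i))\<^sup>2) \<le> (M\<^sup>2 / (cmod (f 0))\<^sup>2) * ((real n + \<alpha>) gchoose n)\<^sup>2"
      using f0 gchoose_diagonal_pos[OF alpha, of n] by (simp add: field_simps)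
    also have "\<dots> \<le> (M\<^sup>2 / (cmod (f 0))\<^sup>2) * (C * ((real n + 2 * \<alpha>) gchoose n))"
      by (intro mult_left_mono C(2)) auto
    finally show ?thesis by (simp add: C'_def mult.assoc)
  qed
  have "cmod (b z / a z) \<le> sqrt C' * (1 - cmod z) powr (- \<alpha> - 1/2)" if "cmod z < 1" for z
    by (rule power_series_growth[OF \<phi> that alpha S])
  then show ?thesis by (intro exI[of _ "sqrt C'"] exI[of _ 0]) auto
qed

end
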